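(* Let $n,k$ be positive integers and $\epsilon\in(0,1)$. There exist absolute constants $\alpha, \beta > 1$ such that for any fixed constant $C_L>1$ there is a randomized construction of a matrix $\Phi \in \mathbb{R}^{m\times n}$ with $m = O( (k/\epsilon ) \cdot \log(1/\epsilon))$ and column sparsity $O(\log(1/\epsilon))$ such that the following holds for every fixed $x\in\mathbb{R}^n$. Suppose one is given a (fixed) set $L \subseteq [n]$ such that \[ |L| = C_L \cdot k/\epsilon \quad\text{and}\quad \exists\, T \subset L,\ |T| \leq k:\ \|x - x_T \|_2 \leq ( 1+\epsilon) \|x_{-k}\|_2 .\] Then from $\Phi x$ and $L$ one can find, in time $O(m)$, a set $S$ of size $\beta k$ such that \[ \|x - x_{S} \|_2 \leq (1 + \alpha \epsilon) \|x_{-k}\|_2 \] holds with probability $9/10$.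
   Context: For $x\in\mathbb{R}^n$, $H(x,k)$ denotes the set of indices of the $k$ largest-magnitude coordinates of $x$; for $S\subseteq[n]$, $x_S$ is $x$ with all coordinates outside $S$ set to zero; $x_{-k} = x_{[n]\setminus H(x,k)}$. Column sparsity is the maximum number of nonzero entries in a column.
   Formalization: In the bounds on m and on the column sparsity, log(1/ε) is read as max(1, log(1/ε)); with the literal logarithm the bounds tend to 0 as ε tends to 1, forcing Φ = 0, and the claim fails. *)

theory Defs
  imports "HOL-Probability.Probability_Mass_Function" "Jordan_Normal_Form.Matrix"
begin

unbundle no vec_syntax

section \<open>Sparse approximation\<close>

definition l2_norm :: "real Matrix.vec \<Rightarrow> real" where
  "l2_norm x = L2_set (\<lambda>i. x $ i) {..<dim_vec x}"

definition restr :: "real Matrix.vec \<Rightarrow> nat set \<Rightarrow> real Matrix.vec" where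
  "restr x S = Matrix.vec (dim_vec x) (\<lambda>i. if i \<in> S then x $ i else 0)"

text \<open>Coordinates are numbered from 0. Ties in magnitude are broken in favour of the smaller index;
  if k exceeds the dimension, all indices are taken.\<close>

definition heavy :: "real Matrix.vec \<Rightarrow> nat \<Rightarrow> nat set" where
  "heavy x k = {i. i < dim_vec x \<and>
     card {j. j < dim_vec x \<and>
       (\<bar>x $ j\<bar> > \<bar>x $ i\<bar> \<or> (\<bar>x $ j\<bar> = \<bar>x $ i\<bar> \<and> j < i))} < k}"

definition tail :: "real Matrix.vec \<Rightarrow> nat \<Rightarrow> real Matrix.vec" where
  "tail x k = restr x ({..<dim_vec x} - heavy x k)"

definition column_sparsity :: "real mat \<Rightarrow> nat" where
  "column_sparsity A =
     Max ((\<lambda>j. card {i. i < dim_row A \<and> A $$ (i, j) \<noteq> 0}) ` {..<dim_col A})"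

text \<open>The logarithmic factor in asymptotic bounds. It equals log(1/eps) for eps at most 1/e; the
  maximum with 1 keeps the bounds from degenerating to 0 as eps tends to 1.\<close>

definition log_inv :: "real \<Rightarrow> real" where
  "log_inv \<epsilon> = max 1 (ln (1 / \<epsilon>))"

section \<open>A RAM with bounded words and real registers\<close>

text \<open>Programs work on named arrays of natural numbers and named arrays of reals; a scalar variable
  is cell 0 of an array. Every natural number an expression computes, and hence every address, is
  reduced modulo the word bound W. Real arithmetic is exact; reals can be compared, but not
  converted to words (no rounding), and the only literal constants are natural numbers. These
  restrictions keep unit costs honest: words have about log W bits, and a program cannot store
  unbounded advice in a real constant.\<close>

record ram =
  wmem :: "string \<Rightarrow> nat \<Rightarrow> nat"
  rmem :: "string \<Rightarrow> nat \<Rightarrow> real"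

datatype wexp =
    WConst nat
  | WMem string wexp
  | WAdd wexp wexp
  | WSub wexp wexp
  | WMul wexp wexp
  | WDiv wexp wexp
  | WMod wexp wexp

datatype rexp =
    OfWord wexp
  | RMem string wexp
  | RAdd rexp rexp
  | RSub rexp rexp
  | RMul rexp rexp
  | RDiv rexp rexp

datatype bexp =
    WLess wexp wexp
  | RLess rexp rexp
  | Neg bexp
  | Conj bexp bexp

text \<open>Subtraction is truncated at 0, and division by 0 yields 0.\<close>

fun wval :: "nat \<Rightarrow> ram \<Rightarrow> wexp \<Rightarrow> nat" where
  "wval W s (WConst c) = c mod W"
| "wval W s (WMem a e) = wmem s a (wval W s e) mod W"
| "wval W s (WAdd e f) = (wval W s e + wval W s f) mod W"
| "wval W s (WSub e f) = (wval W s e - wval W s f) mod W"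
| "wval W s (WMul e f) = (wval W s e * wval W s f) mod W"
| "wval W s (WDiv e f) = (wval W s e div wval W s f) mod W"
| "wval W s (WMod e f) = (wval W s e mod wval W s f) mod W"

fun rval :: "nat \<Rightarrow> ram \<Rightarrow> rexp \<Rightarrow> real" where
  "rval W s (OfWord e) = real (wval W s e)"
| "rval W s (RMem a e) = rmem s a (wval W s e)"
| "rval W s (RAdd e f) = rval W s e + rval W s f"
| "rval W s (RSub e f) = rval W s e - rval W s f"
| "rval W s (RMul e f) = rval W s e * rval W s f"
| "rval W s (RDiv e f) = rval W s e / rval W s f"

fun bval :: "nat \<Rightarrow> ram \<Rightarrow> bexp \<Rightarrow> bool" where
  "bval W s (WLess e f) \<longleftrightarrow> wval W s e < wval W s f"
| "bval W s (RLess e f) \<longleftrightarrow> rval W s e < rval W s f"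
| "bval W s (Neg b) \<longleftrightarrow> \<not> bval W s b"
| "bval W s (Conj b c) \<longleftrightarrow> bval W s b \<and> bval W s c"

text \<open>In the assignments, the first expression is the address and the second the value.\<close>

datatype com =
    Skip
  | WAssign string wexp wexp
  | RAssign string wexp rexp
  | Seq com com
  | If bexp com com
  | While bexp com

text \<open>The relation exec W c s t s' holds iff c, started in s, halts in s' after t steps. Assignments
  and tests cost one step; the expressions in a fixed program have bounded size, so
  this is the number of elementary operations up to a constant depending on the program only.\<close>

inductive exec :: "nat \<Rightarrow> com \<Rightarrow> ram \<Rightarrow> nat \<Rightarrow> ram \<Rightarrow> bool" for W :: nat where
  Skip: "exec W Skip s 1 s"
| WAssign: "exec W (WAssign a e f) s 1
    (s\<lparr>wmem := (wmem s)(a := (wmem s a)(wval W s e := wval W s f))\<rparr>)"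
| RAssign: "exec W (RAssign a e f) s 1
    (s\<lparr>rmem := (rmem s)(a := (rmem s a)(wval W s e := rval W s f))\<rparr>)"
| Seq: "exec W c s t s' \<Longrightarrow> exec W d s' u s'' \<Longrightarrow> exec W (Seq c d) s (t + u) s''"
| IfTrue: "bval W s b \<Longrightarrow> exec W c s t s' \<Longrightarrow> exec W (If b c d) s (1 + t) s'"
| IfFalse: "\<not> bval W s b \<Longrightarrow> exec W d s t s' \<Longrightarrow> exec W (If b c d) s (1 + t) s'"
| WhileFalse: "\<not> bval W s b \<Longrightarrow> exec W (While b c) s 1 s"
| WhileTrue: "bval W s b \<Longrightarrow> exec W c s t s' \<Longrightarrow> exec W (While b c) s' u s'' \<Longrightarrow>
    exec W (While b c) s (1 + t + u) s''"

inductive_cases exec_SkipE: "exec W Skip s t s'"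
inductive_cases exec_WAssignE: "exec W (WAssign a e f) s t s'"
inductive_cases exec_RAssignE: "exec W (RAssign a e f) s t s'"
inductive_cases exec_SeqE: "exec W (Seq c d) s t s'"
inductive_cases exec_IfE: "exec W (If b c d) s t s'"
inductive_cases exec_WhileE: "exec W (While b c) s t s'"

lemma exec_deterministic:
  "exec W c s t s' \<Longrightarrow> exec W c s u s'' \<Longrightarrow> u = t \<and> s'' = s'"
proof (induction arbitrary: u s'' rule: exec.induct)
  case (Skip s)
  then show ?case by (rule exec_SkipE) simp
next
  case (WAssign a e f s)
  then show ?case by (rule exec_WAssignE) simp
next
  case (RAssign a e f s)
  then show ?case by (rule exec_RAssignE) simp
next
  case (Seq c s t s' d u' r)
  from Seq.prems obtain t1 s1 t2 where "u = t1 + t2" "exec W c s t1 s1" "exec W d s1 t2 s''"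
    by (rule exec_SeqE)
  with Seq.IH(1)[of t1 s1] Seq.IH(2)[of t2 s''] show ?case by simp
next
  case (IfTrue s b c t s' d)
  from IfTrue.prems IfTrue.hyps(1) obtain t1 where "u = 1 + t1" "exec W c s t1 s''"
    by (auto elim: exec_IfE)
  with IfTrue.IH[of t1 s''] show ?case by simp
next
  case (IfFalse s b d t s' c)
  from IfFalse.prems IfFalse.hyps(1) obtain t1 where "u = 1 + t1" "exec W d s t1 s''"
    by (auto elim: exec_IfE)
  with IfFalse.IH[of t1 s''] show ?case by simp
next
  case (WhileFalse s b c)
  from WhileFalse.prems show ?case
    by (rule exec_WhileE) (use WhileFalse.hyps in simp_all)
next
  case (WhileTrue s b c t s' u' r)
  from WhileTrue.prems obtain t1 s1 t2 where
    "u = 1 + t1 + t2" "exec W c s t1 s1" "exec W (While b c) s1 t2 s''"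
    by (rule exec_WhileE) (use WhileTrue.hyps(1) in simp_all)
  with WhileTrue.IH(1)[of t1 s1] WhileTrue.IH(2)[of t2 s''] show ?case by simp
qed

section \<open>Input and output of the decoder\<close>

definition col_rows :: "real mat \<Rightarrow> nat \<Rightarrow> nat list" where
  "col_rows A j = filter (\<lambda>i. A $$ (i, j) \<noteq> 0) [0..<dim_row A]"

definition nth_or_0 :: "'a::zero list \<Rightarrow> nat \<Rightarrow> 'a" where
  "nth_or_0 xs p = (if p < length xs then xs ! p else 0)"

text \<open>The matrix, with m rows, is given by column adjacency lists: cell j of deg holds the number of
  nonzero entries of column j, and cells j m + t of row and val hold the row index and the value
  of its t-th nonzero entry, in increasing order of rows. The decoder thus has random access to
  the nonzero entries of any column. The index set is given as a list ls of its elements. All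
  cells not mentioned are 0.\<close>

definition decoder_input ::
    "nat \<Rightarrow> nat \<Rightarrow> real \<Rightarrow> real mat \<Rightarrow> real Matrix.vec \<Rightarrow> nat list \<Rightarrow> ram" where
  "decoder_input n k \<epsilon> A y ls =
    (let m = dim_row A in
     \<lparr>wmem = (\<lambda>_ _. 0)
        (''n'' := nth_or_0 [n],
         ''k'' := nth_or_0 [k],
         ''m'' := nth_or_0 [m],
         ''l'' := nth_or_0 [length ls],
         ''L'' := nth_or_0 ls,
         ''deg'' := (\<lambda>j. if j < n then length (col_rows A j) else 0),
         ''row'' := (\<lambda>p. if p < n * m then nth_or_0 (col_rows A (p div m)) (p mod m) else 0)),
      rmem = (\<lambda>_ _. 0)
        (''eps'' := nth_or_0 [\<epsilon>],
         ''y'' := (\<lambda>i. if i < m then y $ i else 0),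
         ''val'' := (\<lambda>p. if p < n * m
            then nth_or_0 (map (\<lambda>i. A $$ (i, p div m)) (col_rows A (p div m))) (p mod m) else 0))\<rparr>)"

text \<open>The output set is listed in array S, with the length of the list in scalar s.\<close>

definition decoder_output :: "ram \<Rightarrow> nat set" where
  "decoder_output s = wmem s ''S'' ` {..<wmem s ''s'' 0}"

end

theory Submission
  imports Defs "HOL-Probability.Product_PMF"
begin

unbundle no vec_syntax

text \<open>The matrix is a CountSketch with about log (1 / eps) blocks of O(k / eps) buckets. As L is known to
  the decoder, it can discard for each i in L the blocks in which i shares its bucket with another
  element of L, so that the remaining noise comes from outside L only and does not depend on the large
  entries. The estimate of the magnitude of entry i is the median of the absolute bucket values over all
  blocks, where discarded blocks count as infinite, and S consists of the 3 k largest estimates. Only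
  about eps |L| elements of L are overestimated noticeably, hence at most k, and the expected square by
  which a fixed element of T is underestimated is at most twice the variance of the noise. Both
  selection problems are solved by median of medians in linear time.\<close>

section \<open>Weakest preconditions with a time budget\<close>

text \<open>The two kinds of error have very different costs. An overestimate only wastes a slot of
  S, whereas losing an element of T can cost arbitrarily much, which a failure probability of
  \<epsilon> per element does not exclude. Counting discarded blocks as infinite lets collisions
  inside L cause overestimates only, so that an underestimate stems from the squared mass F outside
  L alone. This is controlled in second moment: a bucket carries noise of variance F / B, so k
  elements lose O(k F / B) in squared norm. With B of order k / \<epsilon>, and F at most the
  squared error of x_T, the loss is an O(\<epsilon>) fraction of the squared tail. The number d of
  blocks only has to leave at most k elements with many bad blocks, so |L| / 4^d must be small
  against k; hence d is of order log (1 / \<epsilon>), whatever n is. The time bound allows a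
  constant number of steps for each pair of an element of L and a block, since |L| d is at most m.
  Sorting all estimates would exceed it, and as reals cannot be rounded to words and the program has
  no source of randomness, selection is comparison-based and deterministic.\<close>

text \<open>The postcondition also receives the part of the budget that was not spent.\<close>

definition wp :: "nat \<Rightarrow> com \<Rightarrow> (ram \<Rightarrow> nat \<Rightarrow> bool) \<Rightarrow> ram \<Rightarrow> nat \<Rightarrow> bool" where
  "wp W c Q s b \<longleftrightarrow> (\<exists>t s'. exec W c s t s' \<and> t \<le> b \<and> Q s' (b - t))"

definition setw :: "string \<Rightarrow> nat \<Rightarrow> nat \<Rightarrow> ram \<Rightarrow> ram" where
  "setw a i v s = s\<lparr>wmem := (wmem s)(a := (wmem s a)(i := v))\<rparr>"

definition setr :: "string \<Rightarrow> nat \<Rightarrow> real \<Rightarrow> ram \<Rightarrow> ram" where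
  "setr a i v s = s\<lparr>rmem := (rmem s)(a := (rmem s a)(i := v))\<rparr>"

lemma wmem_setw [simp]: "wmem (setw a i v s) b = (if b = a then (wmem s a)(i := v) else wmem s b)"
  and rmem_setw [simp]: "rmem (setw a i v s) = rmem s"
  by (auto simp: setw_def)

lemma wmem_setr [simp]: "wmem (setr a i v s) = wmem s"
  and rmem_setr [simp]: "rmem (setr a i v s) b = (if b = a then (rmem s a)(i := v) else rmem s b)"
  by (auto simp: setr_def)

lemma wp_Skip [simp]: "wp W Skip Q s b \<longleftrightarrow> 0 < b \<and> Q s (b - 1)"
  unfolding wp_def by (auto intro!: exI[of _ 1] exI[of _ s] exec.Skip elim!: exec_SkipE)

lemma wp_WAssign [simp]:
  "wp W (WAssign a e f) Q s b \<longleftrightarrow> 0 < b \<and> Q (setw a (wval W s e) (wval W s f) s) (b - 1)"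
  unfolding wp_def setw_def
  by (auto intro!: exI[of _ 1] exec.WAssign elim!: exec_WAssignE)

lemma wp_RAssign [simp]:
  "wp W (RAssign a e f) Q s b \<longleftrightarrow> 0 < b \<and> Q (setr a (wval W s e) (rval W s f) s) (b - 1)"
  unfolding wp_def setr_def
  by (auto intro!: exI[of _ 1] exec.RAssign elim!: exec_RAssignE)

lemma wp_Seq [simp]: "wp W (Seq c d) Q s b \<longleftrightarrow> wp W c (wp W d Q) s b"
proof
  assume "wp W (Seq c d) Q s b"
  then obtain t s' where *: "exec W (Seq c d) s t s'" "t \<le> b" "Q s' (b - t)"
    by (auto simp: wp_def)
  from *(1) obtain t1 s1 t2 where "t = t1 + t2" "exec W c s t1 s1" "exec W d s1 t2 s'"
    by (rule exec_SeqE)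
  with * show "wp W c (wp W d Q) s b"
    unfolding wp_def by (intro exI[of _ t1] exI[of _ s1]) (auto simp: diff_diff_left intro!: exI[of _ t2])
next
  assume "wp W c (wp W d Q) s b"
  then obtain t1 s1 t2 s' where "exec W c s t1 s1" "t1 \<le> b" "exec W d s1 t2 s'"
    "t2 \<le> b - t1" "Q s' (b - t1 - t2)"
    by (auto simp: wp_def)
  then show "wp W (Seq c d) Q s b"
    unfolding wp_def by (intro exI[of _ "t1 + t2"] exI[of _ s']) (auto intro: exec.Seq)
qed

lemma wp_If [simp]:
  "wp W (If e c d) Q s b \<longleftrightarrow> 0 < b \<and> (if bval W s e then wp W c Q s (b - 1) else wp W d Q s (b - 1))"
proof
  assume "wp W (If e c d) Q s b"
  then obtain t s' where *: "exec W (If e c d) s t s'" "t \<le> b" "Q s' (b - t)"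
    by (auto simp: wp_def)
  from *(1) *(2,3) show "0 < b \<and> (if bval W s e then wp W c Q s (b - 1) else wp W d Q s (b - 1))"
    by (cases rule: exec_IfE) (force simp: wp_def)+
next
  assume *: "0 < b \<and> (if bval W s e then wp W c Q s (b - 1) else wp W d Q s (b - 1))"
  show "wp W (If e c d) Q s b"
  proof (cases "bval W s e")
    case True
    with * obtain t s' where "exec W c s t s'" "t \<le> b - 1" "Q s' (b - 1 - t)"
      by (auto simp: wp_def)
    with * True show ?thesis
      unfolding wp_def by (intro exI[of _ "1 + t"] exI[of _ s']) (auto intro: exec.IfTrue[simplified])
  next
    case False
    with * obtain t s' where "exec W d s t s'" "t \<le> b - 1" "Q s' (b - 1 - t)"
      by (auto simp: wp_def)
    with * False show ?thesis
      unfolding wp_def by (intro exI[of _ "1 + t"] exI[of _ s']) (auto intro: exec.IfFalse[simplified])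
  qed
qed

text \<open>Returning the surplus \<open>b - T\<close> to the caller lets every program be verified
  once with its own budget and then be used under any larger one.\<close>

lemma wp_conseq:
  assumes "wp W c Q s T" "T \<le> b" "\<And>s' b'. Q s' b' \<Longrightarrow> b' \<le> T \<Longrightarrow> Q' s' (b' + (b - T))"
  shows "wp W c Q' s b"
proof -
  from assms(1) obtain t s' where "exec W c s t s'" "t \<le> T" "Q s' (T - t)"
    by (auto simp: wp_def)
  with assms(2) assms(3)[of s' "T - t"] show ?thesis
    unfolding wp_def by (intro exI[of _ t] exI[of _ s']) auto
qed

text \<open>The budget is its own termination measure: the test alone costs a step, so the induction
  runs on \<open>b\<close>, and the invariant relates the state to the budget that is left.\<close>

lemma wp_While:
  assumes "I s b"
    and "\<And>s b. I s b \<Longrightarrow> 0 < b"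
    and "\<And>s b. I s b \<Longrightarrow> bval W s e \<Longrightarrow> wp W c I s (b - 1)"
    and "\<And>s b. I s b \<Longrightarrow> \<not> bval W s e \<Longrightarrow> Q s (b - 1)"
  shows "wp W (While e c) Q s b"
  using assms(1)
proof (induction b arbitrary: s rule: less_induct)
  case (less b)
  note pos = assms(2)[OF less.prems]
  show ?case
  proof (cases "bval W s e")
    case True
    from assms(3)[OF less.prems True] obtain t s1 where
      1: "exec W c s t s1" "t \<le> b - 1" "I s1 (b - 1 - t)"
      by (auto simp: wp_def)
    with pos have "wp W (While e c) Q s1 (b - 1 - t)"
      by (intro less.IH) auto
    then obtain u s2 where "exec W (While e c) s1 u s2" "u \<le> b - 1 - t" "Q s2 (b - 1 - t - u)"
      by (auto simp: wp_def)
    with 1 True pos show ?thesis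
      unfolding wp_def by (intro exI[of _ "1 + t + u"] exI[of _ s2]) (auto intro: exec.WhileTrue[simplified])
  next
    case False
    with pos assms(4)[OF less.prems False] show ?thesis
      unfolding wp_def by (intro exI[of _ 1] exI[of _ s]) (auto intro: exec.WhileFalse[simplified])
  qed
qed

abbreviation sv :: "string \<Rightarrow> wexp" where
  "sv a \<equiv> WMem a (WConst 0)"

abbreviation wset :: "string \<Rightarrow> wexp \<Rightarrow> com" where
  "wset a e \<equiv> WAssign a (WConst 0) e"

abbreviation rset :: "string \<Rightarrow> rexp \<Rightarrow> com" where
  "rset a e \<equiv> RAssign a (WConst 0) e"

definition for_loop :: "string \<Rightarrow> wexp \<Rightarrow> com \<Rightarrow> com" where
  "for_loop i e c = Seq (wset i (WConst 0))
     (While (WLess (sv i) e) (Seq c (wset i (WAdd (sv i) (WConst 1)))))"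

text \<open>An iteration costs the body, one test and one increment, hence \<open>T + 2\<close>; the
  final 2 pays for the initialisation and the failing test. The bound \<open>e\<close> is evaluated
  anew at every test, so the invariant has to fix its value, and \<open>n < W\<close> keeps the
  counter from wrapping around.\<close>

lemma wp_for_loop:
  assumes "n < W"
    and init: "I 0 (setw i 0 0 s)"
    and bound: "\<And>j s. I j s \<Longrightarrow> j \<le> n \<Longrightarrow> wval W s e = n \<and> wmem s i 0 = j"
    and step: "\<And>j s. I j s \<Longrightarrow> j < n \<Longrightarrow>
      wp W c (\<lambda>s' _. wmem s' i 0 = j \<and> I (Suc j) (setw i 0 (Suc j) s')) s T"
  shows "wp W (for_loop i e c) (\<lambda>s' _. I n s') s (n * (T + 2) + 2)"
proof -
  let ?I = "\<lambda>s b. \<exists>j\<le>n. I j s \<and> (n - j) * (T + 2) + 1 \<le> b"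
  from assms(1) have W0: "0 mod W = 0" by simp
  have "wp W (While (WLess (sv i) e) (Seq c (wset i (WAdd (sv i) (WConst 1)))))
      (\<lambda>s' _. I n s') (setw i 0 0 s) (n * (T + 2) + 1)"
  proof (rule wp_While[where I = ?I])
    show "?I (setw i 0 0 s) (n * (T + 2) + 1)"
      using init by (intro exI[of _ 0]) auto
    show "0 < b" if "?I s b" for s b
      using that by auto
    show "wp W (Seq c (wset i (WAdd (sv i) (WConst 1)))) ?I s (b - 1)"
      if I: "?I s b" and c: "bval W s (WLess (sv i) e)" for s b
    proof -
      from I obtain j where j: "j \<le> n" "I j s" "(n - j) * (T + 2) + 1 \<le> b" by auto
      from bound[OF j(2,1)] c \<open>n < W\<close> j(1) have "j < n" by auto
      then have *: "(n - Suc j) * (T + 2) + T + 3 \<le> b"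
        using j(3) by (auto simp: Suc_diff_Suc[symmetric])
      show ?thesis
        unfolding wp_Seq
        apply (rule wp_conseq[OF step[OF j(2) \<open>j < n\<close>]])
        subgoal using * by simp
        subgoal for s' b'
          using * \<open>j < n\<close> \<open>n < W\<close> by (auto intro!: exI[of _ "Suc j"])
        done
    qed
    show "I n s" if I: "?I s b" and c: "\<not> bval W s (WLess (sv i) e)" for s b
    proof -
      from I obtain j where j: "j \<le> n" "I j s" by auto
      from bound[OF j(2,1)] c \<open>n < W\<close> j(1) have "j = n" by auto
      with j show ?thesis by simp
    qed
  qed
  then show ?thesis
    using W0 by (simp add: for_loop_def)
qed

section \<open>Linear time selection\<close>

definition seg :: "(nat \<Rightarrow> real) \<Rightarrow> nat \<Rightarrow> nat \<Rightarrow> real list" where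
  "seg A l n = map (\<lambda>i. A (l + i)) [0..<n]"

definition below :: "real \<Rightarrow> real list \<Rightarrow> nat" where
  "below v xs = length (filter (\<lambda>x. x < v) xs)"

definition above :: "real \<Rightarrow> real list \<Rightarrow> nat" where
  "above v xs = length (filter (\<lambda>x. v < x) xs)"

text \<open>Ranks are 0-based. Counting on both sides avoids a tie-breaking rule: at most
  \<open>q\<close> elements are smaller than \<open>v\<close>, and more than \<open>q\<close> are at
  most \<open>v\<close>.\<close>

definition is_qth :: "real list \<Rightarrow> nat \<Rightarrow> real \<Rightarrow> bool" where
  "is_qth xs q v \<longleftrightarrow> below v xs \<le> q \<and> q + above v xs < length xs"

lemma length_seg [simp]: "length (seg A l n) = n"
  and seg_0 [simp]: "seg A l 0 = []"
  and seg_Suc [simp]: "seg A l (Suc n) = seg A l n @ [A (l + n)]"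
  by (simp_all add: seg_def)

lemma below_simps [simp]:
  "below v [] = 0" "below v (xs @ ys) = below v xs + below v ys"
  "below v (x # xs) = (if x < v then 1 else 0) + below v xs"
  by (simp_all add: below_def)

lemma above_simps [simp]:
  "above v [] = 0" "above v (xs @ ys) = above v xs + above v ys"
  "above v (x # xs) = (if v < x then 1 else 0) + above v xs"
  by (simp_all add: above_def)

lemma seg_cong: "(\<And>i. l \<le> i \<Longrightarrow> i < l + n \<Longrightarrow> A i = B i) \<Longrightarrow> seg A l n = seg B l n"
  by (simp add: seg_def)

lemma below_above_le_length: "below v xs + above v xs \<le> length xs"
  by (induction xs) auto

lemma in_set_if_is_qth: "is_qth xs q v \<Longrightarrow> v \<in> set xs"
proof -
  assume "is_qth xs q v"
  then have "below v xs + above v xs < length xs"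
    by (simp add: is_qth_def)
  then show "v \<in> set xs"
    by (induction xs) (auto split: if_splits)
qed

text \<open>The result occurs in the filtered list and is thus below the pivot, so each discarded
  element adds one to the length and one to the elements above the result.\<close>

lemma is_qth_filter_less:
  assumes "is_qth (filter (\<lambda>x. x < p) xs) q v"
  shows "is_qth xs q v"
proof -
  from in_set_if_is_qth[OF assms] have "v < p" by auto
  then have "below v (filter (\<lambda>x. x < p) xs) = below v xs"
    "above v xs + length (filter (\<lambda>x. x < p) xs) = above v (filter (\<lambda>x. x < p) xs) + length xs"
    by (induction xs) auto
  with assms show ?thesis by (simp add: is_qth_def)
qed

text \<open>Every discarded element is below the result, so the rank drops by their number
  \<open>length xs - above p xs\<close>; the second hypothesis keeps the subtraction from the rank
  from being truncated.\<close>

lemma is_qth_filter_greater: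
  assumes "is_qth (filter (\<lambda>x. p < x) xs) (q - (length xs - above p xs)) v"
    and "length xs \<le> q + above p xs"
  shows "is_qth xs q v"
proof -
  from in_set_if_is_qth[OF assms(1)] have "p < v" by auto
  then have *: "above v (filter (\<lambda>x. p < x) xs) = above v xs"
    "below v xs + length (filter (\<lambda>x. p < x) xs) = below v (filter (\<lambda>x. p < x) xs) + length xs"
    by (induction xs) auto
  have "above p xs \<le> length xs" "above p xs = length (filter (\<lambda>x. p < x) xs)"
    using below_above_le_length[of p xs] by (simp_all add: above_def)
  with assms * show ?thesis by (auto simp: is_qth_def)
qed

section \<open>Group medians and balanced pivots\<close>

definition med3 :: "real \<Rightarrow> real \<Rightarrow> real \<Rightarrow> real" where
  "med3 x y z = (if x < y then if y < z then y else if x < z then z else x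
     else if x < z then x else if y < z then z else y)"

text \<open>Tukey's ninther. It is cheaper than the true median of nine values and still has four of
  them on either side, itself included.\<close>

definition med9 :: "(nat \<Rightarrow> real) \<Rightarrow> nat \<Rightarrow> real" where
  "med9 A l = med3 (med3 (A l) (A (l + 1)) (A (l + 2))) (med3 (A (l + 3)) (A (l + 4)) (A (l + 5)))
     (med3 (A (l + 6)) (A (l + 7)) (A (l + 8)))"

text \<open>Written as a linear inequality between indicators so that two levels of medians combine
  by arithmetic alone: two of three, twice, give four of nine.\<close>

lemma med3_ge:
  "2 * of_bool (v \<le> med3 x y z) \<le> of_bool (v \<le> x) + of_bool (v \<le> y) + (of_bool (v \<le> z) :: nat)"
  by (auto simp: med3_def)

lemma med3_le:
  "2 * of_bool (med3 x y z \<le> v) \<le> of_bool (x \<le> v) + of_bool (y \<le> v) + (of_bool (z \<le> v) :: nat)"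
  by (auto simp: med3_def)

lemma sum_lessThan_9: "(\<Sum>t<(9::nat). f t) = f 0 + f 1 + f 2 + f 3 + f 4 + f 5 + f 6 + f 7 + (f 8 :: nat)"
  by (simp add: eval_nat_numeral)

lemma med9_ge: "v \<le> med9 A l \<Longrightarrow> 4 \<le> (\<Sum>t<9. of_bool (v \<le> A (l + t)) :: nat)"
  using med3_ge[of v "med3 (A l) (A (l + 1)) (A (l + 2))" "med3 (A (l + 3)) (A (l + 4)) (A (l + 5))" "med3 (A (l + 6)) (A (l + 7)) (A (l + 8))"]
    med3_ge[of v "A l" "A (l + 1)" "A (l + 2)"] med3_ge[of v "A (l + 3)" "A (l + 4)" "A (l + 5)"]
    med3_ge[of v "A (l + 6)" "A (l + 7)" "A (l + 8)"]
  unfolding med9_def sum_lessThan_9 by simp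

lemma med9_le: "med9 A l \<le> v \<Longrightarrow> 4 \<le> (\<Sum>t<9. of_bool (A (l + t) \<le> v) :: nat)"
  using med3_le[of "med3 (A l) (A (l + 1)) (A (l + 2))" "med3 (A (l + 3)) (A (l + 4)) (A (l + 5))" "med3 (A (l + 6)) (A (l + 7)) (A (l + 8))" v]
    med3_le[of "A l" "A (l + 1)" "A (l + 2)" v] med3_le[of "A (l + 3)" "A (l + 4)" "A (l + 5)" v]
    med3_le[of "A (l + 6)" "A (l + 7)" "A (l + 8)" v]
  unfolding med9_def sum_lessThan_9 by simp

lemma below_map_upt: "below v (map f [0..<n]) + (\<Sum>i<n. of_bool (v \<le> f i)) = n"
  by (induction n) auto

lemma above_map_upt: "above v (map f [0..<n]) + (\<Sum>i<n. of_bool (f i \<le> v)) = n"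
  by (induction n) auto

lemma sum_groups_of_9:
  fixes P Q :: "nat \<Rightarrow> bool"
  assumes "9 * g \<le> n" and "\<And>i. i < g \<Longrightarrow> P i \<Longrightarrow> 4 \<le> (\<Sum>t<9. of_bool (Q (9 * i + t)) :: nat)"
  shows "4 * (\<Sum>i<g. of_bool (P i)) \<le> (\<Sum>i<n. of_bool (Q i) :: nat)"
proof -
  have "4 * (\<Sum>i<g. of_bool (P i)) = (\<Sum>i<g. 4 * of_bool (P i) :: nat)"
    by (simp add: sum_distrib_left)
  also have "\<dots> \<le> (\<Sum>i<g. \<Sum>t<9. of_bool (Q (9 * i + t)))"
    using assms(2) by (intro sum_mono) auto
  also have "\<dots> = (\<Sum>i<g. sum (\<lambda>j. of_bool (Q j)) {i * 9..<i * 9 + 9})"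
  proof (rule sum.cong[OF refl])
    fix i
    show "(\<Sum>t<9. of_bool (Q (9 * i + t)) :: nat) = sum (\<lambda>j. of_bool (Q j)) {i * 9..<i * 9 + 9}"
      using sum.shift_bounds_nat_ivl[of "\<lambda>j. of_bool (Q j) :: nat" 0 "i * 9" 9]
      by (simp add: atLeast0LessThan add.commute mult.commute)
  qed
  also have "\<dots> = (\<Sum>j<g * 9. of_bool (Q j))"
    by (rule sum.nat_group)
  also have "\<dots> \<le> (\<Sum>j<n. of_bool (Q j))"
    using assms(1) by (intro sum_mono2) auto
  finally show ?thesis .
qed

text \<open>At least half of the g group medians are at least \<open>v\<close>, and at least half
  are at most \<open>v\<close>. Each brings along four elements of its group on the same side, which
  makes 2 g elements on either side.\<close>

lemma median_of_medians:
  assumes "is_qth (map (\<lambda>i. med9 A (l + 9 * i)) [0..<n div 9]) (n div 9 div 2) v"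
  shows "below v (seg A l n) + 2 * (n div 9) \<le> n" "above v (seg A l n) + 2 * (n div 9) \<le> n"
proof -
  define g where "g = n div 9"
  define f where "f = (\<lambda>i. med9 A (l + 9 * i))"
  have g: "9 * g \<le> n" by (simp add: g_def)
  from assms have q: "below v (map f [0..<g]) \<le> g div 2" "g div 2 + above v (map f [0..<g]) < g"
    by (simp_all add: is_qth_def f_def g_def)
  have "4 * (\<Sum>i<g. of_bool (v \<le> f i)) \<le> (\<Sum>i<n. of_bool (v \<le> A (l + i)) :: nat)"
    using med9_ge[of v A] by (intro sum_groups_of_9 g) (simp only: f_def add.assoc[symmetric])
  moreover have "4 * (\<Sum>i<g. of_bool (f i \<le> v)) \<le> (\<Sum>i<n. of_bool (A (l + i) \<le> v) :: nat)"
    using med9_le[of A _ v] by (intro sum_groups_of_9 g) (simp only: f_def add.assoc[symmetric])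
  moreover note below_map_upt[of v f g] above_map_upt[of v f g]
    below_map_upt[of v "\<lambda>i. A (l + i)" n] above_map_upt[of v "\<lambda>i. A (l + i)" n]
  ultimately show "below v (seg A l n) + 2 * (n div 9) \<le> n" "above v (seg A l n) + 2 * (n div 9) \<le> n"
    using q unfolding seg_def g_def[symmetric] by linarith+
qed

abbreviation same :: "'a set \<Rightarrow> ('a \<Rightarrow> 'b) \<Rightarrow> ('a \<Rightarrow> 'b) \<Rightarrow> bool" where
  "same X f g \<equiv> \<forall>a. a \<notin> X \<longrightarrow> f a = g a"

section \<open>Programs for group medians, counting and partitioning\<close>

definition med3_com :: "string \<Rightarrow> rexp \<Rightarrow> rexp \<Rightarrow> rexp \<Rightarrow> com" where
  "med3_com a x y z =
     If (RLess x y) (If (RLess y z) (rset a y) (If (RLess x z) (rset a z) (rset a x)))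
       (If (RLess x z) (rset a x) (If (RLess y z) (rset a z) (rset a y)))"

lemma wp_med3_com:
  "wp W (med3_com a x y z) (\<lambda>s' _. s' = setr a 0 (med3 (rval W s x) (rval W s y) (rval W s z)) s) s 4"
  by (simp add: med3_com_def med3_def)

lemma wp_Seq_med3_com:
  assumes "v = med3 (rval W s x) (rval W s y) (rval W s z)"
    and "4 \<le> b" "\<And>b'. b - 4 \<le> b' \<Longrightarrow> wp W d Q (setr a 0 v s) b'"
  shows "wp W (Seq (med3_com a x y z) d) Q s b"
  unfolding wp_Seq by (rule wp_conseq[OF wp_med3_com]) (use assms in auto)

definition group_cell :: "nat \<Rightarrow> rexp" where
  "group_cell t = RMem ''A'' (WAdd (sv ''lo'') (WAdd (WMul (WConst 9) (sv ''i'')) (WConst t)))"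

definition median_step :: com where
  "median_step =
      Seq (med3_com ''a'' (group_cell 0) (group_cell 1) (group_cell 2))
      (Seq (med3_com ''b'' (group_cell 3) (group_cell 4) (group_cell 5))
      (Seq (med3_com ''c'' (group_cell 6) (group_cell 7) (group_cell 8))
      (Seq (med3_com ''a'' (RMem ''a'' (WConst 0)) (RMem ''b'' (WConst 0)) (RMem ''c'' (WConst 0)))
        (RAssign ''A'' (WAdd (sv ''hi'') (sv ''i'')) (RMem ''a'' (WConst 0))))))"

definition medians_com :: com where
  "medians_com = for_loop ''i'' (sv ''g'') median_step"

text \<open>The medians go into the cells from \<open>h\<close> on, behind all cells that are read,
  so the input stays intact. A round costs four medians of three with at most four steps each and
  one store, hence 17 steps.\<close>

lemma wp_medians_com:
  assumes W: "9 < W" "h + g < W" and g: "l + 9 * g \<le> h"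
    and s: "wmem s ''lo'' 0 = l" "wmem s ''hi'' 0 = h" "wmem s ''g'' 0 = g"
  shows "wp W medians_com
    (\<lambda>s' _. same {''i''} (wmem s') (wmem s) \<and> same {''A'', ''a'', ''b'', ''c''} (rmem s') (rmem s) \<and>
       (\<forall>i<h. rmem s' ''A'' i = rmem s ''A'' i) \<and>
       (\<forall>i<g. rmem s' ''A'' (h + i) = med9 (rmem s ''A'') (l + 9 * i))) s (g * 19 + 2)"
proof -
  let ?I = "\<lambda>j s'. wmem s' ''i'' 0 = j \<and> same {''i''} (wmem s') (wmem s) \<and>
    same {''A'', ''a'', ''b'', ''c''} (rmem s') (rmem s) \<and>
       (\<forall>i<h. rmem s' ''A'' i = rmem s ''A'' i) \<and>
       (\<forall>i<j. rmem s' ''A'' (h + i) = med9 (rmem s ''A'') (l + 9 * i))"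
  have "wp W medians_com (\<lambda>s' _. ?I g s') s (g * (17 + 2) + 2)"
    unfolding medians_com_def
  proof (rule wp_for_loop)
    fix j and s' :: ram
    assume I: "?I j s'" and j: "j < g"
    have lt: "l + (9 * j + t) < h" if "t < 9" for t using j g that by simp
    have m: "(l + (9 * j mod W + t mod W) mod W) mod W = l + (9 * j + t)" if "t < 9" for t
      using lt[OF that] W that by (simp add: mod_simps)
    have A: "rmem s' ''A'' (l + (9 * j + t)) = rmem s ''A'' (l + (9 * j + t))" if "t < 9" for t
      using I lt[OF that] by blast
    have mm: "l mod W = l" "j mod W = j" "(h + j) mod W = h + j" "h mod W = h" "9 mod W = 9"
      using W g j by auto
    have *: "wmem s' ''lo'' 0 = l" "wmem s' ''hi'' 0 = h" "wmem s' ''i'' 0 = j"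
      using I s by auto
    have cell: "rval W s'' (group_cell t) = rmem s ''A'' (l + 9 * j + t)"
      if "wmem s'' = wmem s'" "rmem s'' ''A'' = rmem s' ''A''" "t < 9" for s'' t
      using that m[of t] A[of t] mm * by (simp add: group_cell_def add.assoc)
    let ?A = "\<lambda>t. rmem s ''A'' (l + 9 * j + t)"
    let ?v = "med9 (rmem s ''A'') (l + 9 * j)"
    have med: "wp W median_step
      (\<lambda>s'' _. wmem s'' = wmem s' \<and> same {''A'', ''a'', ''b'', ''c''} (rmem s'') (rmem s') \<and>
         rmem s'' ''A'' = (rmem s' ''A'')(h + j := ?v)) s' 17"
      unfolding median_step_def
    proof (rule wp_Seq_med3_com[where v = "med3 (?A 0) (?A 1) (?A 2)"], goal_cases)
      case b1: (3 b)
      show ?case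
      proof (rule wp_Seq_med3_com[where v = "med3 (?A 3) (?A 4) (?A 5)"], goal_cases)
        case b2: (3 b')
        show ?case
        proof (rule wp_Seq_med3_com[where v = "med3 (?A 6) (?A 7) (?A 8)"], goal_cases)
          case b3: (3 b'')
          show ?case
            by (rule wp_Seq_med3_com[where v = "?v"]) (use b1 b2 b3 mm * in \<open>simp_all add: med9_def\<close>)
        qed (use b1 b2 in \<open>simp_all add: cell\<close>)
      qed (use b1 in \<open>simp_all add: cell\<close>)
    qed (simp_all add: cell)
    show "wp W median_step
      (\<lambda>s' _. wmem s' ''i'' 0 = j \<and> ?I (Suc j) (setw ''i'' 0 (Suc j) s')) s' 17"
      by (rule wp_conseq[OF med]) (use I j in \<open>auto simp: less_Suc_eq\<close>)
  qed (use W s g in \<open>auto\<close>)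
  then show ?thesis
    by (rule wp_conseq) auto
qed

definition count_com :: com where
  "count_com =
    (let x = RMem ''A'' (WAdd (sv ''lo'') (sv ''i'')); v = RMem ''v'' (WConst 0) in
     Seq (wset ''cl'' (WConst 0)) (Seq (wset ''ch'' (WConst 0))
      (for_loop ''i'' (WSub (sv ''hi'') (sv ''lo''))
        (If (RLess x v) (wset ''cl'' (WAdd (sv ''cl'') (WConst 1)))
          (If (RLess v x) (wset ''ch'' (WAdd (sv ''ch'') (WConst 1))) Skip)))))"

lemma wp_count_com:
  assumes W: "1 < W" "l + n < W" and s: "wmem s ''lo'' 0 = l" "wmem s ''hi'' 0 = l + n"
    "rmem s ''v'' 0 = v"
  shows "wp W count_com
    (\<lambda>s' _. same {''i'', ''cl'', ''ch''} (wmem s') (wmem s) \<and> rmem s' = rmem s \<and>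
       wmem s' ''cl'' 0 = below v (seg (rmem s ''A'') l n) \<and>
       wmem s' ''ch'' 0 = above v (seg (rmem s ''A'') l n)) s (n * 5 + 4)"
proof -
  let ?xs = "\<lambda>j. seg (rmem s ''A'') l j"
  let ?I = "\<lambda>j s'. wmem s' ''i'' 0 = j \<and> same {''i'', ''cl'', ''ch''} (wmem s') (wmem s) \<and>
    rmem s' = rmem s \<and> wmem s' ''cl'' 0 = below v (?xs j) \<and> wmem s' ''ch'' 0 = above v (?xs j)"
  let ?x = "RMem ''A'' (WAdd (sv ''lo'') (sv ''i''))" and ?v = "RMem ''v'' (WConst 0)"
  have "wp W (for_loop ''i'' (WSub (sv ''hi'') (sv ''lo''))
        (If (RLess ?x ?v) (wset ''cl'' (WAdd (sv ''cl'') (WConst 1)))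
          (If (RLess ?v ?x) (wset ''ch'' (WAdd (sv ''ch'') (WConst 1))) Skip)))
      (\<lambda>s' _. ?I n s') (setw ''ch'' 0 0 (setw ''cl'' 0 0 s)) (n * (3 + 2) + 2)"
  proof (rule wp_for_loop)
    fix j and s' :: ram
    assume I: "?I j s'" and j: "j < n"
    have le: "below v (?xs j) + above v (?xs j) \<le> j"
      using below_above_le_length[of v "?xs j"] by simp
    then have m: "l mod W = l" "j mod W = j" "(l + j) mod W = l + j" "1 mod W = 1"
      "below v (?xs j) mod W = below v (?xs j)" "(below v (?xs j) + 1) mod W = below v (?xs j) + 1"
      "above v (?xs j) mod W = above v (?xs j)" "(above v (?xs j) + 1) mod W = above v (?xs j) + 1"
      using W j by auto
    show "wp W (If (RLess ?x ?v) (wset ''cl'' (WAdd (sv ''cl'') (WConst 1)))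
          (If (RLess ?v ?x) (wset ''ch'' (WAdd (sv ''ch'') (WConst 1))) Skip))
        (\<lambda>s' _. wmem s' ''i'' 0 = j \<and> ?I (Suc j) (setw ''i'' 0 (Suc j) s')) s' 3"
      using I s m by simp
  qed (use W s in \<open>auto\<close>)
  then have "wp W count_com (\<lambda>s' _. ?I n s') s (n * 5 + 4)"
    unfolding count_com_def Let_def using W by simp
  then show ?thesis
    by (rule wp_conseq) auto
qed

definition compact_com :: "bexp \<Rightarrow> com" where
  "compact_com P =
     Seq (wset ''w'' (WConst 0))
    (Seq (for_loop ''i'' (WSub (sv ''hi'') (sv ''lo''))
        (If P (Seq (RAssign ''A'' (WAdd (sv ''lo'') (sv ''w'')) (RMem ''A'' (WAdd (sv ''lo'') (sv ''i''))))
                (wset ''w'' (WAdd (sv ''w'') (WConst 1)))) Skip))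
      (wset ''hi'' (WAdd (sv ''lo'') (sv ''w''))))"

text \<open>The partition works in place: the write position never overtakes the read position, so
  the cells from \<open>l + j\<close> on are still the original ones. The old \<open>hi\<close>
  determines the loop bound and may be overwritten only after the loop.\<close>

lemma wp_compact_com:
  assumes W: "1 < W" "l + n < W" and s: "wmem s ''lo'' 0 = l" "wmem s ''hi'' 0 = l + n"
    "rmem s ''v'' 0 = v"
    and P: "\<And>s'. rmem s' ''v'' 0 = v \<Longrightarrow>
      bval W s' P = p (rval W s' (RMem ''A'' (WAdd (sv ''lo'') (sv ''i''))))"
  defines "ys \<equiv> filter p (seg (rmem s ''A'') l n)"
  shows "wp W (compact_com P)
    (\<lambda>s' _. same {''i'', ''w'', ''hi''} (wmem s') (wmem s) \<and> same {''A''} (rmem s') (rmem s) \<and>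
       (\<forall>i<l. rmem s' ''A'' i = rmem s ''A'' i) \<and> wmem s' ''hi'' 0 = l + length ys \<and>
       seg (rmem s' ''A'') l (length ys) = ys) s (n * 5 + 4)"
proof -
  let ?xs = "\<lambda>j. filter p (seg (rmem s ''A'') l j)"
  let ?I = "\<lambda>j s'. wmem s' ''i'' 0 = j \<and> same {''i'', ''w'', ''hi''} (wmem s') (wmem s) \<and>
    wmem s' ''hi'' = wmem s ''hi'' \<and>
    same {''A''} (rmem s') (rmem s) \<and> (\<forall>i. i < l \<or> l + j \<le> i \<longrightarrow> rmem s' ''A'' i = rmem s ''A'' i) \<and>
    wmem s' ''w'' 0 = length (?xs j) \<and> seg (rmem s' ''A'') l (length (?xs j)) = ?xs j"
  let ?x = "RMem ''A'' (WAdd (sv ''lo'') (sv ''i''))" and ?v = "RMem ''v'' (WConst 0)"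
  let ?c = "If P (Seq (RAssign ''A'' (WAdd (sv ''lo'') (sv ''w'')) (RMem ''A'' (WAdd (sv ''lo'') (sv ''i''))))
                (wset ''w'' (WAdd (sv ''w'') (WConst 1)))) Skip"
  have le: "length (?xs j) \<le> j" for j
    using length_filter_le[of p "seg (rmem s ''A'') l j"] by simp
  have "wp W (for_loop ''i'' (WSub (sv ''hi'') (sv ''lo'')) ?c)
      (\<lambda>s' _. ?I n s') (setw ''w'' 0 0 s) (n * (3 + 2) + 2)"
  proof (rule wp_for_loop)
    fix j and s' :: ram
    assume I: "?I j s'" and j: "j < n"
    let ?w = "length (?xs j)"
    have m: "l mod W = l" "j mod W = j" "(l + j) mod W = l + j" "1 mod W = 1"
      "?w mod W = ?w" "(?w + 1) mod W = ?w + 1" "(l + ?w) mod W = l + ?w"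
      using W j le[of j] by auto
    have v: "rmem s' ''v'' 0 = v" and c: "wmem s' ''i'' 0 = j" "wmem s' ''lo'' 0 = l"
      "wmem s' ''w'' 0 = ?w" "rmem s' ''A'' (l + j) = rmem s ''A'' (l + j)"
      using I s by auto
    have "seg ((rmem s' ''A'')(l + ?w := x)) l ?w = seg (rmem s' ''A'') l ?w" for x
      by (rule seg_cong) simp
    with I m s c j le[of j] show "wp W ?c (\<lambda>s' _. wmem s' ''i'' 0 = j \<and> ?I (Suc j) (setw ''i'' 0 (Suc j) s')) s' 3"
      by (simp add: P[OF v])
  qed (use W s in \<open>auto\<close>)
  then have "wp W (for_loop ''i'' (WSub (sv ''hi'') (sv ''lo'')) ?c)
      (\<lambda>s' _. ?I n s') (setw ''w'' 0 0 s) (n * 5 + 2)" by simp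
  then show ?thesis
    unfolding compact_com_def using W
    apply simp
    apply (erule wp_conseq)
    using le[of n] s W
    apply (auto simp: ys_def)
    done
qed

section \<open>Selection with an explicit stack and amortised cost\<close>

definition select_step :: com where
  "select_step =
    (let x = RMem ''A'' (WAdd (sv ''lo'') (sv ''i'')); v = RMem ''v'' (WConst 0) in
     If (WLess (sv ''mode'') (WConst 1))
      (Seq (wset ''g'' (WDiv (WSub (sv ''hi'') (sv ''lo'')) (WConst 9)))
        (If (WLess (sv ''g'') (WConst 1))
          (Seq (rset ''v'' (RMem ''A'' (sv ''lo''))) (wset ''mode'' (WConst 1)))
          (Seq medians_com
          (Seq (WAssign ''sl'' (sv ''sp'') (sv ''lo''))
          (Seq (WAssign ''sq'' (sv ''sp'') (sv ''q''))
          (Seq (wset ''sp'' (WAdd (sv ''sp'') (WConst 1)))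
          (Seq (wset ''lo'' (sv ''hi''))
          (Seq (wset ''hi'' (WAdd (sv ''hi'') (sv ''g'')))
            (wset ''q'' (WDiv (sv ''g'') (WConst 2)))))))))))
      (Seq count_com
        (If (WLess (sv ''q'') (sv ''cl''))
          (Seq (compact_com (RLess x v)) (wset ''mode'' (WConst 0)))
          (If (WLess (WAdd (sv ''q'') (sv ''ch'')) (WSub (sv ''hi'') (sv ''lo'')))
            (If (WLess (sv ''sp'') (WConst 1)) (wset ''mode'' (WConst 2))
              (Seq (wset ''sp'' (WSub (sv ''sp'') (WConst 1)))
              (Seq (wset ''hi'' (sv ''lo''))
              (Seq (wset ''lo'' (WMem ''sl'' (sv ''sp'')))
                (wset ''q'' (WMem ''sq'' (sv ''sp'')))))))
            (Seq (wset ''q'' (WSub (sv ''q'') (WSub (WSub (sv ''hi'') (sv ''lo'')) (sv ''ch''))))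
            (Seq (compact_com (RLess v x)) (wset ''mode'' (WConst 0))))))))"

text \<open>The current problem is the search for the q-th smallest element in cells lo to hi - 1 of A. In
  mode 0 it still needs a pivot, in mode 1 the pivot is v, in mode 2 the search is over. The stack
  holds the problems that wait for their pivot, which is the median of the medians of groups of nine
  and thus the solution of the next problem; each segment starts where the previous one ends.\<close>

definition select_com :: com where
  "select_com = Seq (wset ''lo'' (WConst 0)) (Seq (wset ''sp'' (WConst 0)) (Seq (wset ''mode'' (WConst 0))
     (While (WLess (sv ''mode'') (WConst 2)) select_step)))"

text \<open>The language has no procedures, so the recursion lives on a stack. \<open>R\<close> is
  what a solution of the current problem satisfies, \<open>F\<close> what the overall answer must
  satisfy. A frame promises that every such solution splits the waiting segment in a balanced way;
  the rest of the stack then regards the waiting problem as the current one. Segments shorter than 9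
  are never pushed.\<close>

fun stack_ok :: "(real \<Rightarrow> bool) \<Rightarrow> nat \<Rightarrow> (nat \<Rightarrow> nat) \<Rightarrow> (nat \<Rightarrow> nat) \<Rightarrow> (nat \<Rightarrow> real) \<Rightarrow>
    nat \<Rightarrow> nat \<Rightarrow> (real \<Rightarrow> bool) \<Rightarrow> bool" where
  "stack_ok F N sl sq A 0 l R \<longleftrightarrow> (\<forall>v. R v \<longrightarrow> F v)"
| "stack_ok F N sl sq A (Suc p) l R \<longleftrightarrow>
    (let n = l - sl p; ys = seg A (sl p) n in
      sl p + 9 \<le> l \<and> l + n \<le> N \<and> sq p < n \<and>
      (\<forall>v. R v \<longrightarrow> below v ys + 2 * (n div 9) \<le> n \<and> above v ys + 2 * (n div 9) \<le> n) \<and>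
      stack_ok F N sl sq A p (sl p) (is_qth ys (sq p)))"

text \<open>The cost of finding a pivot and solving the rest is at most 222 n, because
  222 g \<ge> 19 g + 10 n + 33 whenever g \<ge> 1 and n \<le> 9 g + 8; here 19 g + 2 is the cost of the g
  medians and 10 n + 8 that of the partition.\<close>

fun stack_cost :: "(nat \<Rightarrow> nat) \<Rightarrow> nat \<Rightarrow> nat \<Rightarrow> nat" where
  "stack_cost sl 0 l = 0"
| "stack_cost sl (Suc p) l =
    (let n = l - sl p in 10 * n + 20 + 222 * (n - 2 * (n div 9)) + stack_cost sl p (sl p))"

text \<open>\<open>R\<close> occurs only in premises. After a partition, every solution for the
  remaining part also solves the whole segment, so the stack stays valid as it is.\<close>

lemma stack_ok_mono:
  "stack_ok F N sl sq A p l R \<Longrightarrow> (\<And>v. R' v \<Longrightarrow> R v) \<Longrightarrow> stack_ok F N sl sq A p l R'"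
  by (cases p) (auto simp: Let_def)

lemma stack_ok_cong:
  assumes "\<And>i. i < p \<Longrightarrow> sl i = sl' i" "\<And>i. i < p \<Longrightarrow> sq i = sq' i" "\<And>i. i < l \<Longrightarrow> A i = A' i"
  shows "stack_ok F N sl sq A p l R \<Longrightarrow> stack_ok F N sl' sq' A' p l R"
  using assms
proof (induction p arbitrary: l R)
  case (Suc p)
  have "seg A (sl' p) (l - sl' p) = seg A' (sl' p) (l - sl' p)"
    using Suc.prems(4) by (intro seg_cong) auto
  with Suc.prems Suc.IH[of "sl' p" "is_qth (seg A' (sl' p) (l - sl' p)) (sq' p)"] show ?case
    by (auto simp: Let_def)
qed auto

lemma stack_cost_cong: "(\<And>i. i < p \<Longrightarrow> sl i = sl' i) \<Longrightarrow> stack_cost sl p l = stack_cost sl' p l"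
  by (induction p arbitrary: l) (auto simp: Let_def)

text \<open>Each frame owns at least nine cells, so the stack pointer is bounded by an address and
  cannot wrap around.\<close>

lemma stack_ok_height: "stack_ok F N sl sq A p l R \<Longrightarrow> p \<le> l"
proof (induction p arbitrary: l R)
  case (Suc p)
  from Suc.prems Suc.IH[of "sl p"] have "p \<le> sl p" "sl p + 9 \<le> l" by (auto simp: Let_def)
  then show ?case by simp
qed simp

definition sel_words :: "string set" where
  "sel_words = {''lo'', ''hi'', ''q'', ''sp'', ''sl'', ''sq'', ''mode'', ''g'', ''i'', ''w'', ''cl'', ''ch''}"

definition sel_reals :: "string set" where
  "sel_reals = {''A'', ''v'', ''a'', ''b'', ''c''}"

text \<open>\<open>l + 2 * n \<le> N\<close> reserves space for all medians to come: a push replaces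
  \<open>l\<close> and \<open>n\<close> by \<open>l + n\<close> and \<open>g\<close>, where
  \<open>2 * g \<le> n\<close>.\<close>

definition sel_frame :: "(real \<Rightarrow> bool) \<Rightarrow> nat \<Rightarrow> ram \<Rightarrow> nat \<Rightarrow> nat \<Rightarrow> nat \<Rightarrow> nat \<Rightarrow> bool" where
  "sel_frame F N s p l n q \<longleftrightarrow>
     wmem s ''sp'' 0 = p \<and> wmem s ''lo'' 0 = l \<and> wmem s ''hi'' 0 = l + n \<and> wmem s ''q'' 0 = q \<and>
     q < n \<and> l + 2 * n \<le> N \<and>
     stack_ok F N (wmem s ''sl'') (wmem s ''sq'') (rmem s ''A'') p l (is_qth (seg (rmem s ''A'') l n) q)"

text \<open>The budget is the potential of an amortised analysis: \<open>stack_cost\<close> for the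
  waiting problems plus the worst case of the current one. Once a pivot is known, this worst case is
  a partition followed by the larger of the two sides.\<close>

definition sel_inv :: "(real \<Rightarrow> bool) \<Rightarrow> nat \<Rightarrow> ram \<Rightarrow> ram \<Rightarrow> nat \<Rightarrow> bool" where
  "sel_inv F N s0 s b \<longleftrightarrow>
     same sel_words (wmem s) (wmem s0) \<and> same sel_reals (rmem s) (rmem s0) \<and>
     (wmem s ''mode'' 0 = 0 \<and> (\<exists>p l n q. sel_frame F N s p l n q \<and>
        stack_cost (wmem s ''sl'') p l + 222 * n + 1 \<le> b) \<or>
      wmem s ''mode'' 0 = 1 \<and> (\<exists>p l n q. sel_frame F N s p l n q \<and>
        stack_cost (wmem s ''sl'') p l + 10 * n + 20 +
          222 * max (below (rmem s ''v'' 0) (seg (rmem s ''A'') l n))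
            (above (rmem s ''v'' 0) (seg (rmem s ''A'') l n)) + 1 \<le> b) \<or>
      wmem s ''mode'' 0 = 2 \<and> F (rmem s ''v'' 0) \<and> 1 \<le> b)"

lemma sel_inv_mode0:
  assumes "same sel_words (wmem s) (wmem s0)" "same sel_reals (rmem s) (rmem s0)"
    "wmem s ''mode'' 0 = 0" "sel_frame F N s p l n q"
    "stack_cost (wmem s ''sl'') p l + 222 * n + 1 \<le> b"
  shows "sel_inv F N s0 s b"
  using assms unfolding sel_inv_def by blast

lemma sel_inv_mode1:
  assumes "same sel_words (wmem s) (wmem s0)" "same sel_reals (rmem s) (rmem s0)"
    "wmem s ''mode'' 0 = 1" "sel_frame F N s p l n q"
    "stack_cost (wmem s ''sl'') p l + 10 * n + 20 +
      222 * max (below (rmem s ''v'' 0) (seg (rmem s ''A'') l n))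
            (above (rmem s ''v'' 0) (seg (rmem s ''A'') l n)) + 1 \<le> b"
  shows "sel_inv F N s0 s b"
  using assms unfolding sel_inv_def by blast

lemma select_step_push:
  assumes W: "N + 20 \<le> W"
    and same: "same sel_words (wmem s) (wmem s0)" "same sel_reals (rmem s) (rmem s0)"
    and mode: "wmem s ''mode'' 0 = 0" and frame: "sel_frame F N s p l n q"
    and b: "stack_cost (wmem s ''sl'') p l + 222 * n + 1 \<le> b"
  shows "wp W select_step (sel_inv F N s0) s (b - 1)"
proof -
  define g where "g = n div 9"
  note f = frame[unfolded sel_frame_def]
  from f have le: "l + 2 * n \<le> N" "q < n" by auto
  have g: "9 * g \<le> n" "n \<le> 9 * g + 8" by (auto simp: g_def)
  from f stack_ok_height have p: "p \<le> l" by blast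
  have m: "0 mod W = 0" "1 mod W = 1" "9 mod W = 9" "2 mod W = 2" "n mod W = n" "l mod W = l" "g mod W = g"
    "(l + n) mod W = l + n" "(l + n + g) mod W = l + n + g" "q mod W = q" "p mod W = p"
    "(p + 1) mod W = p + 1" "Suc p mod W = Suc p" "(g div 2) mod W = g div 2" "Suc 0 mod W = Suc 0"
    using W le g p by auto
  show ?thesis
  proof (cases "g = 0")
    case True
    let ?v = "rmem s ''A'' l" and ?ys = "seg (rmem s ''A'') l n"
    have "?v \<in> set ?ys"
      using le by (auto simp: seg_def image_iff intro!: bexI[of _ 0])
    then have "below ?v ?ys < n" "above ?v ?ys < n"
      using length_filter_less[of ?v ?ys] by (auto simp: below_def above_def)
    \<comment> \<open>A short segment is not split in a balanced way, but the pivot itself drops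
      out. This frees 222 steps, more than the \<open>10 * n + 26\<close> that are due when
      \<open>n \<le> 8\<close>.\<close>
    then have max: "max (below ?v ?ys) (above ?v ?ys) \<le> n - 1" by auto
    have b': "7 \<le> b" "stack_cost (wmem s ''sl'') p l + 10 * n + 20 + 222 * max (below ?v ?ys) (above ?v ?ys) + 1 \<le> b - 5 - 1"
      using b max g(2) True le(2) by linarith+
    show ?thesis
      unfolding select_step_def Let_def
      using f mode m True b' 
      apply (simp add: g_def[symmetric])
      apply (rule sel_inv_mode1[where p = p and l = l and n = n and q = q])
      using same frame
      apply (simp_all add: sel_words_def sel_reals_def sel_frame_def)
      done
  next
    case False
    let ?A = "rmem s ''A''"
    define s1 where "s1 = setw ''g'' 0 g s"
    have s1_g: "wmem s1 ''g'' 0 = g" by (simp add: s1_def)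
    have b': "stack_cost (wmem s ''sl'') p l + (10 * n + 20 + 222 * (n - 2 * g)) + 222 * g + 1 + (g * 19 + 13) \<le> b"
      using b g False by simp
    let ?Q = "\<lambda>s'. same {''i''} (wmem s') (wmem s1) \<and> same {''A'', ''a'', ''b'', ''c''} (rmem s') (rmem s1) \<and>
       (\<forall>i<l+n. rmem s' ''A'' i = rmem s1 ''A'' i) \<and>
       (\<forall>i<g. rmem s' ''A'' (l + n + i) = med9 (rmem s1 ''A'') (l + 9 * i))"
    have med: "wp W medians_com (\<lambda>s' _. ?Q s') s1 (g * 19 + 2)"
      using f W le g by (intro wp_medians_com) (auto simp: s1_def)
    have fin: "sel_inv F N s0 (setw ''q'' 0 (g div 2) (setw ''hi'' 0 (l + n + g) (setw ''lo'' 0 (l + n)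
      (setw ''sp'' 0 (Suc p) (setw ''sq'' p q (setw ''sl'' p l s')))))) b'"
      if Q: "?Q s'" and "stack_cost (wmem s ''sl'') p l + (10 * n + 20 + 222 * (n - 2 * g)) + 222 * g + 1 \<le> b'"
      for s' b'
    proof (rule sel_inv_mode0[where p = "Suc p" and l = "l + n" and n = g and q = "g div 2"], goal_cases)
      case 1
      then show ?case using Q same by (auto simp: s1_def sel_words_def)
    next
      case 2
      then show ?case using Q same by (auto simp: s1_def sel_reals_def)
    next
      case 3
      then show ?case using Q mode by (auto simp: s1_def)
    next
      case 4
      let ?A' = "rmem s' ''A''" and ?sl = "(wmem s ''sl'')(p := l)" and ?sq = "(wmem s ''sq'')(p := q)"
      have *: "wmem s' ''sl'' = wmem s ''sl''" "wmem s' ''sq'' = wmem s ''sq''"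
        using Q by (auto simp: s1_def)
      have A: "seg ?A' l n = seg ?A l n"
        using Q by (intro seg_cong) (auto simp: s1_def)
      have meds: "seg ?A' (l + n) g = map (\<lambda>i. med9 ?A (l + 9 * i)) [0..<g]"
        using Q by (auto simp: seg_def s1_def)
      have "stack_ok F N ?sl ?sq ?A' p l (is_qth (seg ?A' l n) q)"
        by (rule stack_ok_cong[of p "wmem s ''sl''" _ "wmem s ''sq''" _ l ?A]) (use f Q A in \<open>auto simp: s1_def\<close>)
      moreover have "below v (seg ?A' l n) + 2 * g \<le> n \<and> above v (seg ?A' l n) + 2 * g \<le> n"
        if "is_qth (seg ?A' (l + n) g) (g div 2) v" for v
      proof -
        from that have "is_qth (map (\<lambda>i. med9 ?A (l + 9 * i)) [0..<n div 9]) (n div 9 div 2) v"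
          using meds by (simp add: g_def)
        from median_of_medians[OF this] show ?thesis unfolding A g_def by auto
      qed
      ultimately show ?case
        using le g False by (auto simp: sel_frame_def * Let_def g_def[symmetric])
    next
      case 5
      have "wmem s' ''sl'' = wmem s ''sl''" using Q by (auto simp: s1_def)
      moreover have "stack_cost ((wmem s ''sl'')(p := l)) p l = stack_cost (wmem s ''sl'') p l"
        by (rule stack_cost_cong) auto
      ultimately show ?case using that by (simp add: Let_def g_def[symmetric])
    qed
    show ?thesis
      unfolding select_step_def Let_def
      using f mode m False b' s1_g
      apply (simp add: g_def[symmetric] s1_def[symmetric])
      apply (rule wp_conseq[OF med])
       apply linarith
      apply (simp add: s1_def)
      apply (rule fin)
       apply (simp add: s1_def)
      apply simp
      done
  qed
qed

lemma select_step_pivot: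
  assumes W: "N + 20 \<le> W"
    and same: "same sel_words (wmem s) (wmem s0)" "same sel_reals (rmem s) (rmem s0)"
    and mode: "wmem s ''mode'' 0 = 1" and frame: "sel_frame F N s p l n q"
    and b: "stack_cost (wmem s ''sl'') p l + 10 * n + 20 +
        222 * max (below (rmem s ''v'' 0) (seg (rmem s ''A'') l n))
            (above (rmem s ''v'' 0) (seg (rmem s ''A'') l n)) + 1 \<le> b"
  shows "wp W select_step (sel_inv F N s0) s (b - 1)"
proof -
  note f = frame[unfolded sel_frame_def]
  from f have le: "l + 2 * n \<le> N" "q < n" by auto
  from f stack_ok_height have p: "p \<le> l" by blast
  let ?A = "rmem s ''A''" and ?v = "rmem s ''v'' 0"
  let ?ys = "seg ?A l n"
  define cl ch where "cl = below ?v ?ys" and "ch = above ?v ?ys"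
  have cn: "cl + ch \<le> n"
    using below_above_le_length[of ?v ?ys] by (simp add: cl_def ch_def)
  have m: "0 mod W = 0" "1 mod W = 1" "2 mod W = 2" "n mod W = n" "l mod W = l"
    "(l + n) mod W = l + n" "q mod W = q" "p mod W = p" "cl mod W = cl" "ch mod W = ch"
    "(q + ch) mod W = q + ch" "Suc 0 mod W = Suc 0" "(p - Suc 0) mod W = p - Suc 0"
    "(n - ch) mod W = n - ch" "(q - (n - ch)) mod W = q - (n - ch)"
    using W le p cn by auto
  define D where "D = stack_cost (wmem s ''sl'') p l + 222 * max cl ch"
  have W1: "W \<noteq> Suc 0" using W by simp
  have b': "D + 10 * n + 21 \<le> b"
    using b by (simp add: D_def cl_def ch_def)
  let ?Q = "\<lambda>s'. same {''i'', ''cl'', ''ch''} (wmem s') (wmem s) \<and> rmem s' = rmem s \<and>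
       wmem s' ''cl'' 0 = cl \<and> wmem s' ''ch'' 0 = ch"
  have count: "wp W count_com (\<lambda>s' _. ?Q s') s (n * 5 + 4)"
    unfolding cl_def ch_def by (rule wp_count_com) (use f W le in auto)
  define rest where "rest =
       (If (WLess (sv ''q'') (sv ''cl''))
          (Seq (compact_com (RLess (RMem ''A'' (WAdd (sv ''lo'') (sv ''i''))) (RMem ''v'' (WConst 0))))
            (wset ''mode'' (WConst 0)))
          (If (WLess (WAdd (sv ''q'') (sv ''ch'')) (WSub (sv ''hi'') (sv ''lo'')))
            (If (WLess (sv ''sp'') (WConst 1)) (wset ''mode'' (WConst 2))
              (Seq (wset ''sp'' (WSub (sv ''sp'') (WConst 1)))
              (Seq (wset ''hi'' (sv ''lo''))
              (Seq (wset ''lo'' (WMem ''sl'' (sv ''sp'')))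
                (wset ''q'' (WMem ''sq'' (sv ''sp'')))))))
            (Seq (wset ''q'' (WSub (sv ''q'') (WSub (WSub (sv ''hi'') (sv ''lo'')) (sv ''ch''))))
            (Seq (compact_com (RLess (RMem ''v'' (WConst 0)) (RMem ''A'' (WAdd (sv ''lo'') (sv ''i'')))))
              (wset ''mode'' (WConst 0))))))"
  have rest: "wp W rest (sel_inv F N s0) s' b1"
    if Q: "?Q s'" and b1: "D + 5 * n + 15 \<le> b1" for s' b1
  proof -
    have same': "same sel_words (wmem s') (wmem s0)" "same sel_reals (rmem s') (rmem s0)"
      using Q same by (auto simp: sel_words_def sel_reals_def)
    have f': "wmem s' ''sp'' 0 = p" "wmem s' ''lo'' 0 = l" "wmem s' ''hi'' 0 = l + n" "wmem s' ''q'' 0 = q"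
      "wmem s' ''mode'' 0 = 1" "wmem s' ''cl'' 0 = cl" "wmem s' ''ch'' 0 = ch"
      "wmem s' ''sl'' = wmem s ''sl''" "wmem s' ''sq'' = wmem s ''sq''" "rmem s' = rmem s"
      using Q f mode by auto
    \<comment> \<open>Common to both partition cases: the sublist \<open>zs\<close> on one side of
      the pivot becomes the current segment, and the maximum in \<open>D\<close> pays for either
      side.\<close>
    have shrink: "sel_inv F N s0 s2 b2"
      if "same sel_words (wmem s2) (wmem s0)" "same sel_reals (rmem s2) (rmem s0)" "wmem s2 ''mode'' 0 = 0"
        "wmem s2 ''sp'' 0 = p" "wmem s2 ''lo'' 0 = l" "wmem s2 ''q'' 0 = q'"
        "wmem s2 ''hi'' 0 = l + length zs" "wmem s2 ''sl'' = wmem s ''sl''" "wmem s2 ''sq'' = wmem s ''sq''"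
        "\<forall>i<l. rmem s2 ''A'' i = ?A i" "seg (rmem s2 ''A'') l (length zs) = zs"
        "q' < length zs" "length zs \<le> max cl ch" "\<And>v. is_qth zs q' v \<Longrightarrow> is_qth ?ys q v"
        "D + 1 \<le> b2" for s2 b2 q' zs
    proof (rule sel_inv_mode0[where p = p and l = l and n = "length zs" and q = q'])
      have "stack_ok F N (wmem s ''sl'') (wmem s ''sq'') (rmem s2 ''A'') p l (is_qth ?ys q)"
        by (rule stack_ok_cong[of p "wmem s ''sl''" _ "wmem s ''sq''" _ l ?A]) (use f that in auto)
      then have "stack_ok F N (wmem s ''sl'') (wmem s ''sq'') (rmem s2 ''A'') p l (is_qth zs q')"
        by (rule stack_ok_mono) (use that in auto)
      then show "sel_frame F N s2 p l (length zs) q'"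
        using that le cn by (simp add: sel_frame_def)
      have "222 * length zs \<le> 222 * max cl ch" using that by simp
      then show "stack_cost (wmem s2 ''sl'') p l + 222 * length zs + 1 \<le> b2"
        using that(8,15) by (simp add: D_def)
    qed (use that in auto)
    consider "q < cl" | "\<not> q < cl" "q + ch < n" | "\<not> q < cl" "n \<le> q + ch" by linarith
    then show ?thesis
    proof cases
      case 1
      let ?zs = "filter (\<lambda>x. x < ?v) ?ys"
      have len: "length ?zs = cl" by (simp add: cl_def below_def)
      have c: "wp W (compact_com (RLess (RMem ''A'' (WAdd (sv ''lo'') (sv ''i''))) (RMem ''v'' (WConst 0))))
        (\<lambda>s2 _. same {''i'', ''w'', ''hi''} (wmem s2) (wmem s') \<and> same {''A''} (rmem s2) (rmem s') \<and>
       (\<forall>i<l. rmem s2 ''A'' i = rmem s' ''A'' i) \<and> wmem s2 ''hi'' 0 = l + length ?zs \<and>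
       seg (rmem s2 ''A'') l (length ?zs) = ?zs) s' (n * 5 + 4)"
        using wp_compact_com[of W l n s' ?v _ "\<lambda>x. x < ?v"] W le f' m by simp
      have qth: "is_qth ?ys q v" if "is_qth ?zs q v" for v
        using that by (rule is_qth_filter_less)
      have fin: "sel_inv F N s0 (setw ''mode'' 0 0 s2) b2"
        if Q2: "same {''i'', ''w'', ''hi''} (wmem s2) (wmem s')" "same {''A''} (rmem s2) (rmem s')"
          "\<forall>i<l. rmem s2 ''A'' i = rmem s' ''A'' i" "wmem s2 ''hi'' 0 = l + length ?zs"
          "seg (rmem s2 ''A'') l (length ?zs) = ?zs"
          and b2: "D + 1 \<le> b2" for s2 b2
      proof (rule shrink[of _ q ?zs], goal_cases)
        case 1
        then show ?case using Q2(1) same'(1) by (auto simp: sel_words_def)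
      next
        case 2
        then show ?case using Q2(2) same'(2) by (auto simp: sel_reals_def)
      next
        case (14 v)
        then show ?case by (rule qth)
      qed (use Q2 b2 f' 1 len in simp_all)
      show ?thesis
        unfolding rest_def
        using b1
        apply (simp add: 1 f' m W1)
        apply (rule wp_conseq[OF c])
         apply simp
        apply simp
        apply (rule fin)
             apply simp_all
        done
    next
      case 2
      then have qth: "is_qth ?ys q ?v"
        by (simp add: is_qth_def cl_def ch_def)
      show ?thesis
      proof (cases p)
        case 0
        then have "F ?v" using qth f by simp
        then show ?thesis
          unfolding rest_def sel_inv_def
          using 2 f' m b1 0 same' by (simp add: sel_words_def sel_reals_def)
      next
        \<comment> \<open>The problem is solved and another one waits. The value found is the
          balanced pivot promised by the frame, so the waiting segment resumes in mode 1, paid for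
          by the top term of \<open>stack_cost\<close>.\<close>
        case (Suc p')
        let ?l = "wmem s ''sl'' p'"
        let ?q = "wmem s ''sq'' p'"
        define n' where "n' = l - ?l"
        from f Suc qth have st: "?l + 9 \<le> l" "l + n' \<le> N" "?q < n'"
          "below ?v (seg ?A ?l n') + 2 * (n' div 9) \<le> n'" "above ?v (seg ?A ?l n') + 2 * (n' div 9) \<le> n'"
          "stack_ok F N (wmem s ''sl'') (wmem s ''sq'') ?A p' ?l (is_qth (seg ?A ?l n') ?q)"
          by (auto simp: Let_def n'_def)
        from st(2,1) have ln: "l = ?l + n'" by (simp add: n'_def)
        have m': "p' mod W = p'" "?l mod W = ?l" "?q mod W = ?q"
          using W le p Suc st ln by auto
        have cost: "stack_cost (wmem s ''sl'') p l = 10 * n' + 20 + 222 * (n' - 2 * (n' div 9)) +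
            stack_cost (wmem s ''sl'') p' ?l"
          by (simp add: Suc Let_def n'_def)
        have max: "max (below ?v (seg ?A ?l n')) (above ?v (seg ?A ?l n')) \<le> n' - 2 * (n' div 9)"
          using st by auto
        let ?s2 = "setw ''q'' 0 ?q (setw ''lo'' 0 ?l (setw ''hi'' 0 l (setw ''sp'' 0 p' s')))"
        have fin: "sel_inv F N s0 ?s2 b2"
          if "D + 1 \<le> b2" for b2
        proof (rule sel_inv_mode1[where p = p' and l = ?l and n = n' and q = ?q], goal_cases)
          case 1
          then show ?case using same'(1) by (auto simp: sel_words_def)
        next
          case 2
          then show ?case using same'(2) by simp
        next
          case 3
          then show ?case using f' by simp
        next
          case 4
          have "?l + 2 * n' \<le> N" using st(2) ln by linarith
          then show ?case using f' st(3,6) ln[symmetric] by (simp add: sel_frame_def)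
        next
          case 5
          have "222 * max (below ?v (seg ?A ?l n')) (above ?v (seg ?A ?l n')) \<le> 222 * (n' - 2 * (n' div 9))"
            using max by (rule mult_le_mono2)
          then have "stack_cost (wmem s ''sl'') p' ?l + 10 * n' + 20 +
              222 * max (below ?v (seg ?A ?l n')) (above ?v (seg ?A ?l n')) + 1 \<le> b2"
            using cost that unfolding D_def by linarith
          then show ?case using f' by simp
        qed
        show ?thesis
          unfolding rest_def
          using 2 f' m m' b1 Suc
          apply simp
          apply (rule fin)
          apply simp
          done
      qed
    next
      case 3
      let ?zs = "filter (\<lambda>x. ?v < x) ?ys"
      let ?q = "q - (n - ch)"
      let ?s = "setw ''q'' 0 ?q s'"
      have len: "length ?zs = ch" by (simp add: ch_def above_def)
      have q': "?q < ch" using 3 le cn by simp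
      have c: "wp W (compact_com (RLess (RMem ''v'' (WConst 0)) (RMem ''A'' (WAdd (sv ''lo'') (sv ''i'')))))
        (\<lambda>s2 _. same {''i'', ''w'', ''hi''} (wmem s2) (wmem ?s) \<and> same {''A''} (rmem s2) (rmem ?s) \<and>
       (\<forall>i<l. rmem s2 ''A'' i = rmem ?s ''A'' i) \<and> wmem s2 ''hi'' 0 = l + length ?zs \<and>
       seg (rmem s2 ''A'') l (length ?zs) = ?zs) ?s (n * 5 + 4)"
        using wp_compact_com[of W l n ?s ?v _ "\<lambda>x. ?v < x"] W le f' m by simp
      have qth: "is_qth ?ys q v" if "is_qth ?zs ?q v" for v
      proof (rule is_qth_filter_greater)
        show "is_qth ?zs (q - (length ?ys - above ?v ?ys)) v"
          using that by (simp only: ch_def length_seg)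
        show "length ?ys \<le> q + above ?v ?ys"
          using 3(2) by (simp only: ch_def length_seg)
      qed
      have fin: "sel_inv F N s0 (setw ''mode'' 0 0 s2) b2"
        if Q2: "same {''i'', ''w'', ''hi''} (wmem s2) (wmem ?s)" "same {''A''} (rmem s2) (rmem ?s)"
          "\<forall>i<l. rmem s2 ''A'' i = rmem ?s ''A'' i" "wmem s2 ''hi'' 0 = l + length ?zs"
          "seg (rmem s2 ''A'') l (length ?zs) = ?zs"
          and b2: "D + 1 \<le> b2" for s2 b2
      proof (rule shrink[of _ ?q ?zs], goal_cases)
        case 1
        then show ?case using Q2(1) same'(1) by (auto simp: sel_words_def)
      next
        case 2
        then show ?case using Q2(2) same'(2) by (auto simp: sel_reals_def)
      next
        case (14 v)
        then show ?case by (rule qth)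
      qed (use Q2 b2 f' q' len in simp_all)
      show ?thesis
        unfolding rest_def
        using b1
        apply (simp add: 3 not_less[THEN iffD2, OF 3(2)] f' m W1)
        apply (rule wp_conseq[OF c])
         apply simp
        apply simp
        apply (rule fin)
             apply simp_all
        done
    qed
  qed
  show ?thesis
    unfolding select_step_def Let_def rest_def[symmetric]
    using f mode m b'
    apply simp
    apply (rule wp_conseq[OF count])
     apply simp
    apply (rule rest)
     apply simp
    apply simp
    done
qed

text \<open>At the start the stack is empty, so \<open>F\<close> is the specification itself, and
  the space \<open>2 * n\<close> is what the frame invariant asks for at
  \<open>l = 0\<close>.\<close>

lemma wp_select_com:
  assumes W: "2 * n + 20 \<le> W" and s: "wmem s ''hi'' 0 = n" "wmem s ''q'' 0 = q" "q < n"
  shows "wp W select_com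
    (\<lambda>s' _. same sel_words (wmem s') (wmem s) \<and> same sel_reals (rmem s') (rmem s) \<and>
       is_qth (seg (rmem s ''A'') 0 n) q (rmem s' ''v'' 0)) s (222 * n + 4)"
proof -
  define F where "F = is_qth (seg (rmem s ''A'') 0 n) q"
  have m: "0 mod W = 0" "1 mod W = 1" "2 mod W = 2" "Suc 0 mod W = Suc 0" using W by auto
  let ?s = "setw ''mode'' 0 0 (setw ''sp'' 0 0 (setw ''lo'' 0 0 s))"
  have "wp W (While (WLess (sv ''mode'') (WConst 2)) select_step)
     (\<lambda>s' _. same sel_words (wmem s') (wmem s) \<and> same sel_reals (rmem s') (rmem s) \<and> F (rmem s' ''v'' 0))
     ?s (222 * n + 1)"
  proof (rule wp_While[where I = "sel_inv F (2 * n) s"])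
    show "sel_inv F (2 * n) s ?s (222 * n + 1)"
      by (rule sel_inv_mode0[where p = 0 and l = 0 and n = n and q = q])
        (use s in \<open>auto simp: sel_words_def sel_frame_def F_def\<close>)
    show "0 < b" if "sel_inv F (2 * n) s s' b" for s' b
      using that unfolding sel_inv_def by auto
    show "wp W select_step (sel_inv F (2 * n) s) s' (b - 1)"
      if I: "sel_inv F (2 * n) s s' b" and c: "bval W s' (WLess (sv ''mode'') (WConst 2))" for s' b
      using I select_step_push[OF W, of s' s F _ _ _ _ b] select_step_pivot[OF W, of s' s F _ _ _ _ b] c m
      unfolding sel_inv_def[of F _ s s' b] by auto
    show "same sel_words (wmem s') (wmem s) \<and> same sel_reals (rmem s') (rmem s) \<and> F (rmem s' ''v'' 0)"
      if I: "sel_inv F (2 * n) s s' b" and c: "\<not> bval W s' (WLess (sv ''mode'') (WConst 2))" for s' b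
      using I c m unfolding sel_inv_def by auto
  qed
  then show ?thesis
    unfolding select_com_def F_def using m by simp
qed

section \<open>The decoder\<close>

definition row_exp :: wexp where
  "row_exp = WMem ''row'' (WAdd (WMul (WMem ''L'' (sv ''p'')) (sv ''m'')) (sv ''t''))"

definition norm_com :: com where
  "norm_com = Seq (rset ''M'' (OfWord (WConst 1)))
    (for_loop ''i'' (sv ''m'')
      (If (RLess (RMem ''y'' (sv ''i'')) (OfWord (WConst 0)))
        (rset ''M'' (RSub (RMem ''M'' (WConst 0)) (RMem ''y'' (sv ''i''))))
        (rset ''M'' (RAdd (RMem ''M'' (WConst 0)) (RMem ''y'' (sv ''i''))))))"

definition load_com :: com where
  "load_com = for_loop ''p'' (sv ''l'') (for_loop ''t'' (sv ''d'')
     (Seq (wset ''r'' row_exp) (WAssign ''cnt'' (sv ''r'') (WAdd (WMem ''cnt'' (sv ''r'')) (WConst 1)))))"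

definition values_com :: com where
  "values_com = for_loop ''t'' (sv ''d'')
    (Seq (wset ''r'' row_exp)
      (If (WLess (WMem ''cnt'' (sv ''r'')) (WConst 2))
        (If (RLess (RMem ''y'' (sv ''r'')) (OfWord (WConst 0)))
          (RAssign ''A'' (sv ''t'') (RSub (OfWord (WConst 0)) (RMem ''y'' (sv ''r''))))
          (RAssign ''A'' (sv ''t'') (RMem ''y'' (sv ''r''))))
        (RAssign ''A'' (sv ''t'') (RMem ''M'' (WConst 0)))))"

definition estimate_com :: com where
  "estimate_com = for_loop ''p'' (sv ''l'')
    (Seq values_com
    (Seq (wset ''hi'' (sv ''d''))
    (Seq (wset ''q'' (WDiv (sv ''d'') (WConst 2)))
    (Seq select_com (RAssign ''Z'' (sv ''p'') (RMem ''v'' (WConst 0)))))))"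

text \<open>The subtraction is truncated: if \<open>L\<close> has at most \<open>3 * k\<close>
  elements, the threshold is the smallest estimate and every element is chosen.\<close>

definition threshold_com :: com where
  "threshold_com =
     Seq (for_loop ''p'' (sv ''l'') (RAssign ''A'' (sv ''p'') (RMem ''Z'' (sv ''p''))))
    (Seq (wset ''hi'' (sv ''l''))
    (Seq (wset ''q'' (WSub (sv ''l'') (WMul (WConst 3) (sv ''k'')))) select_com))"

definition append_com :: com where
  "append_com = Seq (WAssign ''S'' (sv ''s'') (WMem ''L'' (sv ''p''))) (wset ''s'' (WAdd (sv ''s'') (WConst 1)))"

text \<open>Two passes, since elements equal to the threshold must not take slots before all larger
  ones are listed.\<close>

definition output_com :: com where
  "output_com =
     Seq (for_loop ''p'' (sv ''l'')
       (If (RLess (RMem ''v'' (WConst 0)) (RMem ''Z'' (sv ''p''))) append_com Skip))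
      (for_loop ''p'' (sv ''l'')
       (If (Conj (Neg (RLess (RMem ''v'' (WConst 0)) (RMem ''Z'' (sv ''p''))))
            (Conj (Neg (RLess (RMem ''Z'' (sv ''p'')) (RMem ''v'' (WConst 0))))
              (WLess (sv ''s'') (WMul (WConst 3) (sv ''k''))))) append_com Skip))"

text \<open>The number of blocks is not given as a scalar. It is read off as the degree of column 0,
  because every column has exactly one nonzero entry per block.\<close>

definition decoder :: com where
  "decoder = Seq (wset ''d'' (WMem ''deg'' (WConst 0)))
    (Seq norm_com (Seq load_com (Seq estimate_com (Seq threshold_com output_com))))"

text \<open>Elements of \<open>L\<close> are addressed by their position in the input list, and the
  matrix enters only through \<open>row p t\<close>, the row of the t-th nonzero entry of the p-th
  element. The bounds by \<open>W\<close> exclude that addresses and counters wrap around.\<close>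

locale decoding =
  fixes W m N d k :: nat and L :: "nat \<Rightarrow> nat" and row :: "nat \<Rightarrow> nat \<Rightarrow> nat" and y :: "nat \<Rightarrow> real"
  assumes W: "2 * N + 20 \<le> W" "2 * d + 20 \<le> W" "N * d < W" "3 * k < W" "m < W"
    and L: "\<And>p. p < N \<Longrightarrow> L p < W" and addr: "\<And>p t. p < N \<Longrightarrow> t < d \<Longrightarrow> L p * m + t < W"
    and row: "\<And>p t. p < N \<Longrightarrow> t < d \<Longrightarrow> row p t < m"
    and pos: "0 < d" "0 < N" "0 < k"
begin

definition input_ok :: "ram \<Rightarrow> bool" where
  "input_ok s \<longleftrightarrow> wmem s ''m'' 0 = m \<and> wmem s ''l'' 0 = N \<and> wmem s ''d'' 0 = d \<and> wmem s ''k'' 0 = k \<and>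
     (\<forall>p<N. wmem s ''L'' p = L p) \<and> (\<forall>p<N. \<forall>t<d. wmem s ''row'' (L p * m + t) = row p t) \<and>
     (\<forall>i<m. rmem s ''y'' i = y i)"

definition load :: "nat \<Rightarrow> nat \<Rightarrow> nat" where
  "load j b = (\<Sum>p<j. \<Sum>t<d. of_bool (row p t = b))"

text \<open>Exceeds every measurement and thus stands for an infinite value.\<close>

definition big :: real where
  "big = 1 + (\<Sum>i<m. \<bar>y i\<bar>)"

definition bucket_value :: "nat \<Rightarrow> nat \<Rightarrow> real" where
  "bucket_value p t = (if load N (row p t) < 2 then \<bar>y (row p t)\<bar> else big)"

lemma mods: "0 mod W = 0" "W \<noteq> Suc 0" "2 mod W = 2" "3 mod W = 3" "m mod W = m"
    "N mod W = N" "d mod W = d" "k mod W = k" "(3 * k) mod W = 3 * k" "(d div 2) mod W = d div 2"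
    "(N - 3 * k) mod W = N - 3 * k"
  using W by auto

lemma input_ok_cong:
  assumes "same X (wmem s') (wmem s)" "same Y (rmem s') (rmem s)"
    "X \<inter> {''m'', ''l'', ''d'', ''k'', ''L'', ''row''} = {}" "''y'' \<notin> Y"
  shows "input_ok s \<Longrightarrow> input_ok s'"
proof -
  have "wmem s' a = wmem s a" if "a \<in> {''m'', ''l'', ''d'', ''k'', ''L'', ''row''}" for a
    using assms that by blast
  moreover have "rmem s' ''y'' = rmem s ''y''" using assms by blast
  ultimately show "input_ok s \<Longrightarrow> input_ok s'" by (simp add: input_ok_def)
qed

lemma wp_norm_com:
  assumes "input_ok s"
  shows "wp W norm_com (\<lambda>s' _. same {''i''} (wmem s') (wmem s) \<and> same {''M''} (rmem s') (rmem s) \<and>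
    rmem s' ''M'' 0 = big) s (m * 4 + 3)"
proof -
  let ?I = "\<lambda>j s'. wmem s' ''i'' 0 = j \<and> same {''i''} (wmem s') (wmem s) \<and>
    same {''M''} (rmem s') (rmem s) \<and> rmem s' ''M'' 0 = 1 + (\<Sum>i<j. \<bar>y i\<bar>)"
  have "wp W (for_loop ''i'' (sv ''m'')
      (If (RLess (RMem ''y'' (sv ''i'')) (OfWord (WConst 0)))
        (rset ''M'' (RSub (RMem ''M'' (WConst 0)) (RMem ''y'' (sv ''i''))))
        (rset ''M'' (RAdd (RMem ''M'' (WConst 0)) (RMem ''y'' (sv ''i''))))))
      (\<lambda>s' _. ?I m s') (setr ''M'' 0 1 s) (m * (2 + 2) + 2)"
    by (rule wp_for_loop) (use assms W in \<open>auto simp: mods input_ok_def\<close>)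
  then have "wp W norm_com (\<lambda>s' _. ?I m s') s (m * 4 + 3)"
    unfolding norm_com_def by (simp add: mods)
  then show ?thesis
    by (rule wp_conseq) (auto simp: big_def)
qed

lemma wval_row_exp:
  assumes "input_ok s" "p < N" "t < d" "wmem s ''p'' 0 = p" "wmem s ''t'' 0 = t"
  shows "wval W s row_exp = row p t"
  using assms L[of p] addr[of p t] row[of p t] W
  by (simp add: row_exp_def input_ok_def mods mod_simps)

text \<open>Keeps the bucket counters below the word bound throughout the counting loop.\<close>

lemma load_le: "p < N \<Longrightarrow> t \<le> d \<Longrightarrow> load p b + (\<Sum>i<t. of_bool (row p i = b)) \<le> N * d"
proof -
  assume *: "p < N" "t \<le> d"
  have "load p b \<le> (\<Sum>p<p. \<Sum>t<d. 1)"
    unfolding load_def by (intro sum_mono) auto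
  moreover have "(\<Sum>i<t. of_bool (row p i = b)) \<le> (\<Sum>i<t. 1 :: nat)"
    by (intro sum_mono) auto
  moreover have "p * d + t \<le> Suc p * d" using * by simp
  moreover have "Suc p * d \<le> N * d" using * by (intro mult_le_mono1) auto
  ultimately show ?thesis by simp
qed

lemma wp_load_com:
  assumes "input_ok s" "\<And>b. wmem s ''cnt'' b = 0"
  shows "wp W load_com (\<lambda>s' _. same {''p'', ''t'', ''r'', ''cnt''} (wmem s') (wmem s) \<and> rmem s' = rmem s \<and>
    (\<forall>b. wmem s' ''cnt'' b = load N b)) s (N * (d * 4 + 4) + 2)"
proof -
  let ?same = "\<lambda>s'. same {''p'', ''t'', ''r'', ''cnt''} (wmem s') (wmem s) \<and> rmem s' = rmem s"
  let ?I = "\<lambda>j s'. wmem s' ''p'' 0 = j \<and> ?same s' \<and> (\<forall>b. wmem s' ''cnt'' b = load j b)"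
  have "wp W load_com (\<lambda>s' _. ?I N s') s (N * ((d * (2 + 2) + 2) + 2) + 2)"
    unfolding load_com_def
  proof (rule wp_for_loop[where I = ?I])
    fix j and s1 :: ram
    assume I: "?I j s1" and j: "j < N"
    let ?J = "\<lambda>t s'. wmem s' ''p'' 0 = j \<and> wmem s' ''t'' 0 = t \<and> ?same s' \<and>
      (\<forall>b. wmem s' ''cnt'' b = load j b + (\<Sum>i<t. of_bool (row j i = b)))"
    have "wp W (for_loop ''t'' (sv ''d'')
     (Seq (wset ''r'' row_exp) (WAssign ''cnt'' (sv ''r'') (WAdd (WMem ''cnt'' (sv ''r'')) (WConst 1)))))
      (\<lambda>s' _. ?J d s') s1 (d * (2 + 2) + 2)"
    proof (rule wp_for_loop[where I = ?J])
      fix t and s2 :: ram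
      assume J: "?J t s2" and t: "t < d"
      from J have "same {''p'', ''t'', ''r'', ''cnt''} (wmem s2) (wmem s)" "same {} (rmem s2) (rmem s)" by auto
      from input_ok_cong[OF this _ _ assms(1)] have "input_ok s2" by auto
      from wval_row_exp[OF this j t] J have r: "wval W s2 row_exp = row j t" by blast
      have m: "row j t mod W = row j t" using row[OF j t] W by auto
      let ?c = "load j (row j t) + (\<Sum>i<t. of_bool (row j i = row j t))"
      have "?c + 1 \<le> N * d" using load_le[of j "Suc t" "row j t"] j t by simp
      then have c: "?c mod W = ?c" "(?c + 1) mod W = ?c + 1" using W by auto
      show "wp W (Seq (wset ''r'' row_exp) (WAssign ''cnt'' (sv ''r'') (WAdd (WMem ''cnt'' (sv ''r'')) (WConst 1))))
        (\<lambda>s' _. wmem s' ''t'' 0 = t \<and> ?J (Suc t) (setw ''t'' 0 (Suc t) s')) s2 2"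
        using J r m c by (simp add: mods)
    qed (use I assms(1) W in \<open>auto simp: mods input_ok_def\<close>)
    then show "wp W (for_loop ''t'' (sv ''d'')
     (Seq (wset ''r'' row_exp) (WAssign ''cnt'' (sv ''r'') (WAdd (WMem ''cnt'' (sv ''r'')) (WConst 1)))))
      (\<lambda>s' _. wmem s' ''p'' 0 = j \<and> ?I (Suc j) (setw ''p'' 0 (Suc j) s')) s1 (d * (2 + 2) + 2)"
      by (rule wp_conseq) (auto simp: load_def)
  qed (use assms W in \<open>auto simp: mods input_ok_def load_def\<close>)
  then show ?thesis
    by (rule wp_conseq) (auto simp: algebra_simps)
qed

lemma wp_values_com:
  assumes "input_ok s" "\<And>b. wmem s ''cnt'' b = load N b" "rmem s ''M'' 0 = big"
    and p: "wmem s ''p'' 0 = p" "p < N"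
  shows "wp W values_com (\<lambda>s' _. same {''t'', ''r''} (wmem s') (wmem s) \<and> same {''A''} (rmem s') (rmem s) \<and>
    seg (rmem s' ''A'') 0 d = map (bucket_value p) [0..<d]) s (d * 6 + 2)"
proof -
  let ?J = "\<lambda>t s'. wmem s' ''t'' 0 = t \<and> same {''t'', ''r''} (wmem s') (wmem s) \<and>
    same {''A''} (rmem s') (rmem s) \<and> (\<forall>i<t. rmem s' ''A'' i = bucket_value p i)"
  have "wp W values_com (\<lambda>s' _. ?J d s') s (d * (4 + 2) + 2)"
    unfolding values_com_def
  proof (rule wp_for_loop[where I = ?J])
    fix t and s2 :: ram
    assume J: "?J t s2" and t: "t < d"
    from J have 1: "same {''t'', ''r''} (wmem s2) (wmem s)" "same {''A''} (rmem s2) (rmem s)" by auto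
    from input_ok_cong[OF this _ _ assms(1)] have ok: "input_ok s2" by auto
    from wval_row_exp[OF this p(2) t] J p have r: "wval W s2 row_exp = row p t" by auto
    have y: "rmem s2 ''y'' (row p t) = y (row p t)" using ok row[OF p(2) t] by (simp add: input_ok_def)
    have l: "load N b \<le> N * d" for b
      using load_le[of "N - 1" d b] pos by (cases N) (auto simp: load_def)
    have m: "row p t mod W = row p t" "t mod W = t" "load N b mod W = load N b" for b
      using row[OF p(2) t] W t l[of b] by auto
    show "wp W (Seq (wset ''r'' row_exp)
      (If (WLess (WMem ''cnt'' (sv ''r'')) (WConst 2))
        (If (RLess (RMem ''y'' (sv ''r'')) (OfWord (WConst 0)))
          (RAssign ''A'' (sv ''t'') (RSub (OfWord (WConst 0)) (RMem ''y'' (sv ''r''))))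
          (RAssign ''A'' (sv ''t'') (RMem ''y'' (sv ''r''))))
        (RAssign ''A'' (sv ''t'') (RMem ''M'' (WConst 0)))))
      (\<lambda>s' _. wmem s' ''t'' 0 = t \<and> ?J (Suc t) (setw ''t'' 0 (Suc t) s')) s2 4"
      using J assms y m r by (auto simp: mods bucket_value_def less_Suc_eq)
  qed (use assms W in \<open>auto simp: mods input_ok_def\<close>)
  then show ?thesis
    by (rule wp_conseq) (auto simp: seg_def)
qed

lemma wp_estimate_com:
  assumes "input_ok s" "\<And>b. wmem s ''cnt'' b = load N b" "rmem s ''M'' 0 = big"
  shows "wp W estimate_com
    (\<lambda>s' _. same (sel_words \<union> {''p'', ''t'', ''r''}) (wmem s') (wmem s) \<and>
       same (sel_reals \<union> {''Z''}) (rmem s') (rmem s) \<and>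
       (\<forall>p<N. is_qth (map (bucket_value p) [0..<d]) (d div 2) (rmem s' ''Z'' p))) s
    (N * (228 * d + 11) + 2)"
proof -
  let ?I = "\<lambda>j s'. wmem s' ''p'' 0 = j \<and> same (sel_words \<union> {''p'', ''t'', ''r''}) (wmem s') (wmem s) \<and>
    same (sel_reals \<union> {''Z''}) (rmem s') (rmem s) \<and>
    (\<forall>p<j. is_qth (map (bucket_value p) [0..<d]) (d div 2) (rmem s' ''Z'' p))"
  \<comment> \<open>\<open>228 * d + 9\<close> consists of \<open>6 * d + 2\<close> for the values,
    \<open>222 * d + 4\<close> for the selection and three assignments.\<close>
  have "wp W estimate_com (\<lambda>s' _. ?I N s') s (N * ((228 * d + 9) + 2) + 2)"
    unfolding estimate_com_def
  proof (rule wp_for_loop[where I = ?I])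
    fix j and s1 :: ram
    assume I: "?I j s1" and j: "j < N"
    then have 1: "same (sel_words \<union> {''p'', ''t'', ''r''}) (wmem s1) (wmem s)"
      "same (sel_reals \<union> {''Z''}) (rmem s1) (rmem s)" by auto
    then have ok: "input_ok s1"
      by (rule input_ok_cong[OF _ _ _ _ assms(1)]) (auto simp: sel_words_def sel_reals_def)
    have cM: "wmem s1 ''cnt'' b = load N b" "rmem s1 ''M'' 0 = big" for b
      using 1 assms by (auto simp: sel_words_def sel_reals_def)
    have fin: "?I (Suc j) (setw ''p'' 0 (Suc j) (setr ''Z'' j (rmem s3 ''v'' 0) s3))" "wmem s3 ''p'' 0 = j"
      if 2: "same {''t'', ''r''} (wmem s2) (wmem s1)" "same {''A''} (rmem s2) (rmem s1)"
        "seg (rmem s2 ''A'') 0 d = map (bucket_value j) [0..<d]"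
        and 3: "same sel_words (wmem s3) (wmem (setw ''q'' 0 (d div 2) (setw ''hi'' 0 d s2)))"
        "same sel_reals (rmem s3) (rmem s2)" "is_qth (seg (rmem s2 ''A'') 0 d) (d div 2) (rmem s3 ''v'' 0)"
      for s2 s3
    proof -
      have w: "wmem s3 a = wmem s1 a" if "a \<notin> sel_words \<union> {''t'', ''r''}" for a
        using 2(1) 3(1) that by (auto simp: sel_words_def)
      then show "wmem s3 ''p'' 0 = j"
        using I by (auto simp: sel_words_def)
      have r: "rmem s3 a = rmem s1 a" if "a \<notin> sel_reals" for a
        using 2(2) 3(2) that by (auto simp: sel_reals_def)
      then have Z: "rmem s3 ''Z'' = rmem s1 ''Z''"
        by (auto simp: sel_reals_def)
      show "?I (Suc j) (setw ''p'' 0 (Suc j) (setr ''Z'' j (rmem s3 ''v'' 0) s3))"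
        using I w r Z 2(3) 3(3) by (auto simp: less_Suc_eq)
    qed
    let ?Q = "\<lambda>s'. same {''t'', ''r''} (wmem s') (wmem s1) \<and> same {''A''} (rmem s') (rmem s1) \<and>
      seg (rmem s' ''A'') 0 d = map (bucket_value j) [0..<d]"
    have v: "wp W values_com (\<lambda>s' _. ?Q s') s1 (d * 6 + 2)"
      using I j by (intro wp_values_com ok cM) auto
    have step: "wp W (Seq (wset ''hi'' (sv ''d'')) (Seq (wset ''q'' (WDiv (sv ''d'') (WConst 2)))
        (Seq select_com (RAssign ''Z'' (sv ''p'') (RMem ''v'' (WConst 0))))))
      (\<lambda>s' _. wmem s' ''p'' 0 = j \<and> ?I (Suc j) (setw ''p'' 0 (Suc j) s')) s2 b"
      if 2: "?Q s2" and b: "222 * d + 7 \<le> b" for s2 b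
    proof -
      let ?s = "setw ''q'' 0 (d div 2) (setw ''hi'' 0 d s2)"
      have sel: "wp W select_com (\<lambda>s' _. same sel_words (wmem s') (wmem ?s) \<and> same sel_reals (rmem s') (rmem ?s) \<and>
         is_qth (seg (rmem ?s ''A'') 0 d) (d div 2) (rmem s' ''v'' 0)) ?s (222 * d + 4)"
        using W pos by (intro wp_select_com) auto
      have d: "wmem s2 ''d'' 0 = d" using 2 ok by (auto simp: input_ok_def)
      have jm: "j mod W = j" using j W by simp
      show ?thesis
        using b
        apply (simp add: d mods)
        apply (rule wp_conseq[OF sel])
         apply simp
        subgoal premises prems for s3 b'
          using fin[of s2 s3] prems 2 jm by (simp add: mods)
        done
    qed
    show "wp W (Seq values_com (Seq (wset ''hi'' (sv ''d'')) (Seq (wset ''q'' (WDiv (sv ''d'') (WConst 2)))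
        (Seq select_com (RAssign ''Z'' (sv ''p'') (RMem ''v'' (WConst 0)))))))
      (\<lambda>s' _. wmem s' ''p'' 0 = j \<and> ?I (Suc j) (setw ''p'' 0 (Suc j) s')) s1 (228 * d + 9)"
      unfolding wp_Seq[of W values_com]
      apply (rule wp_conseq[OF v])
       apply simp
      apply (erule step)
      apply simp
      done
  qed (use assms W in \<open>auto simp: mods input_ok_def sel_words_def\<close>)
  then show ?thesis
    by (rule wp_conseq) auto
qed

lemma wp_threshold_com:
  assumes "input_ok s"
  shows "wp W threshold_com
    (\<lambda>s' _. same (sel_words \<union> {''p''}) (wmem s') (wmem s) \<and> same sel_reals (rmem s') (rmem s) \<and>
       is_qth (map (rmem s ''Z'') [0..<N]) (N - 3 * k) (rmem s' ''v'' 0)) s (225 * N + 8)"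
proof -
  let ?I = "\<lambda>j s'. wmem s' ''p'' 0 = j \<and> same {''p''} (wmem s') (wmem s) \<and>
    same {''A''} (rmem s') (rmem s) \<and> (\<forall>i<j. rmem s' ''A'' i = rmem s ''Z'' i)"
  have copy: "wp W (for_loop ''p'' (sv ''l'') (RAssign ''A'' (sv ''p'') (RMem ''Z'' (sv ''p''))))
      (\<lambda>s' _. ?I N s') s (N * (1 + 2) + 2)"
    by (rule wp_for_loop[where I = ?I])
      (use assms W in \<open>auto simp: mods input_ok_def less_Suc_eq\<close>)
  have step: "wp W (Seq (wset ''hi'' (sv ''l''))
    (Seq (wset ''q'' (WSub (sv ''l'') (WMul (WConst 3) (sv ''k'')))) select_com))
    (\<lambda>s' _. same (sel_words \<union> {''p''}) (wmem s') (wmem s) \<and> same sel_reals (rmem s') (rmem s) \<and>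
       is_qth (map (rmem s ''Z'') [0..<N]) (N - 3 * k) (rmem s' ''v'' 0)) s2 b"
    if I: "?I N s2" and b: "222 * N + 6 \<le> b" for s2 b
  proof -
    let ?s = "setw ''q'' 0 (N - 3 * k) (setw ''hi'' 0 N s2)"
    have sel: "wp W select_com (\<lambda>s' _. same sel_words (wmem s') (wmem ?s) \<and> same sel_reals (rmem s') (rmem ?s) \<and>
         is_qth (seg (rmem ?s ''A'') 0 N) (N - 3 * k) (rmem s' ''v'' 0)) ?s (222 * N + 4)"
      using W pos by (intro wp_select_com) auto
    have c: "wmem s2 ''l'' 0 = N" "wmem s2 ''k'' 0 = k" using I assms by (auto simp: input_ok_def)
    have A: "seg (rmem s2 ''A'') 0 N = map (rmem s ''Z'') [0..<N]"
      using I by (simp add: seg_def)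
    show ?thesis
      using b
      apply (simp add: c mods)
      apply (rule wp_conseq[OF sel])
       apply simp
      subgoal premises prems for s3 b'
        using prems I A by (auto simp: sel_words_def sel_reals_def)
      done
  qed
  show ?thesis
    unfolding threshold_com_def wp_Seq[of W "for_loop ''p'' (sv ''l'') (RAssign ''A'' (sv ''p'') (RMem ''Z'' (sv ''p'')))"]
    apply (rule wp_conseq[OF copy])
     apply simp
    apply (erule step)
    apply simp
    done
qed

section \<open>Listing the largest estimates\<close>

definition top_set :: "(nat \<Rightarrow> real) \<Rightarrow> nat set \<Rightarrow> bool" where
  "top_set z P \<longleftrightarrow> P \<subseteq> {..<N} \<and> card P = min N (3 * k) \<and>
     (\<exists>v. (\<forall>p\<in>P. v \<le> z p) \<and> (\<forall>p\<in>{..<N} - P. z p \<le> v))"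

text \<open>If slots remain free, \<open>P\<close> contains all positions with estimate at least
  \<open>v\<close>, and at most \<open>N - 3 * k\<close> estimates are smaller. This forces
  \<open>N < 3 * k\<close>, and then \<open>P\<close> is everything.\<close>

lemma top_set_if_threshold:
  fixes z :: "nat \<Rightarrow> real"
  assumes v: "is_qth (map z [0..<N]) (N - 3 * k) v"
    and P: "{p. p < N \<and> v < z p} \<subseteq> P" "P \<subseteq> {p. p < N \<and> v \<le> z p}" "card P \<le> 3 * k"
      "card P < 3 * k \<Longrightarrow> {p. p < N \<and> v \<le> z p} \<subseteq> P"
  shows "top_set z P"
proof -
  have PN: "P \<subseteq> {..<N}" using P(2) by auto
  have "card P = min N (3 * k)"
  proof (cases "card P < 3 * k")
    case True
    then have "P = {p. p < N \<and> v \<le> z p}" using P by auto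
    moreover have "card {p. p < N \<and> v \<le> z p} = (\<Sum>p<N. of_bool (v \<le> z p))"
      by (simp add: lessThan_def Collect_conj_eq)
    ultimately have "card P + below v (map z [0..<N]) = N"
      using below_map_upt[of v z N] by simp
    with v True show ?thesis by (auto simp: is_qth_def)
  next
    case False
    moreover have "card P \<le> N" using card_mono[OF _ PN] by simp
    ultimately show ?thesis using P(3) by simp
  qed
  with PN P(1,2) show ?thesis
    unfolding top_set_def by (auto intro!: exI[of _ v])
qed

lemma wp_output_com:
  assumes ok: "input_ok s" and s0: "wmem s ''s'' 0 = 0"
    and v: "is_qth (map (rmem s ''Z'') [0..<N]) (N - 3 * k) (rmem s ''v'' 0)"
  shows "wp W output_com
    (\<lambda>s' _. \<exists>P. top_set (rmem s ''Z'') P \<and> decoder_output s' = L ` P) s (10 * N + 4)"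
proof -
  let ?z = "rmem s ''Z''" and ?v = "rmem s ''v'' 0"
  let ?fr = "\<lambda>s'. same {''p'', ''S'', ''s''} (wmem s') (wmem s) \<and> rmem s' = rmem s"
  let ?out = "\<lambda>s' P. P \<subseteq> {..<N} \<and> wmem s' ''s'' 0 = card P \<and> wmem s' ''S'' ` {..<card P} = L ` P"
  have append: "wp W append_com (\<lambda>s' _. wmem s' ''p'' 0 = j \<and> ?fr s' \<and> ?out s' (insert j P)) s1 2"
    if "?fr s1" "?out s1 P" "j < N" "j \<notin> P" "wmem s1 ''p'' 0 = j" for s1 P j
  proof -
    have fin: "finite P" using that(2) finite_subset by blast
    have "card (insert j P) \<le> N"
      using card_mono[of "{..<N}" "insert j P"] that by simp
    then have m: "j mod W = j" "L j mod W = L j" "card P mod W = card P" "Suc (card P) mod W = Suc (card P)"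
      using that(3,4) W L[of j] fin by auto
    have c: "{..<Suc (card P)} \<inter> {x. x \<noteq> card P} = {..<card P}" by auto
    have "wmem s1 ''L'' j = L j" using that ok by (auto simp: input_ok_def)
    then show ?thesis
      using that m fin c by (simp add: append_com_def mods)
  qed
  let ?I1 = "\<lambda>j s'. wmem s' ''p'' 0 = j \<and> ?fr s' \<and> ?out s' {p. p < j \<and> p < N \<and> ?v < ?z p}"
  let ?I2 = "\<lambda>j s'. wmem s' ''p'' 0 = j \<and> ?fr s' \<and> (\<exists>P. ?out s' P \<and> {p. p < N \<and> ?v < ?z p} \<subseteq> P \<and>
     P \<subseteq> {p. p < N \<and> ?v < ?z p} \<union> {p. p < j \<and> p < N \<and> ?v = ?z p} \<and> card P \<le> 3 * k \<and>
     (card P < 3 * k \<longrightarrow> {p. p < j \<and> p < N \<and> ?v \<le> ?z p} \<subseteq> P))"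
  let ?c1 = "RLess (RMem ''v'' (WConst 0)) (RMem ''Z'' (sv ''p''))"
  let ?c2 = "Conj (Neg (RLess (RMem ''v'' (WConst 0)) (RMem ''Z'' (sv ''p''))))
            (Conj (Neg (RLess (RMem ''Z'' (sv ''p'')) (RMem ''v'' (WConst 0))))
              (WLess (sv ''s'') (WMul (WConst 3) (sv ''k''))))"
  have loop1: "wp W (for_loop ''p'' (sv ''l'') (If ?c1 append_com Skip)) (\<lambda>s' _. ?I1 N s') s (N * (3 + 2) + 2)"
  proof (rule wp_for_loop[where I = ?I1])
    fix j and s1 :: ram
    assume I: "?I1 j s1" and j: "j < N"
    let ?P = "\<lambda>j. {p. p < j \<and> p < N \<and> ?v < ?z p}"
    have jm: "j mod W = j" using j W by simp
    show "wp W (If ?c1 append_com Skip) (\<lambda>s' _. wmem s' ''p'' 0 = j \<and> ?I1 (Suc j) (setw ''p'' 0 (Suc j) s')) s1 3"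
    proof (cases "?v < ?z j")
      case True
      then have P: "?P (Suc j) = insert j (?P j)" using j by (auto simp: less_Suc_eq)
      have "wp W append_com (\<lambda>s' _. wmem s' ''p'' 0 = j \<and> ?I1 (Suc j) (setw ''p'' 0 (Suc j) s')) s1 2"
        unfolding P by (rule wp_conseq[OF append[of s1 "?P j" j]]) (use I j in auto)
      then show ?thesis using True I jm by (simp add: mods)
    next
      case False
      then have "?P (Suc j) = ?P j" by (auto simp: less_Suc_eq)
      with False I jm show ?thesis by (simp add: mods)
    qed
  qed (use ok s0 W in \<open>auto simp: input_ok_def mods\<close>)
  have loop2: "wp W (for_loop ''p'' (sv ''l'') (If ?c2 append_com Skip)) (\<lambda>s' _. ?I2 N s') s2 (N * (3 + 2) + 2)"
    if I1: "?I1 N s2" for s2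
  proof (rule wp_for_loop[where I = ?I2])
    have "card {p. p < N \<and> ?v < ?z p} = N - (\<Sum>p<N. of_bool (?z p \<le> ?v))"
    proof -
      have "card {p. p < N \<and> ?v < ?z p} = card ({..<N} - {p. p < N \<and> ?z p \<le> ?v})"
        by (rule arg_cong[where f = card]) auto
      also have "\<dots> = N - card {p. p < N \<and> ?z p \<le> ?v}"
        by (subst card_Diff_subset) auto
      finally show ?thesis by (simp add: lessThan_def Collect_conj_eq)
    qed
    \<comment> \<open>By the choice of the rank, fewer than \<open>N - (N - 3 * k)\<close> estimates
      exceed the threshold, so the first pass does not overfill the output.\<close>
    then have "card {p. p < N \<and> ?v < ?z p} \<le> 3 * k"
      using v above_map_upt[of ?v ?z N] by (auto simp: is_qth_def)
    then show "?I2 0 (setw ''p'' 0 0 s2)"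
      using I1 by (auto intro!: exI[of _ "{p. p < N \<and> ?v < ?z p}"])
  next
    fix j and s1 :: ram
    assume I: "?I2 j s1" and j: "j < N"
    then obtain P where P: "?out s1 P" "{p. p < N \<and> ?v < ?z p} \<subseteq> P"
      "P \<subseteq> {p. p < N \<and> ?v < ?z p} \<union> {p. p < j \<and> p < N \<and> ?v = ?z p}" "card P \<le> 3 * k"
      "card P < 3 * k \<longrightarrow> {p. p < j \<and> p < N \<and> ?v \<le> ?z p} \<subseteq> P" by blast
    have jm: "j mod W = j" using j W by simp
    have fin: "finite P" using P(1) finite_subset by blast
    have cm: "card P mod W = card P" "wmem s1 ''k'' 0 = k"
      using P(4) W I ok by (auto simp: input_ok_def)
    show "wp W (If ?c2 append_com Skip) (\<lambda>s' _. wmem s' ''p'' 0 = j \<and> ?I2 (Suc j) (setw ''p'' 0 (Suc j) s')) s1 3"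
    proof (cases "?v = ?z j \<and> card P < 3 * k")
      case True
      then have jP: "j \<notin> P" using P(3) by auto
      have "wp W append_com (\<lambda>s' _. wmem s' ''p'' 0 = j \<and> ?I2 (Suc j) (setw ''p'' 0 (Suc j) s')) s1 2"
      proof (rule wp_conseq[OF append[of s1 P j]], goal_cases)
        case (7 s' b')
        have "insert j P \<subseteq> {p. p < N \<and> ?v < ?z p} \<union> {p. p < Suc j \<and> p < N \<and> ?v = ?z p}"
          "{p. p < N \<and> ?v < ?z p} \<subseteq> insert j P" "card (insert j P) \<le> 3 * k"
          using P(2,3) True j fin jP by auto
        moreover have "{p. p < Suc j \<and> p < N \<and> ?v \<le> ?z p} \<subseteq> insert j P"
          using P(5) True by (auto simp: less_Suc_eq)
        ultimately show ?case
          using 7 by (auto intro!: exI[of _ "insert j P"])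
      qed (use I P jP j in auto)
      then show ?thesis using True I jm cm P(1) by (simp add: mods)
    next
      case False
      have I': "?I2 (Suc j) (setw ''p'' 0 (Suc j) s1)"
      proof -
        have "P \<subseteq> {p. p < N \<and> ?v < ?z p} \<union> {p. p < Suc j \<and> p < N \<and> ?v = ?z p}"
          using P(3) by auto
        moreover have "{p. p < Suc j \<and> p < N \<and> ?v \<le> ?z p} \<subseteq> P" if "card P < 3 * k"
        proof -
          from that False have "?v \<noteq> ?z j" by simp
          with P(2) P(5) that show ?thesis by (force simp: less_Suc_eq)
        qed
        ultimately show ?thesis
          using I P(1,2,4) by (auto intro!: exI[of _ P])
      qed
      have pj: "wmem s1 ''p'' 0 = j" and fr: "rmem s1 = rmem s" using I by auto
      have "\<not> bval W s1 ?c2"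
        using False jm cm P(1) pj fr by (auto simp: mods)
      then show ?thesis
        unfolding wp_If wp_Skip by (simp only: if_False) (intro I' pj conjI; simp)
    qed
  qed (use I1 ok W in \<open>auto simp: input_ok_def mods\<close>)
  show ?thesis
    unfolding output_com_def wp_Seq
    apply (rule wp_conseq[OF loop1])
     apply simp
    apply (rule wp_conseq[OF loop2])
      apply assumption
     apply simp
    subgoal for s2 b2 s3 b3
    proof (elim conjE exE)
      fix P
      assume P: "wmem s3 ''s'' 0 = card P" "wmem s3 ''S'' ` {..<card P} = L ` P"
        "{p. p < N \<and> ?v < ?z p} \<subseteq> P"
        "P \<subseteq> {p. p < N \<and> ?v < ?z p} \<union> {p. p < N \<and> p < N \<and> ?v = ?z p}" "card P \<le> 3 * k"
        "card P < 3 * k \<longrightarrow> {p. p < N \<and> p < N \<and> ?v \<le> ?z p} \<subseteq> P"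
      have "top_set ?z P"
        by (rule top_set_if_threshold[OF v]) (use P in auto)
      with P(1,2) show ?thesis by (auto simp: decoder_output_def)
    qed
    done
qed

text \<open>The budgets of the five phases are added up; later \<open>N * d\<close> and
  \<open>N\<close> turn out to be at most \<open>m\<close>, which makes the total linear in
  \<open>m\<close>.\<close>

lemma wp_decoder:
  assumes s: "wmem s ''m'' 0 = m" "wmem s ''l'' 0 = N" "wmem s ''deg'' 0 = d" "wmem s ''k'' 0 = k"
    "\<And>p. p < N \<Longrightarrow> wmem s ''L'' p = L p" "\<And>p t. p < N \<Longrightarrow> t < d \<Longrightarrow> wmem s ''row'' (L p * m + t) = row p t"
    "\<And>i. i < m \<Longrightarrow> rmem s ''y'' i = y i" "\<And>b. wmem s ''cnt'' b = 0" "wmem s ''s'' 0 = 0"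
  shows "wp W decoder
    (\<lambda>s' _. \<exists>z P. (\<forall>p<N. is_qth (map (bucket_value p) [0..<d]) (d div 2) (z p)) \<and> top_set z P \<and>
      decoder_output s' = L ` P) s (4 * m + 232 * (N * d) + 250 * N + 20)"
proof -
  let ?X = "sel_words \<union> {''p'', ''t'', ''r''}" and ?Y = "sel_reals \<union> {''Z'', ''M''}"
  have ok1: "input_ok (setw ''d'' 0 d s)"
    using s by (simp add: input_ok_def)
  show ?thesis
    unfolding decoder_def wp_Seq
    apply (simp add: s mods)
    apply (rule wp_conseq[OF wp_norm_com[OF ok1]])
     apply simp
    subgoal for s1 b1
      apply (rule wp_conseq[OF wp_load_com])
         apply (rule input_ok_cong[OF _ _ _ _ ok1, of "{''i''}" _ "{''M''}"]; simp)
        apply (simp add: s)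
       apply (simp add: algebra_simps)
      subgoal for s2 b2
        apply (rule wp_conseq[OF wp_estimate_com])
            apply (rule input_ok_cong[OF _ _ _ _ ok1, of "?X \<union> {''i'', ''cnt''}" _ ?Y]; simp add: sel_words_def sel_reals_def)
           apply simp
          apply simp
         apply (simp add: algebra_simps)
        subgoal for s3 b3
          apply (rule wp_conseq[OF wp_threshold_com])
            apply (rule input_ok_cong[OF _ _ _ _ ok1, of "?X \<union> {''i'', ''cnt''}" _ ?Y]; simp add: sel_words_def sel_reals_def)
           apply (simp add: algebra_simps)
          subgoal for s4 b4
            apply (rule wp_conseq[OF wp_output_com])
                apply (rule input_ok_cong[OF _ _ _ _ ok1, of "?X \<union> {''i'', ''cnt''}" _ ?Y]; simp add: sel_words_def sel_reals_def)
               apply (simp add: s sel_words_def)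
              apply (simp add: sel_reals_def)
             apply (simp add: algebra_simps)
            apply (auto simp: sel_reals_def)
            done
          done
        done
      done
    done
qed

end

section \<open>The random matrix\<close>

text \<open>Markov's inequality for a strict threshold, which covers \<open>\<mu> = 0\<close> as
  well, because \<open>X\<close> then vanishes almost surely. This case arises when \<open>x\<close>
  has no mass outside \<open>L\<close>.\<close>

lemma prob_greater_le:
  fixes X :: "'a \<Rightarrow> real"
  assumes fin: "finite (set_pmf p)" and nn: "\<And>x. 0 \<le> X x" and E: "measure_pmf.expectation p X \<le> \<mu>" and "0 < c"
  shows "measure_pmf.prob p {x. c * \<mu> < X x} \<le> 1 / c"
proof -
  have int: "integrable (measure_pmf p) X" using fin by (rule integrable_measure_pmf_finite)
  have "0 \<le> measure_pmf.expectation p X" using nn by simp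
  with E consider "\<mu> = 0" "measure_pmf.expectation p X = 0" | "0 < \<mu>" by linarith
  then show ?thesis
  proof cases
    case 1
    then have "AE x in measure_pmf p. X x = 0"
      using integral_nonneg_eq_0_iff_AE[OF int] nn by simp
    then have "measure_pmf.prob p {x. c * \<mu> < X x} = 0"
      using 1 by (intro measure_pmf.prob_eq_0[THEN iffD2]) auto
    then show ?thesis using \<open>0 < c\<close> by simp
  next
    case 2
    have "measure_pmf.prob p {x. c * \<mu> < X x} \<le> measure_pmf.prob p {x. c * \<mu> \<le> X x}"
      by (intro measure_pmf.finite_measure_mono) auto
    also have "\<dots> \<le> measure_pmf.expectation p X / (c * \<mu>)"
      using integral_Markov_inequality_measure[OF int, of UNIV "c * \<mu>"] nn 2 \<open>0 < c\<close> by simp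
    also have "\<dots> \<le> \<mu> / (c * \<mu>)"
      using E 2 \<open>0 < c\<close> by (intro divide_right_mono) auto
    finally show ?thesis using 2 \<open>0 < c\<close> by simp
  qed
qed

section \<open>Random buckets and signs\<close>

definition row_pmf :: "nat \<Rightarrow> nat \<Rightarrow> (nat \<Rightarrow> nat \<times> bool) pmf" where
  "row_pmf n B = Pi_pmf {..<n} (0, False) (\<lambda>_. pmf_of_set ({..<B} \<times> UNIV))"

definition hash_pmf :: "nat \<Rightarrow> nat \<Rightarrow> nat \<Rightarrow> (nat \<Rightarrow> nat \<Rightarrow> nat \<times> bool) pmf" where
  "hash_pmf d n B = Pi_pmf {..<d} (\<lambda>_. (0, False)) (\<lambda>_. row_pmf n B)"

definition sg :: "bool \<Rightarrow> real" where
  "sg b = (if b then 1 else - 1)"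

lemma sg_square [simp]: "sg b * sg b = 1" and sg_neg [simp]: "sg (\<not> b) = - sg b"
  and abs_sg [simp]: "\<bar>sg b\<bar> = 1" and sg_nonzero [simp]: "sg b \<noteq> 0"
  by (auto simp: sg_def)

context
  fixes n B :: nat
  assumes B: "0 < B"
begin

lemma finite_values: "finite ({..<B} \<times> (UNIV :: bool set))" "{..<B} \<times> (UNIV :: bool set) \<noteq> {}"
  using B by auto

lemma set_row_pmf: "set_pmf (row_pmf n B) = PiE_dflt {..<n} (0, False) (\<lambda>_. {..<B} \<times> UNIV)"
  unfolding row_pmf_def by (subst set_Pi_pmf) (use finite_values in \<open>auto simp: PiE_dflt_def\<close>)

lemma finite_set_row_pmf: "finite (set_pmf (row_pmf n B))"
  unfolding set_row_pmf using finite_values by (intro finite_PiE_dflt) auto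

lemma finite_set_hash_pmf: "finite (set_pmf (hash_pmf d n B))"
  unfolding hash_pmf_def by (subst set_Pi_pmf) (use finite_set_row_pmf in \<open>auto intro!: finite_PiE_dflt\<close>)

lemma bucket_less: "g \<in> set_pmf (row_pmf n B) \<Longrightarrow> j < n \<Longrightarrow> fst (g j) < B"
  unfolding set_row_pmf PiE_dflt_def by (force simp: mem_Times_iff)

lemma hash_bucket_less:
  assumes "f \<in> set_pmf (hash_pmf d n B)" "r < d" "j < n"
  shows "fst (f r j) < B"
proof -
  have "f r \<in> set_pmf (row_pmf n B)"
    using assms unfolding hash_pmf_def by (subst (asm) set_Pi_pmf) (auto simp: PiE_dflt_def)
  then show ?thesis using assms(3) by (rule bucket_less)
qed

lemma row_pmf_uniform: "row_pmf n B = pmf_of_set (PiE_dflt {..<n} (0, False) (\<lambda>_. {..<B} \<times> UNIV))"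
  unfolding row_pmf_def by (rule Pi_pmf_of_set) (use finite_values in auto)

text \<open>Both indices fall into a given bucket with probability \<open>1 / B * (1 / B)\<close>,
  and there are \<open>B\<close> buckets.\<close>

lemma prob_collision:
  assumes "i < n" "j < n" "i \<noteq> j"
  shows "measure_pmf.prob (row_pmf n B) {g. fst (g j) = fst (g i)} = 1 / B"
proof -
  let ?p = "pmf_of_set ({..<B} \<times> (UNIV :: bool set))"
  have single: "measure_pmf.prob ?p {v. fst v = b} = 1 / B" if "b < B" for b
  proof -
    have "({..<B} \<times> (UNIV :: bool set)) \<inter> {v. fst v = b} = {b} \<times> UNIV" using that by auto
    then show ?thesis
      by (subst measure_pmf_of_set) (use finite_values B in \<open>auto simp: card_cartesian_product\<close>)
  qed
  have both: "measure_pmf.prob (row_pmf n B) {g. fst (g i) = b \<and> fst (g j) = b} = 1 / B * (1 / B)"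
    if "b < B" for b
  proof -
    have "{g :: nat \<Rightarrow> nat \<times> bool. fst (g i) = b \<and> fst (g j) = b} =
      Pi {..<n} (\<lambda>l. if l \<in> {i, j} then {v. fst v = b} else UNIV)"
      using assms by (auto simp: Pi_def)
    then have "measure_pmf.prob (row_pmf n B) {g. fst (g i) = b \<and> fst (g j) = b} =
      (\<Prod>l<n. measure_pmf.prob ?p (if l \<in> {i, j} then {v. fst v = b} else UNIV))"
      by (simp only: row_pmf_def measure_Pi_pmf_Pi finite_lessThan)
    also have "\<dots> = (\<Prod>l\<in>{i, j}. measure_pmf.prob ?p (if l \<in> {i, j} then {v. fst v = b} else UNIV))"
      using assms by (intro prod.mono_neutral_right) (auto simp del: measure_pmf_of_set)
    also have "\<dots> = 1 / B * (1 / B)"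
      using assms(3) single[OF that] by simp
    finally show ?thesis .
  qed
  have "measure_pmf.prob (row_pmf n B) {g. fst (g j) = fst (g i)} =
    measure_pmf.prob (row_pmf n B) (\<Union>b<B. {g. fst (g i) = b \<and> fst (g j) = b})"
    by (rule measure_prob_cong_0) (use bucket_less[OF _ assms(1)] in \<open>auto simp: set_pmf_iff\<close>)
  also have "\<dots> = (\<Sum>b<B. measure_pmf.prob (row_pmf n B) {g. fst (g i) = b \<and> fst (g j) = b})"
    by (intro measure_pmf.finite_measure_finite_Union) (auto simp: disjoint_family_on_def)
  also have "\<dots> = (\<Sum>b<B. 1 / B * (1 / B))"
    using both by simp
  also have "\<dots> = 1 / B" using B by simp
  finally show ?thesis .
qed

text \<open>Flipping one sign permutes a set on which the distribution is uniform. This symmetry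
  cancels the mixed terms of the variance.\<close>

lemma expectation_flip_sign:
  assumes "j < n"
  shows "measure_pmf.expectation (row_pmf n B) (\<lambda>g. \<phi> (g(j := (fst (g j), \<not> snd (g j))))) =
    measure_pmf.expectation (row_pmf n B) (\<phi> :: _ \<Rightarrow> real)"
proof -
  let ?\<sigma> = "\<lambda>g :: nat \<Rightarrow> nat \<times> bool. g(j := (fst (g j), \<not> snd (g j)))"
  let ?U = "PiE_dflt {..<n} (0, False) (\<lambda>_. {..<B} \<times> (UNIV :: bool set))"
  have "bij_betw ?\<sigma> ?U ?U"
    by (rule bij_betw_byWitness[where f' = ?\<sigma>])
      (use assms in \<open>auto simp: PiE_dflt_def mem_Times_iff\<close>)
  moreover have "?U \<noteq> {}" using finite_values by simp
  moreover have "finite ?U" using finite_values by (intro finite_PiE_dflt) auto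
  ultimately have "map_pmf ?\<sigma> (row_pmf n B) = row_pmf n B"
    unfolding row_pmf_uniform by (rule map_pmf_of_set_bij_betw)
  then have "measure_pmf.expectation (row_pmf n B) \<phi> = measure_pmf.expectation (map_pmf ?\<sigma> (row_pmf n B)) \<phi>"
    by simp
  then show ?thesis by simp
qed

end

section \<open>Noise and bad rows\<close>

definition noise :: "nat \<Rightarrow> (nat \<Rightarrow> real) \<Rightarrow> nat set \<Rightarrow> (nat \<Rightarrow> nat \<times> bool) \<Rightarrow> nat \<Rightarrow> real" where
  "noise n x L g i = (\<Sum>j\<in>{..<n} - L. of_bool (fst (g j) = fst (g i)) * sg (snd (g j)) * x j)"

text \<open>In the square of the noise, mixed terms vanish by the symmetry of a sign, and each
  diagonal term is weighted by a collision probability. As \<open>i\<close> is in \<open>L\<close>,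
  it differs from all summation indices.\<close>

lemma expectation_noise:
  assumes B: "0 < B" and i: "i < n" "i \<in> L"
  shows "measure_pmf.expectation (row_pmf n B) (\<lambda>g. (noise n x L g i)\<^sup>2) = (\<Sum>j\<in>{..<n} - L. (x j)\<^sup>2) / B"
proof -
  let ?E = "measure_pmf.expectation (row_pmf n B)" and ?J = "{..<n} - L"
  let ?c = "\<lambda>g j. of_bool (fst (g j) = fst (g i)) * sg (snd (g j)) * x j"
  have int: "integrable (measure_pmf (row_pmf n B)) (\<phi> :: _ \<Rightarrow> real)" for \<phi>
    using finite_set_row_pmf[OF B] by (rule integrable_measure_pmf_finite)
  have diag: "?E (\<lambda>g. ?c g j * ?c g j) = (x j)\<^sup>2 / B" if "j \<in> ?J" for j
  proof -
    have "?E (\<lambda>g. ?c g j * ?c g j) = ?E (\<lambda>g. (x j)\<^sup>2 * indicator {g. fst (g j) = fst (g i)} g)"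
      by (intro arg_cong[where f = ?E] ext) (auto simp: power2_eq_square)
    also have "\<dots> = (x j)\<^sup>2 * measure_pmf.prob (row_pmf n B) {g. fst (g j) = fst (g i)}"
      by simp
    also have "\<dots> = (x j)\<^sup>2 / B"
      using that i by (subst prob_collision[OF B]) auto
    finally show ?thesis .
  qed
  have cross: "?E (\<lambda>g. ?c g j * ?c g l) = 0" if "j \<in> ?J" "l \<in> ?J" "j \<noteq> l" for j l
  proof -
    \<comment> \<open>Flipping the sign of \<open>j\<close> keeps all buckets and the sign of
      \<open>l\<close>, so it negates the product.\<close>
    have "?E (\<lambda>g. ?c g j * ?c g l) = ?E (\<lambda>g. - (?c g j * ?c g l))"
    proof -
      have "j \<noteq> i" "j < n" using that i by auto
      then show ?thesis
        using that(3) by (subst expectation_flip_sign[OF B, of j n, symmetric]) simp_all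
    qed
    then show ?thesis by simp
  qed
  have "?E (\<lambda>g. (noise n x L g i)\<^sup>2) = ?E (\<lambda>g. \<Sum>j\<in>?J. \<Sum>l\<in>?J. ?c g j * ?c g l)"
    by (simp add: noise_def power2_eq_square sum_product)
  also have "\<dots> = (\<Sum>j\<in>?J. \<Sum>l\<in>?J. ?E (\<lambda>g. ?c g j * ?c g l))"
    by (subst Bochner_Integration.integral_sum, rule int)
      (intro sum.cong refl Bochner_Integration.integral_sum int)
  also have "\<dots> = (\<Sum>j\<in>?J. \<Sum>l\<in>?J. if l = j then (x j)\<^sup>2 / B else 0)"
    by (intro sum.cong refl) (use diag cross in auto)
  also have "\<dots> = (\<Sum>j\<in>?J. (x j)\<^sup>2) / B"
    by (simp add: sum_divide_distrib)
  finally show ?thesis .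
qed

text \<open>A row is good for i if no other element of L shares the bucket of i and the noise is of the
  order of its standard deviation.\<close>

definition bad_row :: "nat \<Rightarrow> nat \<Rightarrow> (nat \<Rightarrow> real) \<Rightarrow> nat set \<Rightarrow> nat \<Rightarrow> (nat \<Rightarrow> nat \<times> bool) \<Rightarrow> bool" where
  "bad_row n B x L i g \<longleftrightarrow> (\<exists>j\<in>L - {i}. fst (g j) = fst (g i)) \<or>
     128 * ((\<Sum>j\<in>{..<n} - L. (x j)\<^sup>2) / B) < (noise n x L g i)\<^sup>2"

text \<open>The union bound over collisions with \<open>L\<close> and Markov's inequality for the
  squared noise contribute 1 / 128 each. The total is the square of 1 / 8, which suits the count
  over half of the rows below.\<close>

lemma prob_bad_row:
  assumes B: "0 < B" "128 * card L \<le> B" and i: "L \<subseteq> {..<n}" "i \<in> L"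
  shows "measure_pmf.prob (row_pmf n B) {g. bad_row n B x L i g} \<le> 1 / 64"
proof -
  let ?P = "measure_pmf.prob (row_pmf n B)"
  have fin: "finite L" using i finite_subset by blast
  have i': "i < n" using i by auto
  let ?A = "\<Union>j\<in>L - {i}. {g :: nat \<Rightarrow> nat \<times> bool. fst (g j) = fst (g i)}"
  let ?N = "{g. 128 * ((\<Sum>j\<in>{..<n} - L. (x j)\<^sup>2) / B) < (noise n x L g i)\<^sup>2}"
  have "?P ?A \<le> (\<Sum>j\<in>L - {i}. ?P {g. fst (g j) = fst (g i)})"
    using fin by (intro measure_pmf.finite_measure_subadditive_finite) auto
  also have "\<dots> = (\<Sum>j\<in>L - {i}. 1 / B)"
    by (intro sum.cong refl prob_collision) (use B i in auto)
  also have "\<dots> \<le> card L / B"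
    using fin by (simp add: divide_right_mono card_Diff1_le)
  also have "\<dots> \<le> 1 / 128"
  proof -
    from B(2) have "real (128 * card L) \<le> real B" by (simp only: of_nat_le_iff)
    with B(1) show ?thesis by (simp add: field_simps)
  qed
  finally have A: "?P ?A \<le> 1 / 128" .
  have N: "?P ?N \<le> 1 / 128"
    by (intro prob_greater_le finite_set_row_pmf)
      (use expectation_noise[OF B(1) i' i(2), of x] B in auto)
  have "{g. bad_row n B x L i g} = ?A \<union> ?N"
    by (auto simp: bad_row_def)
  then have "?P {g. bad_row n B x L i g} \<le> ?P ?A + ?P ?N"
    by (simp add: measure_Un_le)
  with A N show ?thesis by simp
qed

lemma map_hash_pmf: "r < d \<Longrightarrow> map_pmf (\<lambda>f. f r) (hash_pmf d n B) = row_pmf n B"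
  unfolding hash_pmf_def by (subst Pi_pmf_component) auto

text \<open>If half of the rows are bad, some set R of at least d / 2 rows is entirely bad; by
  independence this has probability at most (1 / 64) ^ |R| \<le> (1 / 8) ^ d. The union bound over
  at most 2 ^ d sets leaves (1 / 4) ^ d and takes the place of a Chernoff bound.\<close>

lemma prob_half_bad:
  assumes B: "0 < B" "128 * card L \<le> B" and i: "L \<subseteq> {..<n}" "i \<in> L"
  shows "measure_pmf.prob (hash_pmf d n B) {f. d \<le> 2 * card {r. r < d \<and> bad_row n B x L i (f r)}} \<le> 1 / 4 ^ d"
proof -
  let ?P = "measure_pmf.prob (hash_pmf d n B)" and ?bad = "bad_row n B x L i"
  let ?R = "{R. R \<subseteq> {..<d} \<and> d \<le> 2 * card R}"
  have finR: "finite ?R" by (rule finite_subset[of _ "Pow {..<d}"]) auto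
  have "?P {f. d \<le> 2 * card {r. r < d \<and> ?bad (f r)}} \<le> ?P (\<Union>R\<in>?R. {f. \<forall>r\<in>R. ?bad (f r)})"
  proof (rule measure_pmf.finite_measure_mono)
    show "{f. d \<le> 2 * card {r. r < d \<and> ?bad (f r)}} \<subseteq> (\<Union>R\<in>?R. {f. \<forall>r\<in>R. ?bad (f r)})"
    proof
      fix f assume "f \<in> {f. d \<le> 2 * card {r. r < d \<and> ?bad (f r)}}"
      then show "f \<in> (\<Union>R\<in>?R. {f. \<forall>r\<in>R. ?bad (f r)})"
        by (intro UN_I[of "{r. r < d \<and> ?bad (f r)}"]) auto
    qed
  qed simp
  also have "\<dots> \<le> (\<Sum>R\<in>?R. ?P {f. \<forall>r\<in>R. ?bad (f r)})"
    using finR by (intro measure_pmf.finite_measure_subadditive_finite) auto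
  also have "\<dots> \<le> (\<Sum>R\<in>?R. (1 / 8) ^ d)"
  proof (rule sum_mono)
    fix R assume R: "R \<in> ?R"
    have "{f. \<forall>r\<in>R. ?bad (f r)} = Pi {..<d} (\<lambda>r. if r \<in> R then {g. ?bad g} else UNIV)"
      using R by (auto simp: Pi_def split: if_splits)
    then have "?P {f. \<forall>r\<in>R. ?bad (f r)} =
      (\<Prod>r<d. measure_pmf.prob (row_pmf n B) (if r \<in> R then {g. ?bad g} else UNIV))"
      by (simp only: hash_pmf_def measure_Pi_pmf_Pi finite_lessThan)
    also have "\<dots> = (\<Prod>r\<in>R. measure_pmf.prob (row_pmf n B) (if r \<in> R then {g. ?bad g} else UNIV))"
      using R by (intro prod.mono_neutral_right) auto
    also have "\<dots> \<le> (\<Prod>r\<in>R. 1 / 64)"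
      using prob_bad_row[OF assms] by (intro prod_mono) auto
    also have "\<dots> = (1 / 8 :: real) ^ (2 * card R)"
      by (simp add: power_mult power2_eq_square)
    also have "\<dots> \<le> (1 / 8) ^ d"
      using R by (intro power_decreasing) auto
    finally show "?P {f. \<forall>r\<in>R. ?bad (f r)} \<le> (1 / 8) ^ d" .
  qed
  also have "\<dots> = card ?R * (1 / 8) ^ d" by simp
  also have "\<dots> \<le> 2 ^ d * (1 / 8) ^ d"
  proof (rule mult_right_mono)
    have "card ?R \<le> card (Pow {..<d})" by (intro card_mono) auto
    then show "real (card ?R) \<le> 2 ^ d"
      by (simp add: card_Pow flip: of_nat_le_iff)
  qed auto
  also have "\<dots> = (1 / 4) ^ d" by (simp flip: power_mult_distrib)
  finally show ?thesis by (simp add: power_one_over)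
qed

text \<open>Markov's inequality for the number of such elements. Linearity of expectation copes with
  the dependence between elements that share their hash functions.\<close>

lemma prob_many_bad:
  assumes B: "0 < B" "128 * card L \<le> B" and L: "L \<subseteq> {..<n}" and k: "100 * (card L / 4 ^ d) \<le> real k"
  shows "measure_pmf.prob (hash_pmf d n B)
    {f. k < card {i\<in>L. d \<le> 2 * card {r. r < d \<and> bad_row n B x L i (f r)}}} \<le> 1 / 100"
proof -
  let ?P = "measure_pmf.prob (hash_pmf d n B)" and ?E = "measure_pmf.expectation (hash_pmf d n B)"
  let ?A = "\<lambda>i. {f. d \<le> 2 * card {r. r < d \<and> bad_row n B x L i (f r)}}"
  let ?X = "\<lambda>f. real (card {i\<in>L. f \<in> ?A i})"
  have fin: "finite L" using L finite_subset by blast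
  have X: "?X f = (\<Sum>i\<in>L. indicator (?A i) f)" for f
    using fin by (simp add: indicator_def sum.If_cases Collect_conj_eq)
  have int: "integrable (measure_pmf (hash_pmf d n B)) (\<phi> :: _ \<Rightarrow> real)" for \<phi>
    using finite_set_hash_pmf[OF B(1)] by (rule integrable_measure_pmf_finite)
  have "?E ?X = (\<Sum>i\<in>L. ?P (?A i))"
    unfolding X by (subst Bochner_Integration.integral_sum, rule int) simp
  also have "\<dots> \<le> (\<Sum>i\<in>L. 1 / 4 ^ d)"
    by (intro sum_mono prob_half_bad B L)
  finally have "?E ?X \<le> card L / 4 ^ d" by simp
  then have "?P {f. 100 * (card L / 4 ^ d) < ?X f} \<le> 1 / 100"
    by (intro prob_greater_le finite_set_hash_pmf[OF B(1)]) auto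
  moreover have "?P {f. k < card {i\<in>L. f \<in> ?A i}} \<le> ?P {f. 100 * (card L / 4 ^ d) < ?X f}"
    using k by (intro measure_pmf.finite_measure_mono) auto
  ultimately show ?thesis by simp
qed

text \<open>\<open>T\<close> is fixed before the hash functions are drawn, so the expectation is a
  plain sum. All rows are included, because those that pull a median down may be just the noisy
  ones.\<close>

lemma prob_much_noise:
  fixes x :: "nat \<Rightarrow> real"
  assumes B: "0 < B" and T: "T \<subseteq> L" "L \<subseteq> {..<n}" "card T \<le> k"
  defines "F \<equiv> (\<Sum>j\<in>{..<n} - L. (x j)\<^sup>2)"
  shows "measure_pmf.prob (hash_pmf d n B)
    {f. 100 * (real k * real d * (F / B)) < (\<Sum>i\<in>T. \<Sum>r<d. (noise n x L (f r) i)\<^sup>2)} \<le> 1 / 100"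
proof -
  let ?E = "measure_pmf.expectation (hash_pmf d n B)"
  have int: "integrable (measure_pmf (hash_pmf d n B)) (\<phi> :: _ \<Rightarrow> real)" for \<phi>
    using finite_set_hash_pmf[OF B] by (rule integrable_measure_pmf_finite)
  have single: "?E (\<lambda>f. (noise n x L (f r) i)\<^sup>2) = F / B" if "i \<in> T" "r < d" for i r
  proof -
    have "?E (\<lambda>f. (noise n x L (f r) i)\<^sup>2) =
      measure_pmf.expectation (map_pmf (\<lambda>f. f r) (hash_pmf d n B)) (\<lambda>g. (noise n x L g i)\<^sup>2)"
      by simp
    also have "\<dots> = F / B"
      unfolding map_hash_pmf[OF that(2)] F_def by (rule expectation_noise) (use that T B in auto)
    finally show ?thesis .
  qed
  have "?E (\<lambda>f. \<Sum>i\<in>T. \<Sum>r<d. (noise n x L (f r) i)\<^sup>2) = (\<Sum>i\<in>T. \<Sum>r<d. ?E (\<lambda>f. (noise n x L (f r) i)\<^sup>2))"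
    by (subst Bochner_Integration.integral_sum, rule int)
      (intro sum.cong refl Bochner_Integration.integral_sum int)
  also have "\<dots> = (\<Sum>i\<in>T. \<Sum>r<d. F / B)"
    by (intro sum.cong refl single) auto
  also have "\<dots> = card T * d * (F / B)" by simp
  also have "\<dots> \<le> real k * real d * (F / B)"
    by (rule mult_right_mono) (use T(3) in \<open>simp_all add: F_def sum_nonneg mult_right_mono\<close>)
  finally have "?E (\<lambda>f. \<Sum>i\<in>T. \<Sum>r<d. (noise n x L (f r) i)\<^sup>2) \<le> real k * real d * (F / B)" .
  from prob_greater_le[OF finite_set_hash_pmf[OF B] _ this, of 100]
  show ?thesis by (simp add: sum_nonneg)
qed

section \<open>The sketch as a matrix\<close>

definition sketch :: "nat \<Rightarrow> nat \<Rightarrow> nat \<Rightarrow> (nat \<Rightarrow> nat \<Rightarrow> nat \<times> bool) \<Rightarrow> real mat" where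
  "sketch d n B f = Matrix.mat (d * B) n
     (\<lambda>(i, j). if fst (f (i div B) j) = i mod B then sg (snd (f (i div B) j)) else 0)"

lemma sketch_carrier: "sketch d n B f \<in> carrier_mat (d * B) n"
  and dim_sketch [simp]: "dim_row (sketch d n B f) = d * B" "dim_col (sketch d n B f) = n"
  by (simp_all add: sketch_def)

lemma block_index_less: "r < d \<Longrightarrow> c < B \<Longrightarrow> r * B + c < d * (B :: nat)"
proof -
  assume "r < d" "c < B"
  then have "r * B + c < Suc r * B" by simp
  also have "\<dots> \<le> d * B" using \<open>r < d\<close> by (intro mult_le_mono1) simp
  finally show ?thesis .
qed

lemma index_sketch:
  assumes "r < d" "c < B" "j < n"
  shows "sketch d n B f $$ (r * B + c, j) = of_bool (fst (f r j) = c) * sg (snd (f r j))"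
  using assms block_index_less[OF assms(1,2)] by (simp add: sketch_def)

text \<open>Block \<open>r\<close> occupies the \<open>B\<close> rows from \<open>r * B\<close> on,
  so the entries of a column are ordered by block, one per block. Hence the t-th entry of an
  adjacency list belongs to block t.\<close>

lemma col_rows_sketch:
  assumes j: "j < n" and f: "\<And>r. r < d \<Longrightarrow> fst (f r j) < B"
  shows "col_rows (sketch d n B f) j = map (\<lambda>r. r * B + fst (f r j)) [0..<d]"
proof (rule sorted_distinct_set_unique)
  let ?h = "\<lambda>r. r * B + fst (f r j)"
  have less: "?h r < ?h r'" if "r < r'" "r' < d" for r r'
  proof -
    have "?h r < Suc r * B" using that f[of r] by simp
    also have "\<dots> \<le> r' * B" using that by (intro mult_le_mono1) simp
    finally show ?thesis by simp
  qed
  show "sorted (map ?h [0..<d])"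
    unfolding sorted_iff_nth_mono using less by (auto simp: le_less)
  show "distinct (map ?h [0..<d])"
    unfolding distinct_conv_nth
  proof (intro allI impI)
    fix a b assume "a < length (map ?h [0..<d])" "b < length (map ?h [0..<d])" "a \<noteq> b"
    then show "map ?h [0..<d] ! a \<noteq> map ?h [0..<d] ! b"
      using less[of a b] less[of b a] by (cases "a < b") auto
  qed
  show "set (col_rows (sketch d n B f) j) = set (map ?h [0..<d])"
  proof (intro equalityI subsetI)
    fix i assume "i \<in> set (col_rows (sketch d n B f) j)"
    then have i: "i < d * B" "sketch d n B f $$ (i, j) \<noteq> 0" by (auto simp: col_rows_def)
    have "B \<noteq> 0" using i(1) by (cases B) auto
    then have r: "i div B < d" using i by (simp add: less_mult_imp_div_less)
    from i j have "fst (f (i div B) j) = i mod B" by (auto simp: sketch_def split: if_splits)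
    then have "i = ?h (i div B)" by simp
    with r show "i \<in> set (map ?h [0..<d])" by force
  next
    fix i assume "i \<in> set (map ?h [0..<d])"
    then obtain r where r: "r < d" "i = ?h r" by auto
    with index_sketch[OF r(1) f[OF r(1)] j, of f] block_index_less[OF r(1) f[OF r(1)]]
    show "i \<in> set (col_rows (sketch d n B f) j)" by (auto simp: col_rows_def)
  qed
qed (auto simp: col_rows_def sorted_wrt_filter)

lemma column_sparsity_sketch:
  assumes "0 < n" "\<And>r j. r < d \<Longrightarrow> j < n \<Longrightarrow> fst (f r j) < B"
  shows "column_sparsity (sketch d n B f) \<le> d"
proof -
  have "card {i. i < d * B \<and> sketch d n B f $$ (i, j) \<noteq> 0} = d" if "j < n" for j
  proof -
    have "{i. i < d * B \<and> sketch d n B f $$ (i, j) \<noteq> 0} = set (col_rows (sketch d n B f) j)"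
      by (auto simp: col_rows_def)
    moreover have "distinct (col_rows (sketch d n B f) j)" by (simp add: col_rows_def)
    moreover have "length (col_rows (sketch d n B f) j) = d"
      using assms that by (simp add: col_rows_sketch)
    ultimately show ?thesis by (simp add: distinct_card)
  qed
  with assms(1) show ?thesis
    unfolding column_sparsity_def by (subst Max_le_iff) auto
qed

lemma sketch_mult:
  assumes "r < d" "c < B" "x \<in> carrier_vec n"
  shows "(sketch d n B f *\<^sub>v x) $ (r * B + c) = (\<Sum>j<n. of_bool (fst (f r j) = c) * sg (snd (f r j)) * x $ j)"
  using assms block_index_less[OF assms(1,2)]
  by (auto simp: mult_mat_vec_def scalar_prod_def row_def index_sketch atLeast0LessThan intro!: sum.cong)

text \<open>The benefit of discarding collisions inside \<open>L\<close>: up to a sign, the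
  measurement differs from the entry only by mass outside \<open>L\<close>, however large the other
  elements of \<open>L\<close> are.\<close>

lemma sketch_mult_isolated:
  assumes "r < d" "fst (f r i) < B" "x \<in> carrier_vec n" "L \<subseteq> {..<n}" "i \<in> L"
    and iso: "\<forall>j\<in>L - {i}. fst (f r j) \<noteq> fst (f r i)"
  shows "(sketch d n B f *\<^sub>v x) $ (r * B + fst (f r i)) = sg (snd (f r i)) * x $ i + noise n (\<lambda>j. x $ j) L (f r) i"
proof -
  let ?c = "\<lambda>j. of_bool (fst (f r j) = fst (f r i)) * sg (snd (f r j)) * x $ j"
  have fin: "finite L" using assms(4) finite_subset by blast
  have "(\<Sum>j<n. ?c j) = (\<Sum>j\<in>{..<n} - L. ?c j) + (\<Sum>j\<in>L. ?c j)"
    using assms(4) by (intro sum.subset_diff) auto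
  also have "(\<Sum>j\<in>L. ?c j) = ?c i + (\<Sum>j\<in>L - {i}. ?c j)"
    using fin assms(5) by (rule sum.remove)
  also have "(\<Sum>j\<in>L - {i}. ?c j) = 0"
    using iso by (intro sum.neutral) auto
  finally show ?thesis
    by (subst sketch_mult) (use assms in \<open>auto simp: noise_def\<close>)
qed

section \<open>Quality of the estimates\<close>

lemma below_map_card: "below v (map g [0..<n]) = card {i. i < n \<and> g i < v}"
  and above_map_card: "above v (map g [0..<n]) = card {i. i < n \<and> v < g i}"
  by (auto simp: below_def above_def length_filter_conv_card intro!: arg_cong[where f = card])

text \<open>Otherwise all rows that are not bad, more than half of them, would have values below
  \<open>z\<close>, whereas its rank admits only \<open>d div 2\<close> of these.\<close>

lemma median_upper_bound:
  assumes med: "is_qth (map val [0..<d]) (d div 2) z"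
    and bad: "2 * card {r. r < d \<and> bad r} < d"
  obtains r where "r < d" "\<not> bad r" "z \<le> val r"
proof (rule ccontr)
  assume "\<not> thesis"
  with that have "{..<d} - {r. r < d \<and> bad r} \<subseteq> {r. r < d \<and> val r < z}" by force
  then have "card ({..<d} - {r. r < d \<and> bad r}) \<le> card {r. r < d \<and> val r < z}"
    by (intro card_mono) auto
  moreover have "card ({..<d} - {r. r < d \<and> bad r}) = d - card {r. r < d \<and> bad r}"
    by (subst card_Diff_subset) auto
  moreover have "card {r. r < d \<and> val r < z} \<le> d div 2"
    using med by (simp add: is_qth_def below_map_card)
  ultimately show False using bad by linarith
qed

text \<open>At least half of the values are at most the median, so each of these rows must have noise at
  least as large as the amount by which the median falls short of a.\<close>

lemma median_lower_bound:
  fixes a :: real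
  assumes med: "is_qth (map val [0..<d]) (d div 2) z" and "0 < d"
    and val: "\<And>r. r < d \<Longrightarrow> val r \<le> z \<Longrightarrow> a \<le> val r + \<bar>e r\<bar>"
  shows "a \<le> z + sqrt (2 / d * (\<Sum>r<d. (e r)\<^sup>2))"
proof (cases "a \<le> z")
  case True
  then show ?thesis using \<open>0 < d\<close> by (simp add: sum_nonneg add_increasing2)
next
  case False
  let ?R = "{r. r < d \<and> val r \<le> z}"
  have "card ?R = d - card {r. r < d \<and> z < val r}"
  proof -
    have "?R = {..<d} - {r. r < d \<and> z < val r}" by auto
    then have "card ?R = card ({..<d} - {r. r < d \<and> z < val r})" by (rule arg_cong)
    also have "\<dots> = d - card {r. r < d \<and> z < val r}"
      by (subst card_Diff_subset) auto
    finally show ?thesis .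
  qed
  moreover have "d div 2 + card {r. r < d \<and> z < val r} < d"
    using med by (simp add: is_qth_def above_map_card)
  ultimately have R: "d \<le> 2 * card ?R" by linarith
  have "(a - z)\<^sup>2 \<le> (e r)\<^sup>2" if "r \<in> ?R" for r
    using val[of r] that False by (intro abs_le_square_iff[THEN iffD1]) auto
  then have "(\<Sum>r\<in>?R. (a - z)\<^sup>2) \<le> (\<Sum>r\<in>?R. (e r)\<^sup>2)" by (intro sum_mono)
  also have "\<dots> \<le> (\<Sum>r<d. (e r)\<^sup>2)" by (intro sum_mono2) auto
  finally have *: "card ?R * (a - z)\<^sup>2 \<le> (\<Sum>r<d. (e r)\<^sup>2)" by simp
  have "d * (a - z)\<^sup>2 \<le> (2 * card ?R) * (a - z)\<^sup>2"
    using R by (intro mult_right_mono) auto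
  with * have "(a - z)\<^sup>2 \<le> 2 / d * (\<Sum>r<d. (e r)\<^sup>2)"
    using \<open>0 < d\<close> by (simp add: field_simps)
  then have "a - z \<le> sqrt (2 / d * (\<Sum>r<d. (e r)\<^sup>2))" by (rule real_le_rsqrt)
  then show ?thesis by simp
qed

text \<open>Every missed element of T has an estimate below every chosen one. As S is three times as large
  as T and few estimates are too large, the chosen elements outside T make up for the missed
  ones.\<close>

lemma top_estimates_suffice:
  fixes a u z :: "nat \<Rightarrow> real" and \<tau> M v :: real
  assumes P: "P \<subseteq> {..<N}" "card P = min N (3 * k)" "\<And>p. p \<in> P \<Longrightarrow> v \<le> z p"
      "\<And>p. p < N \<Longrightarrow> p \<notin> P \<Longrightarrow> z p \<le> v"
    and T: "T \<subseteq> {..<N}" "card T \<le> k" and k: "0 < k"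
    and over: "card Q \<le> k" "\<And>p. p < N \<Longrightarrow> p \<notin> Q \<Longrightarrow> z p \<le> a p + \<tau> \<and> z p < M"
    and under: "\<And>p. p < N \<Longrightarrow> z p < M \<Longrightarrow> a p \<le> z p + u p"
    and nn: "\<And>p. 0 \<le> a p" "\<And>p. 0 \<le> u p" "0 \<le> \<tau>" and Q: "Q \<subseteq> {..<N}"
  shows "(\<Sum>p\<in>T - P. (a p)\<^sup>2) \<le> (\<Sum>p\<in>P - T. (a p)\<^sup>2) + 4 * real k * \<tau>\<^sup>2 + 4 * (\<Sum>p\<in>T. (u p)\<^sup>2)"
proof (cases "T \<subseteq> P")
  case True
  then have "T - P = {}" by auto
  then have "(\<Sum>p\<in>T - P. (a p)\<^sup>2) = 0" by (simp only: sum.empty)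
  moreover have "0 \<le> (\<Sum>p\<in>P - T. (a p)\<^sup>2) + 4 * real k * \<tau>\<^sup>2 + 4 * (\<Sum>p\<in>T. (u p)\<^sup>2)"
    by (intro add_nonneg_nonneg mult_nonneg_nonneg sum_nonneg) auto
  ultimately show ?thesis by simp
next
  case False
  have fin: "finite P" "finite T" "finite Q" using P(1) T(1) Q finite_subset by blast+
  \<comment> \<open>A missed element of \<open>T\<close> shows that not everything was chosen, so
    all \<open>3 * k\<close> slots are filled.\<close>
  have "card P \<noteq> N"
    using False T(1) P(1) card_subset_eq[of "{..<N}" P] by auto
  with P(2) have card_P: "card P = 3 * k" by linarith
  define t where "t = card (T - P)"
  \<comment> \<open>A lower bound for the magnitudes of chosen elements outside \<open>Q\<close>,
    cut off at 0 so that it survives squaring.\<close>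
  define w where "w = max 0 (v - \<tau>)"
  define G where "G = P - T - Q"
  have "card (T - P) + card (T \<inter> P) = card T"
    using fin by (metis card_Diff_subset_Int card_Int_Diff add.commute)
  moreover have "card (P - T) + card (T \<inter> P) = card P"
    using fin by (metis Int_commute card_Int_Diff add.commute)
  moreover have "card (P - T) - card Q \<le> card G"
    unfolding G_def using fin by (intro diff_card_le_card_Diff)
  \<comment> \<open>\<open>P - T\<close> has at least \<open>2 * k + t\<close> elements, of which at
    most \<open>k\<close> lie in \<open>Q\<close>; the remaining \<open>k + t\<close> are at least
    \<open>2 * t\<close>.\<close>
  ultimately have G: "2 * t \<le> card G" "0 < card G" "t \<le> k"
    using card_P T(2) over(1) k unfolding t_def by linarith+
  have aG: "v < M \<and> w\<^sup>2 \<le> (a p)\<^sup>2" if "p \<in> G" for p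
  proof -
    from that have p: "p < N" "p \<notin> Q" "p \<in> P" using P(1) by (auto simp: G_def)
    from over(2)[OF p(1,2)] P(3)[OF p(3)] nn(1)[of p] have "v < M" "w \<le> a p" "0 \<le> w"
      by (auto simp: w_def)
    then show ?thesis by (auto intro: power_mono)
  qed
  \<comment> \<open>Some chosen element has a finite estimate, so the threshold is finite. The
    estimates of the missed elements are then finite too, as \<open>under\<close> requires.\<close>
  have vM: "v < M" using aG G(2) by (metis card_gt_0_iff ex_in_conv)
  have aT: "(a p)\<^sup>2 \<le> 2 * w\<^sup>2 + (4 * \<tau>\<^sup>2 + 4 * (u p)\<^sup>2)" if "p \<in> T - P" for p
  proof -
    from that T(1) have p: "p < N" "p \<notin> P" by auto
    from P(4)[OF p] under[OF p(1)] vM have "a p \<le> w + \<tau> + u p" by (auto simp: w_def)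
    then have "(a p)\<^sup>2 \<le> (w + \<tau> + u p)\<^sup>2" using nn(1)[of p] by (rule power_mono)
    \<comment> \<open>In effect, \<open>(b + c)\<^sup>2 \<le> 2 * b\<^sup>2 + 2 * c\<^sup>2\<close>
      is applied twice. Because of the factor 2 before \<open>w\<^sup>2\<close>, two chosen elements
      have to make up for a missed one; this is what the \<open>3 * k\<close> slots provide.\<close>
    also have "\<dots> \<le> 2 * w\<^sup>2 + (4 * \<tau>\<^sup>2 + 4 * (u p)\<^sup>2)"
      using sum_squares_ge_zero[of "w - (\<tau> + u p)" "\<tau> - u p"]
        zero_le_power2[of "w - (\<tau> + u p)"] zero_le_power2[of "\<tau> - u p"]
      by (simp add: power2_eq_square algebra_simps)
    finally show ?thesis .
  qed
  have "(\<Sum>p\<in>T - P. (a p)\<^sup>2) \<le> (\<Sum>p\<in>T - P. 2 * w\<^sup>2 + (4 * \<tau>\<^sup>2 + 4 * (u p)\<^sup>2))"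
    by (intro sum_mono aT)
  also have "\<dots> = (2 * t) * w\<^sup>2 + 4 * real t * \<tau>\<^sup>2 + 4 * (\<Sum>p\<in>T - P. (u p)\<^sup>2)"
    by (simp add: sum.distrib t_def sum_distrib_left)
  also have "(2 * t) * w\<^sup>2 \<le> (\<Sum>p\<in>P - T. (a p)\<^sup>2)"
  proof -
    have "(2 * t) * w\<^sup>2 \<le> card G * w\<^sup>2"
      using G(1) by (intro mult_right_mono) auto
    also have "\<dots> = (\<Sum>p\<in>G. w\<^sup>2)" by simp
    also have "\<dots> \<le> (\<Sum>p\<in>G. (a p)\<^sup>2)" using aG by (intro sum_mono) auto
    also have "\<dots> \<le> (\<Sum>p\<in>P - T. (a p)\<^sup>2)"
      using fin by (intro sum_mono2) (auto simp: G_def)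
    finally show ?thesis .
  qed
  also have "4 * real t * \<tau>\<^sup>2 \<le> 4 * real k * \<tau>\<^sup>2"
    using G(3) by (intro mult_right_mono) auto
  also have "(\<Sum>p\<in>T - P. (u p)\<^sup>2) \<le> (\<Sum>p\<in>T. (u p)\<^sup>2)"
    using fin by (intro sum_mono2) auto
  finally show ?thesis by simp
qed

section \<open>Recovery\<close>

text \<open>The element \<open>p\<close> itself always contributes 1. As \<open>h t q < B\<close>, a
  row index determines its block, so another element contributes only if it shares the bucket in the
  same block.\<close>

lemma collision_count:
  fixes h :: "nat \<Rightarrow> nat \<Rightarrow> nat"
  assumes h: "\<And>r p. r < d \<Longrightarrow> p < N \<Longrightarrow> h r p < B" and p: "p < N" and r: "r < d"
  shows "(\<Sum>q<N. \<Sum>t<d. of_bool (t * B + h t q = r * B + h r p)) < (2 :: nat) \<longleftrightarrow>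
    (\<forall>q<N. q \<noteq> p \<longrightarrow> h r q \<noteq> h r p)"
proof -
  have "(\<Sum>t<d. of_bool (t * B + h t q = r * B + h r p)) = (of_bool (h r q = h r p) :: nat)" if "q < N" for q
  proof -
    have "t * B + h t q = r * B + h r p \<longleftrightarrow> t = r \<and> h r q = h r p" if "t < d" for t
    proof
      assume e: "t * B + h t q = r * B + h r p"
      have "t = (t * B + h t q) div B" "r = (r * B + h r p) div B"
        using h[of t q] h[OF r p] \<open>q < N\<close> that by (auto simp: div_mult_self3 div_less)
      with e have "t = r" by simp
      with e show "t = r \<and> h r q = h r p" by simp
    qed auto
    then have "(\<Sum>t<d. of_bool (t * B + h t q = r * B + h r p)) =
      (\<Sum>t<d. if t = r then of_bool (h r q = h r p) else (0 :: nat))"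
      by (intro sum.cong) auto
    then show ?thesis using r by simp
  qed
  then have "(\<Sum>q<N. \<Sum>t<d. of_bool (t * B + h t q = r * B + h r p)) = (\<Sum>q<N. of_bool (h r q = h r p) :: nat)"
    by (intro sum.cong) auto
  also have "\<dots> = of_bool (h r p = h r p) + (\<Sum>q\<in>{..<N} - {p}. of_bool (h r q = h r p))"
    using p by (intro sum.remove) auto
  also have "\<dots> < 2 \<longleftrightarrow> (\<Sum>q\<in>{..<N} - {p}. of_bool (h r q = h r p)) = (0 :: nat)"
    by auto
  also have "\<dots> \<longleftrightarrow> (\<forall>q<N. q \<noteq> p \<longrightarrow> h r q \<noteq> h r p)"
    by (subst sum_eq_0_iff) auto
  finally show ?thesis .
qed

lemma decoder_run:
  assumes f: "\<And>r j. r < d \<Longrightarrow> j < n \<Longrightarrow> fst (f r j) < B" and pos: "0 < B" "0 < d" "0 < k"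
    and ls: "distinct ls" "set ls \<subseteq> {..<n}" "k \<le> length ls" "length ls \<le> B"
    and y: "y \<in> carrier_vec (d * B)"
  obtains t s z P M v where
    "exec ((n + d * B + 2) ^ 3) decoder (decoder_input n k \<epsilon> (sketch d n B f) y ls) t s"
    "t \<le> 506 * (d * B)" "decoder_output s = (!) ls ` P"
    "P \<subseteq> {..<length ls}" "card P = min (length ls) (3 * k)" "\<And>p. p \<in> P \<Longrightarrow> v \<le> z p"
    "\<And>p. p < length ls \<Longrightarrow> p \<notin> P \<Longrightarrow> z p \<le> v" "\<And>b. b < d * B \<Longrightarrow> \<bar>y $ b\<bar> < M"
    "\<And>p. p < length ls \<Longrightarrow> is_qth (map (\<lambda>r.
       if \<forall>j\<in>set ls - {ls ! p}. fst (f r j) \<noteq> fst (f r (ls ! p))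
       then \<bar>y $ (r * B + fst (f r (ls ! p)))\<bar> else M) [0..<d]) (d div 2) (z p)"
proof -
  let ?m = "d * B" and ?N = "length ls" and ?row = "\<lambda>p r. r * B + fst (f r (ls ! p))"
  let ?W = "(n + ?m + 2) ^ 3" and ?s = "decoder_input n k \<epsilon> (sketch d n B f) y ls"
  have lsn: "ls ! p < n" if "p < ?N" for p using ls(2) that by (auto simp: subset_iff)
  have N: "0 < ?N" using ls(3) pos by linarith
  have Nn: "?N \<le> n"
    using distinct_card[OF ls(1)] card_mono[OF _ ls(2)] by simp
  have dm: "d \<le> ?m" "B \<le> ?m" using pos by simp_all
  have Nd: "?N * d \<le> ?m" using ls(4) by (simp add: mult.commute)
  have Nm: "?N \<le> ?m" using ls(4) dm(2) by (rule le_trans)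
  \<comment> \<open>The square of \<open>X\<close> would not cover the additive 20 in the word
    bounds: at \<open>X = 4\<close> it is 16, below \<open>2 * N + 20\<close>. The cube is at least
    \<open>16 * X\<close>, which covers them, and it exceeds all addresses, as these are below
    \<open>n * ?m \<le> X * X\<close>.\<close>
  define X where "X = n + ?m + 2"
  have X: "4 \<le> X" using N Nn Nm unfolding X_def by linarith
  have XnX: "n \<le> X" "?m \<le> X" by (simp_all add: X_def)
  have X2: "4 * X \<le> X * X" using X by (intro mult_le_mono1)
  with X have "16 \<le> X * X" by linarith
  then have "X * 16 \<le> X * (X * X)" by (rule mult_le_mono2)
  moreover have WX: "?W = X * (X * X)" by (simp only: X_def power3_eq_cube mult.assoc)
  ultimately have W16: "16 * X \<le> ?W" by (simp only: mult.commute)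
  have cell: "ls ! p * ?m + r < n * ?m" if "p < ?N" "r < d" for p r
    using block_index_less[of "ls ! p" n r ?m] lsn[OF that(1)] that(2) dm(1) by simp
  have nm: "n * ?m \<le> ?W"
  proof -
    have "n * ?m \<le> X * X" by (intro mult_le_mono) (auto simp: X_def)
    also have "\<dots> \<le> X * X * X" using X by simp
    finally show ?thesis by (simp only: WX mult.assoc)
  qed
  interpret decoding ?W ?m ?N d k "(!) ls" ?row "($) y"
  proof
    have "2 * ?N + 20 \<le> 16 * X" "2 * d + 20 \<le> 16 * X" "?N * d < 16 * X" "3 * k < 16 * X" "?m < 16 * X"
      using X XnX Nn Nd dm(1) ls(3) by linarith+
    note b = this(1,2)[THEN le_trans, OF W16] this(3-5)[THEN less_le_trans, OF W16]
    show "2 * ?N + 20 \<le> ?W" by (rule b)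
    show "2 * d + 20 \<le> ?W" by (rule b)
    show "?N * d < ?W" by (rule b)
    show "3 * k < ?W" by (rule b)
    show "?m < ?W" by (rule b)
    show "ls ! p < ?W" if "p < ?N" for p
      by (rule less_le_trans[OF _ W16]) (use lsn[OF that] in \<open>simp add: X_def\<close>)
    show "ls ! p * ?m + r < ?W" if "p < ?N" "r < d" for p r
      using cell[OF that] nm by linarith
    show "?row p r < ?m" if "p < ?N" "r < d" for p r
      using that f lsn by (intro block_index_less) auto
  qed (use pos N in auto)
  have rows: "col_rows (sketch d n B f) j = map (\<lambda>r. r * B + fst (f r j)) [0..<d]" if "j < n" for j
    using that f by (intro col_rows_sketch)
  have n: "0 < n" using N Nn by linarith
  have "wp ?W decoder
    (\<lambda>s' _. \<exists>z P. (\<forall>p<?N. is_qth (map (bucket_value p) [0..<d]) (d div 2) (z p)) \<and> top_set z P \<and>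
      decoder_output s' = (!) ls ` P) ?s (4 * ?m + 232 * (?N * d) + 250 * ?N + 20)"
  proof (rule wp_decoder)
    show "wmem ?s ''deg'' 0 = d"
      using n by (simp add: decoder_input_def Let_def rows)
    show "wmem ?s ''row'' (ls ! p * ?m + r) = ?row p r" if "p < ?N" "r < d" for p r
    proof -
      have r: "r < ?m" using that(2) dm(1) by linarith
      then have "?m \<noteq> 0" by linarith
      with r have "(ls ! p * ?m + r) div ?m = ls ! p" "(ls ! p * ?m + r) mod ?m = r"
        by (simp_all only: div_mult_self3 mod_mult_self3 div_less mod_less add_0_right not_False_eq_True)
      with cell[OF that] lsn[OF that(1)] that show ?thesis
        by (simp only: decoder_input_def Let_def dim_sketch)
          (simp add: rows nth_or_0_def)
    qed
  qed (use y in \<open>auto simp: decoder_input_def Let_def nth_or_0_def\<close>)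
  then obtain t s z P where *: "exec ?W decoder ?s t s" "t \<le> 4 * ?m + 232 * (?N * d) + 250 * ?N + 20"
    "\<And>p. p < ?N \<Longrightarrow> is_qth (map (bucket_value p) [0..<d]) (d div 2) (z p)" "top_set z P"
    "decoder_output s = (!) ls ` P"
    by (auto simp: wp_def)
  from *(4) obtain v where v: "P \<subseteq> {..<?N}" "card P = min ?N (3 * k)" "\<And>p. p \<in> P \<Longrightarrow> v \<le> z p"
    "\<And>p. p < ?N \<Longrightarrow> p \<notin> P \<Longrightarrow> z p \<le> v"
    by (auto simp: top_set_def)
  \<comment> \<open>506 = 4 + 232 + 250 + 20, where \<open>?N * d\<close> and \<open>?N\<close> are
    at most \<open>?m\<close> and \<open>0 < ?N\<close> absorbs the additive constant.\<close>
  have time: "t \<le> 506 * ?m"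
    using *(2) Nd Nm N by linarith
  have M: "\<bar>y $ b\<bar> < big" if "b < ?m" for b
    unfolding big_def using member_le_sum[of b "{..<?m}" "\<lambda>b. \<bar>y $ b\<bar>"] that by simp
  have "bucket_value p r = (if \<forall>j\<in>set ls - {ls ! p}. fst (f r j) \<noteq> fst (f r (ls ! p))
       then \<bar>y $ (r * B + fst (f r (ls ! p)))\<bar> else big)" if "p < ?N" "r < d" for p r
  proof -
    have "load ?N (?row p r) < 2 \<longleftrightarrow> (\<forall>q<?N. q \<noteq> p \<longrightarrow> fst (f r (ls ! q)) \<noteq> fst (f r (ls ! p)))"
      unfolding load_def using collision_count[of d ?N "\<lambda>r p. fst (f r (ls ! p))" B p r] f lsn that by simp
    also have "\<dots> \<longleftrightarrow> (\<forall>j\<in>set ls - {ls ! p}. fst (f r j) \<noteq> fst (f r (ls ! p)))"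
    proof -
      have "set ls - {ls ! p} = (!) ls ` {q. q < ?N \<and> q \<noteq> p}"
        using ls(1) that(1) by (auto simp: in_set_conv_nth nth_eq_iff_index_eq)
      then show ?thesis by auto
    qed
    finally show ?thesis by (simp only: bucket_value_def)
  qed
  then have val_map: "map (bucket_value p) [0..<d] = map (\<lambda>r.
       if \<forall>j\<in>set ls - {ls ! p}. fst (f r j) \<noteq> fst (f r (ls ! p))
       then \<bar>y $ (r * B + fst (f r (ls ! p)))\<bar> else big) [0..<d]" if "p < ?N" for p
    using that by (intro map_cong refl) simp
  have qth: "is_qth (map (\<lambda>r.
       if \<forall>j\<in>set ls - {ls ! p}. fst (f r j) \<noteq> fst (f r (ls ! p))
       then \<bar>y $ (r * B + fst (f r (ls ! p)))\<bar> else big) [0..<d]) (d div 2) (z p)" if "p < ?N" for p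
    unfolding val_map[OF that, symmetric] by (rule *(3)[OF that])
  show ?thesis
    by (rule that[OF *(1) time *(5) v(1,2)]; (rule v(3) v(4) M qth; assumption)?)
qed

section \<open>From estimates to the approximation error\<close>

lemma l2_norm_minus_restr:
  assumes "x \<in> carrier_vec n"
  shows "(l2_norm (x - restr x S))\<^sup>2 = (\<Sum>i\<in>{..<n} - S. (x $ i)\<^sup>2)"
proof -
  have "(l2_norm (x - restr x S))\<^sup>2 = (\<Sum>i<n. ((x - restr x S) $ i)\<^sup>2)"
    using assms by (simp add: l2_norm_def L2_set_def sum_nonneg restr_def)
  also have "\<dots> = (\<Sum>i<n. if i \<in> S then 0 else (x $ i)\<^sup>2)"
    using assms by (intro sum.cong) (auto simp: restr_def)
  also have "\<dots> = (\<Sum>i\<in>{..<n} - S. (x $ i)\<^sup>2)"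
    by (simp add: sum.If_cases Diff_eq Compl_eq)
  finally show ?thesis .
qed

lemma sum_nth_image:
  assumes "distinct ls" "A \<subseteq> {..<length ls}"
  shows "(\<Sum>p\<in>A. g (ls ! p)) = (\<Sum>i\<in>(!) ls ` A. g i)"
  using assms by (subst sum.reindex) (auto simp: inj_on_def nth_eq_iff_index_eq subset_iff)

text \<open>The deterministic half of the argument: randomness enters only through
  \<open>few_bad\<close> and \<open>little_noise\<close>. The constant is 1312 = 512 + 800. The
  first part is \<open>4 * k * \<tau>\<^sup>2\<close> with
  \<open>\<tau>\<^sup>2 = 128 * (F / B)\<close>; the second is 4 times \<open>2 / d\<close> times
  the noise bound \<open>100 * (k * d * (F / B))\<close>.\<close>

lemma decoder_quality:
  fixes x :: "real Matrix.vec"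
  assumes f: "\<And>r j. r < d \<Longrightarrow> j < n \<Longrightarrow> fst (f r j) < B" and pos: "0 < B" "0 < d" "0 < k"
    and ls: "distinct ls" "set ls \<subseteq> {..<n}" and x: "x \<in> carrier_vec n"
    and T: "T \<subseteq> set ls" "card T \<le> k"
  defines "y \<equiv> sketch d n B f *\<^sub>v x" and "e \<equiv> \<lambda>r i. noise n (\<lambda>j. x $ j) (set ls) (f r) i"
    and "F \<equiv> \<Sum>j\<in>{..<n} - set ls. (x $ j)\<^sup>2"
  assumes P: "P \<subseteq> {..<length ls}" "card P = min (length ls) (3 * k)" "\<And>p. p \<in> P \<Longrightarrow> v \<le> z p"
    "\<And>p. p < length ls \<Longrightarrow> p \<notin> P \<Longrightarrow> z p \<le> v"
    and M: "\<And>b. b < d * B \<Longrightarrow> \<bar>y $ b\<bar> < M"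
    and z: "\<And>p. p < length ls \<Longrightarrow> is_qth (map (\<lambda>r.
       if \<forall>j\<in>set ls - {ls ! p}. fst (f r j) \<noteq> fst (f r (ls ! p))
       then \<bar>y $ (r * B + fst (f r (ls ! p)))\<bar> else M) [0..<d]) (d div 2) (z p)"
    and few_bad: "card {i\<in>set ls. d \<le> 2 * card {r. r < d \<and> bad_row n B (\<lambda>j. x $ j) (set ls) i (f r)}} \<le> k"
    and little_noise: "(\<Sum>i\<in>T. \<Sum>r<d. (e r i)\<^sup>2) \<le> 100 * (real k * real d * (F / B))"
  shows "(\<Sum>j\<in>{..<n} - (!) ls ` P. (x $ j)\<^sup>2) \<le> (\<Sum>j\<in>{..<n} - T. (x $ j)\<^sup>2) + 1312 * (k * (F / B))"
proof -
  let ?N = "length ls" and ?L = "set ls" and ?S = "(!) ls ` P"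
  let ?bad = "\<lambda>i r. bad_row n B (\<lambda>j. x $ j) ?L i (f r)"
  let ?iso = "\<lambda>p r. \<forall>j\<in>?L - {ls ! p}. fst (f r j) \<noteq> fst (f r (ls ! p))"
  let ?val = "\<lambda>p r. if ?iso p r then \<bar>y $ (r * B + fst (f r (ls ! p)))\<bar> else M"
  let ?a = "\<lambda>p. \<bar>x $ (ls ! p)\<bar>"
  \<comment> \<open>\<open>u\<close> is the shortfall granted by \<open>median_lower_bound\<close>,
    and \<open>\<tau>\<close> bounds the noise in a row that is not bad.\<close>
  define u where "u = (\<lambda>p. sqrt (2 / d * (\<Sum>r<d. (e r (ls ! p))\<^sup>2)))"
  define \<tau> where "\<tau> = sqrt (128 * (F / B))"
  define T' where "T' = {p. p < ?N \<and> ls ! p \<in> T}"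
  define Q where "Q = {p. p < ?N \<and> d \<le> 2 * card {r. r < d \<and> ?bad (ls ! p) r}}"
  have F: "0 \<le> F" by (simp add: F_def sum_nonneg)
  have lsn: "ls ! p < n" if "p < ?N" for p using ls(2) that by (auto simp: subset_iff)
  have card_image_ls: "card ((!) ls ` A) = card A" if "A \<subseteq> {..<?N}" for A
    using that ls(1) by (intro card_image) (auto simp: inj_on_def nth_eq_iff_index_eq subset_iff)
  have T'T: "(!) ls ` T' = T"
    using T(1) unfolding T'_def by (force simp: in_set_conv_nth)
  have Q_image: "(!) ls ` Q = {i\<in>?L. d \<le> 2 * card {r. r < d \<and> ?bad i r}}"
    unfolding Q_def by (force simp: in_set_conv_nth)
  have near: "\<bar>\<bar>y $ (r * B + fst (f r (ls ! p)))\<bar> - ?a p\<bar> \<le> \<bar>e r (ls ! p)\<bar>"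
    if "p < ?N" "r < d" "?iso p r" for p r
  proof -
    have "y $ (r * B + fst (f r (ls ! p))) = sg (snd (f r (ls ! p))) * x $ (ls ! p) + e r (ls ! p)"
      unfolding y_def e_def by (rule sketch_mult_isolated) (use that f lsn x ls in auto)
    moreover have "\<bar>sg (snd (f r (ls ! p))) * x $ (ls ! p)\<bar> = ?a p" by (simp add: abs_mult)
    ultimately show ?thesis by linarith
  qed
  have "(\<Sum>p\<in>T' - P. (?a p)\<^sup>2) \<le> (\<Sum>p\<in>P - T'. (?a p)\<^sup>2) + 4 * real k * \<tau>\<^sup>2 + 4 * (\<Sum>p\<in>T'. (u p)\<^sup>2)"
  proof (rule top_estimates_suffice[of P ?N k v z T' Q ?a \<tau> M u])
    show "T' \<subseteq> {..<?N}" "Q \<subseteq> {..<?N}" by (auto simp: T'_def Q_def)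
    then show "card T' \<le> k" "card Q \<le> k"
      using T(2) T'T few_bad Q_image card_image_ls[of T'] card_image_ls[of Q] by auto
    show "z p \<le> ?a p + \<tau> \<and> z p < M" if p: "p < ?N" "p \<notin> Q" for p
    proof -
      from p have "2 * card {r. r < d \<and> ?bad (ls ! p) r} < d" by (auto simp: Q_def)
      from median_upper_bound[OF z[OF p(1)] this] obtain r where r: "r < d" "\<not> ?bad (ls ! p) r" "z p \<le> ?val p r" .
      then have iso: "?iso p r" and "(e r (ls ! p))\<^sup>2 \<le> 128 * (F / B)"
        by (auto simp: bad_row_def e_def F_def)
      then have "\<bar>e r (ls ! p)\<bar> \<le> \<tau>"
        unfolding \<tau>_def by (intro real_le_rsqrt) simp
      moreover have "\<bar>y $ (r * B + fst (f r (ls ! p)))\<bar> < M"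
        using r(1) f lsn p by (intro M block_index_less) auto
      moreover have "z p \<le> \<bar>y $ (r * B + fst (f r (ls ! p)))\<bar>"
        using r(3) by (simp only: if_P[OF iso])
      ultimately show ?thesis using near[OF p(1) r(1) iso] by linarith
    qed
    show "?a p \<le> z p + u p" if p: "p < ?N" "z p < M" for p
      unfolding u_def
    proof (rule median_lower_bound[OF z[OF p(1)] pos(2)])
      fix r assume r: "r < d" "?val p r \<le> z p"
      \<comment> \<open>A discarded row has the value \<open>M\<close>, above the median
        \<open>z p\<close>, so it is not among the rows that pull the median down.\<close>
      with p have iso: "?iso p r" by (smt (verit))
      from near[OF p(1) r(1) iso] show "?a p \<le> ?val p r + \<bar>e r (ls ! p)\<bar>"
        unfolding if_P[OF iso] by linarith
    qed
  qed (use P pos F in \<open>auto simp: u_def \<tau>_def sum_nonneg\<close>)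
  moreover have "(\<Sum>p\<in>T' - P. (?a p)\<^sup>2) = (\<Sum>i\<in>T - ?S. (x $ i)\<^sup>2)"
  proof -
    have "(!) ls ` (T' - P) = T - ?S"
      using P(1) ls(1) unfolding T'T[symmetric]
      by (auto simp: T'_def nth_eq_iff_index_eq subset_iff)
    then show ?thesis
      using sum_nth_image[OF ls(1), of "T' - P" "\<lambda>i. (x $ i)\<^sup>2"] by (auto simp: T'_def)
  qed
  moreover have "(\<Sum>p\<in>P - T'. (?a p)\<^sup>2) = (\<Sum>i\<in>?S - T. (x $ i)\<^sup>2)"
  proof -
    have "(!) ls ` (P - T') = ?S - T"
      using P(1) by (auto simp: T'_def)
    then show ?thesis
      using sum_nth_image[OF ls(1), of "P - T'" "\<lambda>i. (x $ i)\<^sup>2"] P(1) by auto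
  qed
  moreover define G where "G = k * (F / B)"
  moreover have "4 * (\<Sum>p\<in>T'. (u p)\<^sup>2) \<le> 800 * G"
  proof -
    have "(\<Sum>p\<in>T'. (u p)\<^sup>2) = 2 / d * (\<Sum>p\<in>T'. \<Sum>r<d. (e r (ls ! p))\<^sup>2)"
      unfolding u_def by (simp add: sum_nonneg sum_distrib_left)
    also have "(\<Sum>p\<in>T'. \<Sum>r<d. (e r (ls ! p))\<^sup>2) = (\<Sum>i\<in>T. \<Sum>r<d. (e r i)\<^sup>2)"
      using sum_nth_image[OF ls(1), of T' "\<lambda>i. \<Sum>r<d. (e r i)\<^sup>2"] T'T by (auto simp: T'_def)
    also have "2 / d * (\<Sum>i\<in>T. \<Sum>r<d. (e r i)\<^sup>2) \<le> 2 / d * (100 * (real k * real d * (F / B)))"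
      using little_noise by (intro mult_left_mono) auto
    also have "\<dots> = 200 * G" using pos by (simp add: G_def)
    finally show ?thesis by simp
  qed
  moreover have "4 * real k * \<tau>\<^sup>2 = 512 * G"
    using F by (simp add: \<tau>_def G_def)
  ultimately have main: "(\<Sum>i\<in>T - ?S. (x $ i)\<^sup>2) \<le> (\<Sum>i\<in>?S - T. (x $ i)\<^sup>2) + 1312 * G"
    by linarith
  have Sn: "?S \<subseteq> {..<n}" and Tn: "T \<subseteq> {..<n}"
    using P(1) lsn T ls by (auto simp: subset_iff)
  \<comment> \<open>The errors of the output and of \<open>T\<close> share the coordinates outside
    both sets, so they differ exactly by the two sums over set differences compared in
    \<open>main\<close>.\<close>
  have split: "(\<Sum>j\<in>{..<n} - A. (x $ j)\<^sup>2) =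
      (\<Sum>j\<in>{..<n} - (A \<union> C). (x $ j)\<^sup>2) + (\<Sum>j\<in>C - A. (x $ j)\<^sup>2)" if "C \<subseteq> {..<n}" for A C
  proof -
    have "{..<n} - A - (C - A) = {..<n} - (A \<union> C)" by auto
    then show ?thesis
      using sum.subset_diff[of "C - A" "{..<n} - A" "\<lambda>j. (x $ j)\<^sup>2"] that by auto
  qed
  show ?thesis
    using main split[OF Tn, of ?S] split[OF Sn, of T] by (simp add: Un_commute G_def)
qed

section \<open>Success probability, parameters and the final bound\<close>

lemma l2_norm_nonneg: "0 \<le> l2_norm x"
  by (simp add: l2_norm_def)

lemma success_probability:
  fixes x :: "real Matrix.vec"
  assumes B: "0 < B" "128 * card L \<le> B" and L: "L \<subseteq> {..<n}" and T: "T \<subseteq> L" "card T \<le> k"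
    and k: "100 * (card L / 4 ^ d) \<le> real k"
  shows "measure_pmf.prob (hash_pmf d n B)
    {f. card {i\<in>L. d \<le> 2 * card {r. r < d \<and> bad_row n B (($) x) L i (f r)}} \<le> k \<and>
        (\<Sum>i\<in>T. \<Sum>r<d. (noise n (($) x) L (f r) i)\<^sup>2) \<le> 100 * (real k * real d * ((\<Sum>j\<in>{..<n} - L. (x $ j)\<^sup>2) / B))}
      \<ge> 9 / 10"
proof -
  let ?P = "measure_pmf.prob (hash_pmf d n B)"
  let ?A = "{f. k < card {i\<in>L. d \<le> 2 * card {r. r < d \<and> bad_row n B (($) x) L i (f r)}}}"
  let ?C = "{f. 100 * (real k * real d * ((\<Sum>j\<in>{..<n} - L. (x $ j)\<^sup>2) / B)) < (\<Sum>i\<in>T. \<Sum>r<d. (noise n (($) x) L (f r) i)\<^sup>2)}"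
  have "?P (?A \<union> ?C) \<le> ?P ?A + ?P ?C" by (rule measure_Un_le) auto
  also have "?P ?A \<le> 1 / 100" by (rule prob_many_bad[OF B L k])
  also have "?P ?C \<le> 1 / 100" by (rule prob_much_noise[OF B(1) T(1) L T(2)])
  finally have "?P (?A \<union> ?C) \<le> 1 / 10" by simp
  moreover have "?P (UNIV - (?A \<union> ?C)) = 1 - ?P (?A \<union> ?C)"
    using measure_pmf.prob_compl[of "?A \<union> ?C" "hash_pmf d n B"] by simp
  moreover have "UNIV - (?A \<union> ?C) =
     {f. card {i\<in>L. d \<le> 2 * card {r. r < d \<and> bad_row n B (($) x) L i (f r)}} \<le> k \<and>
        (\<Sum>i\<in>T. \<Sum>r<d. (noise n (($) x) L (f r) i)\<^sup>2) \<le> 100 * (real k * real d * ((\<Sum>j\<in>{..<n} - L. (x $ j)\<^sup>2) / B))}"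
    by auto
  ultimately show ?thesis by simp
qed

text \<open>\<open>d\<close> is chosen such that \<open>exp d\<close>, and hence
  \<open>4 ^ d\<close>, is at least \<open>100 * C / \<epsilon>\<close>; this makes the expected
  number of elements with many bad rows at most k / 100. In the bound for \<open>d\<close>, the 2
  stands for the rounding and for \<open>ln (1 / \<epsilon>)\<close>, each at most
  \<open>log_inv \<epsilon>\<close>. The rounding of \<open>B\<close> turns 128 into 129, since
  \<open>C * k / \<epsilon>\<close> is at least 1.\<close>

lemma dimension_bounds:
  fixes C \<epsilon> :: real and k :: nat
  assumes C: "1 < C" and k: "0 < k" and \<epsilon>: "0 < \<epsilon>" "\<epsilon> < 1"
  defines "d \<equiv> nat \<lceil>ln (1 / \<epsilon>) + ln (100 * C)\<rceil>" and "B \<equiv> nat \<lceil>128 * (C * real k / \<epsilon>)\<rceil>"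
  shows "0 < d" "0 < B" "128 * (C * real k / \<epsilon>) \<le> real B"
    "real d \<le> (2 + ln (100 * C)) * log_inv \<epsilon>"
    "real (d * B) \<le> (2 + ln (100 * C)) * 129 * C * (real k / \<epsilon> * log_inv \<epsilon>)"
    "100 * (C * real k / \<epsilon> / 4 ^ d) \<le> real k"
proof -
  have ln: "0 < ln (1 / \<epsilon>)" "0 < ln (100 * C)" using C \<epsilon> by (auto intro: ln_gt_zero)
  have li: "1 \<le> log_inv \<epsilon>" "ln (1 / \<epsilon>) \<le> log_inv \<epsilon>" by (auto simp: log_inv_def)
  have d: "ln (1 / \<epsilon>) + ln (100 * C) \<le> d" "d \<le> ln (1 / \<epsilon>) + ln (100 * C) + 1"
    unfolding d_def using ln by linarith+
  with ln show "0 < d" by linarith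
  have "1 \<le> real k / \<epsilon>" using k \<epsilon> by (simp add: field_simps)
  then have q: "1 \<le> C * real k / \<epsilon>"
    using mult_mono[of 1 C 1 "real k / \<epsilon>"] C by simp
  have B: "128 * (C * real k / \<epsilon>) \<le> B" "B \<le> 128 * (C * real k / \<epsilon>) + 1"
    unfolding B_def using q by linarith+
  with q show "128 * (C * real k / \<epsilon>) \<le> real B" "0 < B" by linarith+
  have "ln (100 * C) * 1 \<le> ln (100 * C) * log_inv \<epsilon>"
    using ln li by (intro mult_left_mono) auto
  with d li show d': "real d \<le> (2 + ln (100 * C)) * log_inv \<epsilon>"
    by (simp add: algebra_simps)
  have "real (d * B) \<le> ((2 + ln (100 * C)) * log_inv \<epsilon>) * (129 * (C * real k / \<epsilon>))"
    unfolding of_nat_mult using d' B q by (intro mult_mono) auto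
  then show "real (d * B) \<le> (2 + ln (100 * C)) * 129 * C * (real k / \<epsilon> * log_inv \<epsilon>)"
    by (simp add: mult_ac)
  have "100 * C / \<epsilon> = exp (ln (1 / \<epsilon>) + ln (100 * C))"
    using C \<epsilon> by (simp add: exp_add)
  also have "\<dots> \<le> exp (real d)" using d by simp
  also have "\<dots> = exp 1 ^ d" by (simp flip: exp_of_nat_mult)
  also have "\<dots> \<le> 4 ^ d" using exp_le by (intro power_mono) auto
  finally have "100 * C / \<epsilon> * real k / 4 ^ d \<le> 4 ^ d * real k / 4 ^ d"
    by (intro divide_right_mono mult_right_mono) auto
  then show "100 * (C * real k / \<epsilon> / 4 ^ d) \<le> real k" by simp
qed

text \<open>As \<open>F \<le> R \<le> 4 * E\<^sup>2\<close>, the added error is at most 1312 * 4 /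
  128 = 41 times \<open>\<epsilon> * E\<^sup>2\<close>. Squaring \<open>1 + \<epsilon>\<close> adds
  3, and the total 44 stays below 46, the linear coefficient of
  \<open>(1 + 23 * \<epsilon>)\<^sup>2\<close>.\<close>

lemma error_bound:
  fixes E \<epsilon> R F q :: real
  assumes \<epsilon>: "0 < \<epsilon>" "\<epsilon> < 1" and E: "0 \<le> E" and R: "R \<le> ((1 + \<epsilon>) * E)\<^sup>2" and F: "0 \<le> F" "F \<le> R"
    and q: "q \<le> \<epsilon> / 128" and l: "l\<^sup>2 \<le> R + 1312 * (q * F)"
  shows "l \<le> (1 + 23 * \<epsilon>) * E"
proof (rule power2_le_imp_le)
  have e2: "\<epsilon> * \<epsilon> \<le> \<epsilon>" using \<epsilon> by (simp add: mult_left_le)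
  have R': "R \<le> (1 + 3 * \<epsilon>) * E\<^sup>2"
  proof -
    have "(1 + \<epsilon>)\<^sup>2 \<le> 1 + 3 * \<epsilon>" using e2 by (simp add: power2_eq_square algebra_simps)
    then have "(1 + \<epsilon>)\<^sup>2 * E\<^sup>2 \<le> (1 + 3 * \<epsilon>) * E\<^sup>2" by (rule mult_right_mono) simp
    with R show ?thesis by (simp add: power_mult_distrib)
  qed
  also have "\<dots> \<le> 4 * E\<^sup>2" using \<epsilon> by (intro mult_right_mono) auto
  finally have R4: "R \<le> 4 * E\<^sup>2" .
  define G H where "G = q * F" and "H = \<epsilon> * E\<^sup>2"
  have "G \<le> \<epsilon> / 128 * (4 * E\<^sup>2)"
    unfolding G_def using q F R4 \<epsilon> by (intro mult_mono) auto
  then have "32 * G \<le> H" by (simp add: H_def)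
  moreover have "0 \<le> H" using \<epsilon> by (simp add: H_def)
  moreover have "(1 + 3 * \<epsilon>) * E\<^sup>2 = E\<^sup>2 + 3 * H" "(1 + 46 * \<epsilon>) * E\<^sup>2 = E\<^sup>2 + 46 * H"
    by (simp_all add: H_def algebra_simps)
  ultimately have "l\<^sup>2 \<le> (1 + 46 * \<epsilon>) * E\<^sup>2"
    using l R' unfolding G_def[symmetric] by linarith
  also have "\<dots> \<le> ((1 + 23 * \<epsilon>) * E)\<^sup>2"
  proof -
    have "1 + 46 * \<epsilon> \<le> (1 + 23 * \<epsilon>)\<^sup>2" by (simp add: power2_eq_square algebra_simps)
    then have "(1 + 46 * \<epsilon>) * E\<^sup>2 \<le> (1 + 23 * \<epsilon>)\<^sup>2 * E\<^sup>2" by (rule mult_right_mono) simp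
    then show ?thesis by (simp add: power_mult_distrib)
  qed
  finally show "l\<^sup>2 \<le> ((1 + 23 * \<epsilon>) * E)\<^sup>2" .
qed (use \<epsilon> E in simp)

theorem theoremB1:
  "\<exists>\<alpha>::real. \<alpha> > 1 \<and> (\<exists>\<beta>::real. \<beta> > 1 \<and> (\<forall>C_L::real. C_L > 1 \<longrightarrow>
    (\<exists>(C_m::real) (C_s::real) (C_t::real) (P::com) (w::nat).
      \<forall>(n::nat) (k::nat) (\<epsilon>::real). n > 0 \<longrightarrow> k > 0 \<longrightarrow> 0 < \<epsilon> \<longrightarrow> \<epsilon> < 1 \<longrightarrow>
      (\<exists>(m::nat) (D :: real mat pmf).
        real m \<le> C_m * (real k / \<epsilon> * log_inv \<epsilon>) \<and>
        (\<forall>\<Phi> \<in> set_pmf D. \<Phi> \<in> carrier_mat m n \<and>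
            real (column_sparsity \<Phi>) \<le> C_s * log_inv \<epsilon>) \<and>
        (\<forall>x \<in> carrier_vec n. \<forall>L ls.
          L \<subseteq> {..<n} \<longrightarrow>
          real (card L) = C_L * real k / \<epsilon> \<longrightarrow>
          (\<exists>T. T \<subseteq> L \<and> card T \<le> k \<and>
             l2_norm (x - restr x T) \<le> (1 + \<epsilon>) * l2_norm (tail x k)) \<longrightarrow>
          distinct ls \<longrightarrow> set ls = L \<longrightarrow>
          (\<forall>\<Phi> \<in> set_pmf D. \<exists>t s.
             exec ((n + m + 2) ^ w) P (decoder_input n k \<epsilon> \<Phi> (\<Phi> *\<^sub>v x) ls) t s \<and>
             real t \<le> C_t * real m \<and>
             decoder_output s \<subseteq> {..<n} \<and>
             real (card (decoder_output s)) \<le> \<beta> * real k) \<and>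
          measure_pmf.prob D {\<Phi>. \<exists>t s.
             exec ((n + m + 2) ^ w) P (decoder_input n k \<epsilon> \<Phi> (\<Phi> *\<^sub>v x) ls) t s \<and>
             l2_norm (x - restr x (decoder_output s)) \<le> (1 + \<alpha> * \<epsilon>) * l2_norm (tail x k)}
            \<ge> 9 / 10)))))"
proof (rule exI[of _ 23], rule conjI, simp, rule exI[of _ 3], rule conjI, simp, intro allI impI)
  fix C :: real assume C: "1 < C"
  show "\<exists>(C_m::real) (C_s::real) (C_t::real) (P::com) (w::nat).
      \<forall>(n::nat) (k::nat) (\<epsilon>::real). n > 0 \<longrightarrow> k > 0 \<longrightarrow> 0 < \<epsilon> \<longrightarrow> \<epsilon> < 1 \<longrightarrow>
      (\<exists>(m::nat) (D :: real mat pmf).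
        real m \<le> C_m * (real k / \<epsilon> * log_inv \<epsilon>) \<and>
        (\<forall>\<Phi> \<in> set_pmf D. \<Phi> \<in> carrier_mat m n \<and>
            real (column_sparsity \<Phi>) \<le> C_s * log_inv \<epsilon>) \<and>
        (\<forall>x \<in> carrier_vec n. \<forall>L ls.
          L \<subseteq> {..<n} \<longrightarrow>
          real (card L) = C * real k / \<epsilon> \<longrightarrow>
          (\<exists>T. T \<subseteq> L \<and> card T \<le> k \<and>
             l2_norm (x - restr x T) \<le> (1 + \<epsilon>) * l2_norm (tail x k)) \<longrightarrow>
          distinct ls \<longrightarrow> set ls = L \<longrightarrow>
          (\<forall>\<Phi> \<in> set_pmf D. \<exists>t s.
             exec ((n + m + 2) ^ w) P (decoder_input n k \<epsilon> \<Phi> (\<Phi> *\<^sub>v x) ls) t s \<and>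
             real t \<le> C_t * real m \<and>
             decoder_output s \<subseteq> {..<n} \<and>
             real (card (decoder_output s)) \<le> 3 * real k) \<and>
          measure_pmf.prob D {\<Phi>. \<exists>t s.
             exec ((n + m + 2) ^ w) P (decoder_input n k \<epsilon> \<Phi> (\<Phi> *\<^sub>v x) ls) t s \<and>
             l2_norm (x - restr x (decoder_output s)) \<le> (1 + 23 * \<epsilon>) * l2_norm (tail x k)}
            \<ge> 9 / 10))"
  \<comment> \<open>The constant \<open>C\<close> enters only through \<open>d\<close> and
    \<open>B\<close>; program, time constant and exponent of the word bound are the same for every
    \<open>C\<close>.\<close>
  proof (rule exI[of _ "(2 + ln (100 * C)) * 129 * C"], rule exI[of _ "2 + ln (100 * C)"],
      rule exI[of _ 506], rule exI[of _ decoder], rule exI[of _ 3], intro allI impI)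
    fix n k :: nat and \<epsilon> :: real
    assume n: "0 < n" and k: "0 < k" and \<epsilon>: "0 < \<epsilon>" "\<epsilon> < 1"
    define d where "d = nat \<lceil>ln (1 / \<epsilon>) + ln (100 * C)\<rceil>"
    define B where "B = nat \<lceil>128 * (C * real k / \<epsilon>)\<rceil>"
    note par = dimension_bounds[OF C k \<epsilon>, folded d_def B_def]
    define D where "D = map_pmf (sketch d n B) (hash_pmf d n B)"
    have hash: "fst (f r j) < B" if "f \<in> set_pmf (hash_pmf d n B)" "r < d" "j < n" for f r j
      using hash_bucket_less[OF par(2) that] .
    have set_D: "\<exists>f \<in> set_pmf (hash_pmf d n B). \<Phi> = sketch d n B f" if "\<Phi> \<in> set_pmf D" for \<Phi>
      using that by (auto simp: D_def)
    show "\<exists>(m::nat) (D :: real mat pmf).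
        real m \<le> (2 + ln (100 * C)) * 129 * C * (real k / \<epsilon> * log_inv \<epsilon>) \<and>
        (\<forall>\<Phi> \<in> set_pmf D. \<Phi> \<in> carrier_mat m n \<and>
            real (column_sparsity \<Phi>) \<le> (2 + ln (100 * C)) * log_inv \<epsilon>) \<and>
        (\<forall>x \<in> carrier_vec n. \<forall>L ls.
          L \<subseteq> {..<n} \<longrightarrow>
          real (card L) = C * real k / \<epsilon> \<longrightarrow>
          (\<exists>T. T \<subseteq> L \<and> card T \<le> k \<and>
             l2_norm (x - restr x T) \<le> (1 + \<epsilon>) * l2_norm (tail x k)) \<longrightarrow>
          distinct ls \<longrightarrow> set ls = L \<longrightarrow>
          (\<forall>\<Phi> \<in> set_pmf D. \<exists>t s.
             exec ((n + m + 2) ^ 3) decoder (decoder_input n k \<epsilon> \<Phi> (\<Phi> *\<^sub>v x) ls) t s \<and>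
             real t \<le> 506 * real m \<and>
             decoder_output s \<subseteq> {..<n} \<and>
             real (card (decoder_output s)) \<le> 3 * real k) \<and>
          measure_pmf.prob D {\<Phi>. \<exists>t s.
             exec ((n + m + 2) ^ 3) decoder (decoder_input n k \<epsilon> \<Phi> (\<Phi> *\<^sub>v x) ls) t s \<and>
             l2_norm (x - restr x (decoder_output s)) \<le> (1 + 23 * \<epsilon>) * l2_norm (tail x k)}
            \<ge> 9 / 10)"
    proof (rule exI[of _ "d * B"], rule exI[of _ D], intro conjI ballI allI impI)
      show "real (d * B) \<le> (2 + ln (100 * C)) * 129 * C * (real k / \<epsilon> * log_inv \<epsilon>)"
        by (rule par(5))
    next
      fix \<Phi> assume "\<Phi> \<in> set_pmf D"
      then obtain f where f: "f \<in> set_pmf (hash_pmf d n B)" "\<Phi> = sketch d n B f"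
        using set_D by blast
      show "\<Phi> \<in> carrier_mat (d * B) n"
        unfolding f(2) by (rule sketch_carrier)
      have "column_sparsity \<Phi> \<le> d"
        unfolding f(2) by (rule column_sparsity_sketch[OF n hash[OF f(1)]])
      with par(4) show "real (column_sparsity \<Phi>) \<le> (2 + ln (100 * C)) * log_inv \<epsilon>"
        by linarith
    next
      fix x :: "real Matrix.vec" and L ls
      assume x: "x \<in> carrier_vec n" and L: "L \<subseteq> {..<n}" and card_L: "real (card L) = C * real k / \<epsilon>"
        and ls: "distinct ls" "set ls = L"
      have len: "length ls = card L" using ls distinct_card by fastforce
      \<comment> \<open>As \<open>C / \<epsilon>\<close> exceeds 1, \<open>L\<close> has at least
        \<open>k\<close> elements. This bounds \<open>k\<close> by the size of the input, so that
        \<open>3 * k\<close> fits into a word.\<close>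
      have kL: "k \<le> card L"
      proof -
        have "real k * \<epsilon> \<le> C * real k" using C \<epsilon> k by (simp add: mult.commute mult_mono)
        then have "real k \<le> C * real k / \<epsilon>" using \<epsilon> by (simp add: field_simps)
        then show ?thesis using card_L by linarith
      qed
      have LB: "128 * card L \<le> B"
        using par(3) card_L by linarith
      have mult: "sketch d n B f *\<^sub>v x \<in> carrier_vec (d * B)" for f
        using sketch_carrier x by (rule mult_mat_vec_carrier)
      have run: "\<exists>t s z P M v. exec ((n + d * B + 2) ^ 3) decoder
            (decoder_input n k \<epsilon> (sketch d n B f) (sketch d n B f *\<^sub>v x) ls) t s \<and>
          t \<le> 506 * (d * B) \<and> decoder_output s = (!) ls ` P \<and>
          P \<subseteq> {..<length ls} \<and> card P = min (length ls) (3 * k) \<and> (\<forall>p\<in>P. v \<le> z p) \<and>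
          (\<forall>p<length ls. p \<notin> P \<longrightarrow> z p \<le> v) \<and> (\<forall>b<d * B. \<bar>(sketch d n B f *\<^sub>v x) $ b\<bar> < M) \<and>
          (\<forall>p<length ls. is_qth (map (\<lambda>r.
            if \<forall>j\<in>set ls - {ls ! p}. fst (f r j) \<noteq> fst (f r (ls ! p))
            then \<bar>(sketch d n B f *\<^sub>v x) $ (r * B + fst (f r (ls ! p)))\<bar> else M) [0..<d]) (d div 2) (z p))"
        if f: "f \<in> set_pmf (hash_pmf d n B)" for f
        apply (rule decoder_run[OF hash[OF f] par(2,1) k ls(1) _ _ _ mult[of f], where \<epsilon> = \<epsilon>])
           apply assumption+
        using L ls kL LB len apply simp_all[3]
        subgoal premises prems for t s z P M v
          by (intro exI[of _ t] exI[of _ s] exI[of _ z] exI[of _ P] exI[of _ M] exI[of _ v] conjI ballI allI impI;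
              (rule prems | assumption)+)
        done
      \<comment> \<open>Time and output size follow from the course of the program alone, for every
        matrix in the support; chance decides only about the quality.\<close>
      show "\<exists>t s. exec ((n + d * B + 2) ^ 3) decoder (decoder_input n k \<epsilon> \<Phi> (\<Phi> *\<^sub>v x) ls) t s \<and>
             real t \<le> 506 * real (d * B) \<and> decoder_output s \<subseteq> {..<n} \<and>
             real (card (decoder_output s)) \<le> 3 * real k"
        if "\<Phi> \<in> set_pmf D" for \<Phi>
      proof -
        obtain f where f: "f \<in> set_pmf (hash_pmf d n B)" "\<Phi> = sketch d n B f"
          using set_D \<open>\<Phi> \<in> set_pmf D\<close> by blast
        from run[OF f(1)] obtain t s P where r: "exec ((n + d * B + 2) ^ 3) decoder
            (decoder_input n k \<epsilon> \<Phi> (\<Phi> *\<^sub>v x) ls) t s" "t \<le> 506 * (d * B)"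
          "decoder_output s = (!) ls ` P" "P \<subseteq> {..<length ls}" "card P = min (length ls) (3 * k)"
          unfolding f(2) by blast
        have "real t \<le> real (506 * (d * B))" using r(2) by (simp only: of_nat_le_iff)
        moreover have "decoder_output s \<subseteq> {..<n}"
          using r(3,4) ls L by force
        moreover have "card (decoder_output s) \<le> 3 * k"
          using card_image_le[of P "(!) ls"] r(3-5) finite_subset[OF r(4)] by simp
        ultimately show ?thesis using r(1) by (intro exI[of _ t] exI[of _ s]) simp
      qed
      assume "\<exists>T. T \<subseteq> L \<and> card T \<le> k \<and>
             l2_norm (x - restr x T) \<le> (1 + \<epsilon>) * l2_norm (tail x k)"
      then obtain T where T: "T \<subseteq> L" "card T \<le> k"
        "l2_norm (x - restr x T) \<le> (1 + \<epsilon>) * l2_norm (tail x k)" by blast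
      let ?F = "\<Sum>j\<in>{..<n} - L. (x $ j)\<^sup>2" and ?E = "l2_norm (tail x k)"
      let ?good = "{f. card {i\<in>L. d \<le> 2 * card {r. r < d \<and> bad_row n B (($) x) L i (f r)}} \<le> k \<and>
        (\<Sum>i\<in>T. \<Sum>r<d. (noise n (($) x) L (f r) i)\<^sup>2) \<le> 100 * (real k * real d * (?F / B))}"
      let ?success = "{\<Phi>. \<exists>t s.
             exec ((n + d * B + 2) ^ 3) decoder (decoder_input n k \<epsilon> \<Phi> (\<Phi> *\<^sub>v x) ls) t s \<and>
             l2_norm (x - restr x (decoder_output s)) \<le> (1 + 23 * \<epsilon>) * ?E}"
      have success: "sketch d n B f \<in> ?success" if f: "f \<in> set_pmf (hash_pmf d n B)" "f \<in> ?good" for f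
      proof -
        from run[OF f(1)] obtain t s z P M v where r: "exec ((n + d * B + 2) ^ 3) decoder
            (decoder_input n k \<epsilon> (sketch d n B f) (sketch d n B f *\<^sub>v x) ls) t s"
          "decoder_output s = (!) ls ` P" "P \<subseteq> {..<length ls}" "card P = min (length ls) (3 * k)"
          "\<forall>p\<in>P. v \<le> z p" "\<forall>p<length ls. p \<notin> P \<longrightarrow> z p \<le> v"
          "\<forall>b<d * B. \<bar>(sketch d n B f *\<^sub>v x) $ b\<bar> < M"
          "\<forall>p<length ls. is_qth (map (\<lambda>r.
            if \<forall>j\<in>set ls - {ls ! p}. fst (f r j) \<noteq> fst (f r (ls ! p))
            then \<bar>(sketch d n B f *\<^sub>v x) $ (r * B + fst (f r (ls ! p)))\<bar> else M) [0..<d]) (d div 2) (z p)"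
          by blast
        have "(\<Sum>j\<in>{..<n} - (!) ls ` P. (x $ j)\<^sup>2) \<le>
            (\<Sum>j\<in>{..<n} - T. (x $ j)\<^sup>2) + 1312 * (k * ((\<Sum>j\<in>{..<n} - set ls. (x $ j)\<^sup>2) / B))"
          by (rule decoder_quality[OF hash[OF f(1)] par(2,1) k ls(1) _ x, where v = v and z = z and M = M])
            (use r(3-8) L ls T f(2) in auto)
        then have "(l2_norm (x - restr x (decoder_output s)))\<^sup>2 \<le>
          (l2_norm (x - restr x T))\<^sup>2 + 1312 * (real k / B * ?F)"
          unfolding r(2) l2_norm_minus_restr[OF x] ls(2) by simp
        moreover have "(l2_norm (x - restr x T))\<^sup>2 \<le> ((1 + \<epsilon>) * ?E)\<^sup>2"
          using T(3) l2_norm_nonneg by (intro power_mono) auto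
        moreover have "?F \<le> (l2_norm (x - restr x T))\<^sup>2"
          unfolding l2_norm_minus_restr[OF x] using T(1) by (intro sum_mono2) auto
        \<comment> \<open>Here the factor 128 in \<open>B\<close> and \<open>C > 1\<close> turn the
          variance bound into a fraction of \<epsilon>.\<close>
        moreover have "real k / B \<le> \<epsilon> / 128"
        proof -
          have "128 * (1 * real k / \<epsilon>) \<le> 128 * (C * real k / \<epsilon>)"
            using C \<epsilon> by (intro mult_left_mono divide_right_mono mult_right_mono) auto
          also note par(3)
          finally show ?thesis using \<epsilon> par(2) by (simp add: field_simps)
        qed
        ultimately have "l2_norm (x - restr x (decoder_output s)) \<le> (1 + 23 * \<epsilon>) * ?E"
          using \<epsilon> by (intro error_bound[of \<epsilon> ?E "(l2_norm (x - restr x T))\<^sup>2" ?F "real k / B"])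
            (auto simp: l2_norm_nonneg sum_nonneg)
        with r(1) show ?thesis by blast
      qed
      have "9 / 10 \<le> measure_pmf.prob (hash_pmf d n B) ?good"
        by (rule success_probability) (use par(2,6) card_L LB L T in auto)
      \<comment> \<open>Bucket indices are known to be below \<open>B\<close> only on the support,
        so success is shown there.\<close>
      also have "\<dots> = measure_pmf.prob (hash_pmf d n B) (?good \<inter> set_pmf (hash_pmf d n B))"
        by (rule measure_Int_set_pmf[symmetric])
      also have "\<dots> \<le> measure_pmf.prob (hash_pmf d n B) (sketch d n B -` ?success)"
        using success by (intro measure_pmf.finite_measure_mono) auto
      also have "\<dots> = measure_pmf.prob D ?success"
        by (simp add: D_def)
      finally show "measure_pmf.prob D ?success \<ge> 9 / 10" .
    qed
  qed
qed

end
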